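(* Let $k$ be a field, $0\neq q\in k$, and let $m\le n$ be positive integers. The products $[T]$, as $T$ runs over all preferred $m$-tableaux (with entries from $\{1,\dots,n\}$), form a $k$-basis of the quantum grassmannian $\mathcal{G}_q(m,n)$.
   Context: $\mathcal{O}_q(M_{mn})$ is the (unital associative) $k$-algebra generated by $X_{ij}$, $1\le i\le m$, $1\le j\le n$, subject to the relations, for $1\le i<k\le m$ and $1\le j<l\le n$: $X_{ij}X_{il}=qX_{il}X_{ij}$, $X_{ij}X_{kj}=qX_{kj}X_{ij}$, $X_{il}X_{kj}=X_{kj}X_{il}$, $X_{ij}X_{kl}-X_{kl}X_{ij}=(q-q^{-1})X_{il}X_{kj}$. For an $m$-element subset $J=\{j_1<\dots<j_m\}\subseteq\{1,\dots,n\}$ the maximal quantum minor is $[J]=\sum_{\sigma\in S_m}(-q)^{\ell(\sigma)}X_{1 j_{\sigma(1)}}\cdots X_{m j_{\sigma(m)}}$, where $\ell(\sigma)$ is the length of $\sigma$. The quantum grassmannian $\mathcal{G}_q(m,n)$ is the $k$-subalgebra of $\mathcal{O}_q(M_{mn})$ generated by all the $[J]$. For $m$-element subsets $A=\{a_1<\dots<a_m\}$ and $B=\{b_1<\dots<b_m\}$ of $\{1,\dots,n\}$, $A\le_* B$ means $a_i\le b_i$ for $i=1,\dots,m$. An allowable $m$-tableau $T$ is a finite sequence of rows $J_1,\dots,J_s$ ($s\ge 0$), each row being a strictly increasing sequence of $m$ elements of $\{1,\dots,n\}$, identified with an $m$-element subset. $T$ is preferred if $J_1\le_* J_2\le_*\dots\le_*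 J_s$. Set $[T]=[J_1][J_2]\cdots[J_s]$, the empty tableau ($s=0$) being preferred with $[T]=1$. *)

theory Defs
  imports
    "HOL-Algebra.QuotRing"
    "HOL-Algebra.Subrings"
    "HOL-Library.Poly_Mapping"
    "HOL-Combinatorics.Permutations"
    "Jordan_Normal_Form.VS_Connect"
begin

text \<open>
  Algebras over a field are records of type \<^typ>\<open>('k, 'a) module\<close> (a ring together with a scalar
  multiplication), the scalars being \<^term>\<open>class_ring :: 'k::field ring\<close>. The locale
  \<^locale>\<open>algebra\<close> of the library is not used, because it assumes commutativity.
\<close>

section \<open>Free algebras\<close>

text \<open>
  The words over an alphabet are wrapped in a type of their own, on which the additively written
  monoid operation is concatenation. The convolution product of \<^theory>\<open>HOL-Library.Poly_Mapping\<close>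
  then is the multiplication of noncommutative polynomials.
\<close>

datatype 'a free_monoid = Word (letters: "'a list")

instantiation free_monoid :: (type) monoid_add
begin

definition zero_free_monoid :: "'a free_monoid"
  where "0 = Word []"

definition plus_free_monoid :: "'a free_monoid \<Rightarrow> 'a free_monoid \<Rightarrow> 'a free_monoid"
  where "v + w = Word (letters v @ letters w)"

instance
  by standard (simp_all add: zero_free_monoid_def plus_free_monoid_def)

end

definition gen :: "'a \<Rightarrow> 'a free_monoid \<Rightarrow>\<^sub>0 'k::field"
  where "gen x = Poly_Mapping.single (Word [x]) 1"

definition free_algebra :: "'a set \<Rightarrow> ('k::field, 'a free_monoid \<Rightarrow>\<^sub>0 'k) module"
  where "free_algebra G =
    \<lparr>carrier = {f. \<forall>w \<in> Poly_Mapping.keys f. set (letters w) \<subseteq> G},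
     mult = (*), one = 1, zero = 0, add = (+),
     smult = (\<lambda>c f. Poly_Mapping.single 0 c * f)\<rparr>"

section \<open>Quotient algebras and generated subalgebras\<close>

definition quot_algebra :: "('k, 'a) module \<Rightarrow> 'a set \<Rightarrow> ('k, 'a set) module"
  where "quot_algebra A I = ring.extend (A Quot I)
    (module.fields (\<lambda>c U. \<Union>x\<in>U. I +>\<^bsub>A\<^esub> (c \<odot>\<^bsub>A\<^esub> x)))"

definition is_subalgebra :: "('k::field, 'a) module \<Rightarrow> 'a set \<Rightarrow> bool"
  where "is_subalgebra A B \<longleftrightarrow> subring B A \<and> Module.submodule B (class_ring :: 'k ring) A"

definition generated_subalgebra :: "('k::field, 'a) module \<Rightarrow> 'a set \<Rightarrow> ('k, 'a) module"
  where "generated_subalgebra A S = A\<lparr>carrier := is_subalgebra A hull S\<rparr>"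

definition list_prod :: "('a, 'b) monoid_scheme \<Rightarrow> 'a list \<Rightarrow> 'a"
  where "list_prod A xs = foldr (\<otimes>\<^bsub>A\<^esub>) xs \<one>\<^bsub>A\<^esub>"

section \<open>Quantum matrices\<close>

definition indices :: "nat \<Rightarrow> nat \<Rightarrow> (nat \<times> nat) set"
  where "indices m n = {1..m} \<times> {1..n}"

definition qmat_relators :: "nat \<Rightarrow> nat \<Rightarrow> 'k::field \<Rightarrow> ((nat \<times> nat) free_monoid \<Rightarrow>\<^sub>0 'k) set"
  where "qmat_relators m n q =
    (let X = (\<lambda>i j. gen (i, j)); s = (\<lambda>c f. Poly_Mapping.single 0 c * f) in
      {X i j * X i l - s q (X i l * X i j) | i j l.
        i \<in> {1..m} \<and> 1 \<le> j \<and> j < l \<and> l \<le> n} \<union>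
      {X i j * X k j - s q (X k j * X i j) | i j k.
        1 \<le> i \<and> i < k \<and> k \<le> m \<and> j \<in> {1..n}} \<union>
      {X i l * X k j - X k j * X i l | i j k l.
        1 \<le> i \<and> i < k \<and> k \<le> m \<and> 1 \<le> j \<and> j < l \<and> l \<le> n} \<union>
      {X i j * X k l - X k l * X i j - s (q - inverse q) (X i l * X k j) | i j k l.
        1 \<le> i \<and> i < k \<and> k \<le> m \<and> 1 \<le> j \<and> j < l \<and> l \<le> n})"

definition qmat_ideal :: "nat \<Rightarrow> nat \<Rightarrow> 'k::field \<Rightarrow> ((nat \<times> nat) free_monoid \<Rightarrow>\<^sub>0 'k) set"
  where "qmat_ideal m n q =
    genideal (free_algebra (indices m n) :: ('k, _) module) (qmat_relators m n q)"

definition qmat :: "nat \<Rightarrow> nat \<Rightarrow> 'k::field \<Rightarrow> ('k, ((nat \<times> nat) free_monoid \<Rightarrow>\<^sub>0 'k) set) module"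
  where "qmat m n q = quot_algebra (free_algebra (indices m n)) (qmat_ideal m n q)"

definition qmat_gen :: "nat \<Rightarrow> nat \<Rightarrow> 'k::field \<Rightarrow> nat \<Rightarrow> nat \<Rightarrow> ((nat \<times> nat) free_monoid \<Rightarrow>\<^sub>0 'k) set"
  where "qmat_gen m n q i j =
    qmat_ideal m n q +>\<^bsub>free_algebra (indices m n) :: ('k, _) module\<^esub> gen (i, j)"

section \<open>Maximal quantum minors and the quantum grassmannian\<close>

text \<open>
  An \<open>m\<close>-element subset of \<open>{1..n}\<close> is represented by the increasing list of its elements.
\<close>

definition increasing_rows :: "nat \<Rightarrow> nat \<Rightarrow> nat list set"
  where "increasing_rows m n = {J. length J = m \<and> set J \<subseteq> {1..n} \<and> sorted_wrt (<) J}"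

definition perm_length :: "nat \<Rightarrow> (nat \<Rightarrow> nat) \<Rightarrow> nat"
  where "perm_length m \<sigma> = card {(i, j). i < j \<and> j < m \<and> \<sigma> j < \<sigma> i}"

text \<open>Lists and permutations are indexed from \<open>0\<close>, the rows of the matrix from \<open>1\<close>.\<close>

definition qminor :: "nat \<Rightarrow> nat \<Rightarrow> 'k::field \<Rightarrow> nat list \<Rightarrow> ((nat \<times> nat) free_monoid \<Rightarrow>\<^sub>0 'k) set"
  where "qminor m n q J =
    (\<Oplus>\<^bsub>qmat m n q\<^esub> \<sigma> \<in> {\<sigma>. \<sigma> permutes {..<m}}.
      (- q) ^ perm_length m \<sigma> \<odot>\<^bsub>qmat m n q\<^esub>
        list_prod (qmat m n q) (map (\<lambda>i. qmat_gen m n q (Suc i) (J ! \<sigma> i)) [0..<m]))"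

definition qgrass :: "nat \<Rightarrow> nat \<Rightarrow> 'k::field \<Rightarrow> ('k, ((nat \<times> nat) free_monoid \<Rightarrow>\<^sub>0 'k) set) module"
  where "qgrass m n q = generated_subalgebra (qmat m n q) (qminor m n q ` increasing_rows m n)"

definition preferred_tableaux :: "nat \<Rightarrow> nat \<Rightarrow> nat list list set"
  where "preferred_tableaux m n = {T. set T \<subseteq> increasing_rows m n \<and> successively (list_all2 (\<le>)) T}"

definition tableau_prod ::
    "nat \<Rightarrow> nat \<Rightarrow> 'k::field \<Rightarrow> nat list list \<Rightarrow> ((nat \<times> nat) free_monoid \<Rightarrow>\<^sub>0 'k) set"
  where "tableau_prod m n q T = list_prod (qmat m n q) (map (qminor m n q) T)"

section \<open>Well-definedness\<close>

lemma keys_single_mult_subset: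
  "Poly_Mapping.keys (Poly_Mapping.single (0::'a free_monoid) (c::'k::field) * f) \<subseteq> Poly_Mapping.keys f"
proof -
  have "Poly_Mapping.keys (Poly_Mapping.single (0::'a free_monoid) c * f) \<subseteq>
      {a + b | a b. a \<in> Poly_Mapping.keys (Poly_Mapping.single (0::'a free_monoid) c) \<and> b \<in> Poly_Mapping.keys f}"
    by (rule keys_mult)
  also have "\<dots> \<subseteq> Poly_Mapping.keys f"
    by (auto split: if_splits)
  finally show ?thesis .
qed

lemma free_algebra_simps:
  "carrier (free_algebra G) = {f. \<forall>w \<in> Poly_Mapping.keys f. set (letters w) \<subseteq> G}"
  "mult (free_algebra G) = (*)"
  "one (free_algebra G) = 1"
  "zero (free_algebra G) = 0"
  "add (free_algebra G) = (+)"
  "module.smult (free_algebra G) = (\<lambda>c f. Poly_Mapping.single 0 c * f)"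
  by (simp_all add: free_algebra_def)

lemma free_algebra_add_closed:
  assumes "f \<in> carrier (free_algebra G)" "g \<in> carrier (free_algebra G)"
  shows "f + g \<in> carrier (free_algebra G)"
  using assms keys_add[of f g] by (auto simp: free_algebra_simps)

lemma free_algebra_mult_closed:
  assumes "f \<in> carrier (free_algebra G)" "g \<in> carrier (free_algebra G)"
  shows "f * g \<in> carrier (free_algebra G)"
  using assms keys_mult[of f g]
  by (fastforce simp: free_algebra_simps plus_free_monoid_def)

lemma free_algebra_smult_closed:
  assumes "f \<in> carrier (free_algebra G)"
  shows "Poly_Mapping.single 0 c * f \<in> carrier (free_algebra G)"
  using assms keys_single_mult_subset[of c f] by (auto simp: free_algebra_simps)

lemma free_algebra_uminus_closed:
  assumes "f \<in> carrier (free_algebra G)"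
  shows "- f \<in> carrier (free_algebra G)"
  using assms by (simp add: free_algebra_simps)

lemma free_algebra_minus_closed:
  assumes "f \<in> carrier (free_algebra G)" "g \<in> carrier (free_algebra G)"
  shows "f - g \<in> carrier (free_algebra G)"
  using free_algebra_add_closed[OF assms(1) free_algebra_uminus_closed[OF assms(2)]] by simp

lemma gen_closed:
  "x \<in> G \<Longrightarrow> gen x \<in> carrier (free_algebra G)"
  by (simp add: free_algebra_simps gen_def)

lemma free_algebra_ring: "ring (free_algebra G :: ('k::field, 'a free_monoid \<Rightarrow>\<^sub>0 'k) module)"
  (is "ring ?F")
proof (rule ringI)
  show "abelian_group (?F)"
  proof (rule abelian_groupI)
    fix x :: "'a free_monoid \<Rightarrow>\<^sub>0 'k"
    assume "x \<in> carrier (?F)"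
    then show "\<exists>y\<in>carrier (?F). y \<oplus>\<^bsub>?F\<^esub> x = \<zero>\<^bsub>?F\<^esub>"
      by (intro bexI[of _ "- x"]) (auto simp: free_algebra_simps)
  next
    fix x y :: "'a free_monoid \<Rightarrow>\<^sub>0 'k"
    assume "x \<in> carrier (?F)" "y \<in> carrier (?F)"
    then show "x \<oplus>\<^bsub>?F\<^esub> y \<in> carrier (?F)"
      using free_algebra_add_closed by (simp only: free_algebra_simps(5))
  qed (simp_all add: free_algebra_simps algebra_simps)
  show "monoid (?F)"
  proof (rule monoidI)
    fix x y :: "'a free_monoid \<Rightarrow>\<^sub>0 'k"
    assume "x \<in> carrier (?F)" "y \<in> carrier (?F)"
    then show "x \<otimes>\<^bsub>?F\<^esub> y \<in> carrier (?F)"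
      using free_algebra_mult_closed by (simp only: free_algebra_simps(2))
  next
    show "\<one>\<^bsub>?F\<^esub> \<in> carrier ?F"
      by (simp add: free_algebra_simps zero_free_monoid_def flip: single_one)
  qed (simp_all add: free_algebra_simps mult.assoc)
qed (simp_all add: free_algebra_simps algebra_simps)

lemma free_algebra_module:
  "module class_ring (free_algebra G :: ('k::field, 'a free_monoid \<Rightarrow>\<^sub>0 'k) module)"
  (is "module _ ?F")
proof (rule moduleI)
  show "cring (class_ring :: 'k ring)"
    by (rule fieldE(1)[OF class_field])
  show "abelian_group (?F)"
    using free_algebra_ring ring.is_abelian_group by blast
next
  fix a :: 'k and x :: "'a free_monoid \<Rightarrow>\<^sub>0 'k"
  assume "x \<in> carrier (?F)"
  then show "a \<odot>\<^bsub>?F\<^esub> x \<in> carrier (?F)"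
    using free_algebra_smult_closed by (simp only: free_algebra_simps(6))
qed (simp_all add: free_algebra_simps single_add distrib_left distrib_right
       mult_single flip: mult.assoc)

lemma single_mult_commute:
  "Poly_Mapping.single (0::'a::monoid_add) (c::'k::field) * f = f * Poly_Mapping.single 0 c"
proof (induction f rule: update_induct)
  case const
  show ?case by simp
next
  case (update f k v)
  have "Poly_Mapping.update k v f = f + Poly_Mapping.single k v"
    using update(1) by (intro poly_mapping_eqI) (auto simp: lookup_add lookup_update lookup_single in_keys_iff)
  then show ?case
    using update by (simp add: distrib_left distrib_right mult_single mult.commute)
qed

lemma free_algebra_smult_assoc2:
  "(c \<odot>\<^bsub>free_algebra G\<^esub> x) \<otimes>\<^bsub>free_algebra G\<^esub> y = c \<odot>\<^bsub>free_algebra G\<^esub> (x \<otimes>\<^bsub>free_algebra G\<^esub> y)"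
  "x \<otimes>\<^bsub>free_algebra G\<^esub> (c \<odot>\<^bsub>free_algebra G\<^esub> y) = c \<odot>\<^bsub>free_algebra G\<^esub> (x \<otimes>\<^bsub>free_algebra G\<^esub> y)"
  by (simp_all add: free_algebra_simps mult.assoc)
    (metis mult.assoc single_mult_commute)

lemma qmat_relators_closed:
  "qmat_relators m n q \<subseteq> carrier (free_algebra (indices m n))"
proof -
  have "gen (i, j) * gen (k, l) \<in> carrier (free_algebra (indices m n))"
    if "i \<in> {1..m}" "k \<in> {1..m}" "j \<in> {1..n}" "l \<in> {1..n}" for i j k l
    using that by (intro free_algebra_mult_closed gen_closed) (auto simp: indices_def)
  note * = this
  show ?thesis
    unfolding qmat_relators_def Let_def
    by (auto intro!: free_algebra_minus_closed free_algebra_smult_closed *)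
qed

lemma qmat_ideal_ideal: "ideal (qmat_ideal m n q) (free_algebra (indices m n))"
  unfolding qmat_ideal_def
  by (rule ring.genideal_ideal[OF free_algebra_ring qmat_relators_closed])

lemma quot_algebra_simps:
  "carrier (quot_algebra A I) = carrier (A Quot I)"
  "mult (quot_algebra A I) = mult (A Quot I)"
  "one (quot_algebra A I) = one (A Quot I)"
  "zero (quot_algebra A I) = zero (A Quot I)"
  "add (quot_algebra A I) = add (A Quot I)"
  "module.smult (quot_algebra A I) = (\<lambda>c U. \<Union>x\<in>U. I +>\<^bsub>A\<^esub> (c \<odot>\<^bsub>A\<^esub> x))"
  by (simp_all add: quot_algebra_def ring.extend_def module.fields_def)

lemma qmat_ring: "ring (qmat m n q)"
proof -
  interpret Q: ring "free_algebra (indices m n) Quot qmat_ideal m n q"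
    by (rule ideal.quotient_is_ring[OF qmat_ideal_ideal])
  show ?thesis
    unfolding qmat_def
  proof (rule ringI)
    show "abelian_group (quot_algebra (free_algebra (indices m n)) (qmat_ideal m n q))"
      by (rule abelian_groupI)
        (simp_all add: quot_algebra_simps Q.a_ac Q.add.l_inv_ex)
    show "monoid (quot_algebra (free_algebra (indices m n)) (qmat_ideal m n q))"
      by (rule monoidI) (auto simp: quot_algebra_simps Q.m_assoc)
  qed (simp_all add: quot_algebra_simps Q.l_distr Q.r_distr)
qed

lemma qmat_smult_coset:
  fixes c :: "'k::field" and q :: 'k and m n :: nat
  defines "F \<equiv> free_algebra (indices m n) :: ('k, _) module"
  assumes x: "x \<in> carrier F"
  shows "c \<odot>\<^bsub>qmat m n q\<^esub> (qmat_ideal m n q +>\<^bsub>F\<^esub> x) = qmat_ideal m n q +>\<^bsub>F\<^esub> (c \<odot>\<^bsub>F\<^esub> x)"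
proof -
  let ?I = "qmat_ideal m n q"
  interpret I: ideal ?I F
    unfolding F_def by (rule qmat_ideal_ideal)
  have one: "Poly_Mapping.single 0 c \<in> carrier F"
    by (auto simp: F_def free_algebra_simps zero_free_monoid_def)
  have *: "?I +>\<^bsub>F\<^esub> (c \<odot>\<^bsub>F\<^esub> y) = ?I +>\<^bsub>F\<^esub> (c \<odot>\<^bsub>F\<^esub> x)" if y: "y \<in> ?I +>\<^bsub>F\<^esub> x" for y
  proof -
    obtain h where h: "h \<in> ?I" "y = h \<oplus>\<^bsub>F\<^esub> x"
      using y by (auto simp: a_r_coset_def')
    have ch: "c \<odot>\<^bsub>F\<^esub> h \<in> ?I"
      using I.I_l_closed[OF h(1) one] by (simp add: F_def free_algebra_simps)
    have "c \<odot>\<^bsub>F\<^esub> y = (c \<odot>\<^bsub>F\<^esub> h) \<oplus>\<^bsub>F\<^esub> (c \<odot>\<^bsub>F\<^esub> x)"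
      by (simp add: h(2) F_def free_algebra_simps distrib_left)
    then have "c \<odot>\<^bsub>F\<^esub> y \<in> ?I +>\<^bsub>F\<^esub> (c \<odot>\<^bsub>F\<^esub> x)"
      using ch by (auto simp: a_r_coset_def')
    moreover have "c \<odot>\<^bsub>F\<^esub> x \<in> carrier F"
      using free_algebra_smult_closed[of x] x by (simp add: F_def free_algebra_simps)
    ultimately show ?thesis
      by (metis I.a_repr_independence')
  qed
  moreover have "x \<in> ?I +>\<^bsub>F\<^esub> x"
    using x by (rule I.a_rcos_self)
  ultimately have "(\<Union>y\<in>?I +>\<^bsub>F\<^esub> x. ?I +>\<^bsub>F\<^esub> (c \<odot>\<^bsub>F\<^esub> y)) = ?I +>\<^bsub>F\<^esub> (c \<odot>\<^bsub>F\<^esub> x)"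
    by blast
  then show ?thesis
    by (simp add: qmat_def quot_algebra_simps F_def)
qed

lemma qmat_carrier_cases:
  assumes "U \<in> carrier (qmat m n (q::'k::field))"
  obtains x where "x \<in> carrier (free_algebra (indices m n))"
    "U = qmat_ideal m n q +>\<^bsub>free_algebra (indices m n) :: ('k, _) module\<^esub> x"
  using assms by (auto simp: qmat_def quot_algebra_simps FactRing_simps)

lemma qmat_coset_closed:
  "x \<in> carrier (free_algebra (indices m n)) \<Longrightarrow>
    qmat_ideal m n q +>\<^bsub>free_algebra (indices m n) :: ('k::field, _) module\<^esub> x \<in> carrier (qmat m n q)"
  by (auto simp: qmat_def quot_algebra_simps FactRing_simps)

lemma qmat_coset_add:
  fixes q :: "'k::field" and m n :: nat
  defines "F \<equiv> free_algebra (indices m n) :: ('k, _) module"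
  assumes "x \<in> carrier F" "y \<in> carrier F"
  shows "(qmat_ideal m n q +>\<^bsub>F\<^esub> x) \<oplus>\<^bsub>qmat m n q\<^esub> (qmat_ideal m n q +>\<^bsub>F\<^esub> y) =
    qmat_ideal m n q +>\<^bsub>F\<^esub> (x \<oplus>\<^bsub>F\<^esub> y)"
proof -
  interpret I: ideal "qmat_ideal m n q" F
    unfolding F_def by (rule qmat_ideal_ideal)
  show ?thesis
    using I.a_rcos_sum[OF assms(2,3)] by (simp add: qmat_def quot_algebra_simps FactRing_def F_def)
qed

lemma qmat_coset_mult:
  fixes q :: "'k::field" and m n :: nat
  defines "F \<equiv> free_algebra (indices m n) :: ('k, _) module"
  assumes "x \<in> carrier F" "y \<in> carrier F"
  shows "(qmat_ideal m n q +>\<^bsub>F\<^esub> x) \<otimes>\<^bsub>qmat m n q\<^esub> (qmat_ideal m n q +>\<^bsub>F\<^esub> y) =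
    qmat_ideal m n q +>\<^bsub>F\<^esub> (x \<otimes>\<^bsub>F\<^esub> y)"
proof -
  interpret I: ideal "qmat_ideal m n q" F
    unfolding F_def by (rule qmat_ideal_ideal)
  show ?thesis
    using I.rcoset_mult_add[OF assms(2,3)] by (simp add: qmat_def quot_algebra_simps FactRing_def F_def)
qed

lemma qmat_module:
  fixes q :: "'k::field"
  shows "module class_ring (qmat m n q)"
proof -
  interpret F: module class_ring "free_algebra (indices m n) :: ('k, _) module"
    by (rule free_algebra_module)
  have [simp]: "carrier (class_ring :: 'k ring) = UNIV" by simp
  note cases = qmat_carrier_cases[where q = q and m = m and n = n]
  note simps = qmat_smult_coset qmat_coset_add qmat_coset_closed F.smult_l_distr F.smult_r_distr
    F.smult_assoc1
  show ?thesis
  proof (rule moduleI)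
    show "cring (class_ring :: 'k ring)"
      by (rule fieldE(1)[OF class_field])
    show "abelian_group (qmat m n q)"
      using qmat_ring ring.is_abelian_group by blast
  next
    fix a :: 'k and x
    assume "x \<in> carrier (qmat m n q)"
    then show "a \<odot>\<^bsub>qmat m n q\<^esub> x \<in> carrier (qmat m n q)"
      by (rule cases) (simp add: simps)
  next
    fix a b :: 'k and x
    assume "x \<in> carrier (qmat m n q)"
    then show "(a \<oplus>\<^bsub>class_ring\<^esub> b) \<odot>\<^bsub>qmat m n q\<^esub> x =
        (a \<odot>\<^bsub>qmat m n q\<^esub> x) \<oplus>\<^bsub>qmat m n q\<^esub> (b \<odot>\<^bsub>qmat m n q\<^esub> x)"
      by (rule cases) (use F.smult_l_distr in \<open>simp add: simps\<close>)
  next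
    fix a :: 'k and x y
    assume "x \<in> carrier (qmat m n q)" "y \<in> carrier (qmat m n q)"
    then show "a \<odot>\<^bsub>qmat m n q\<^esub> (x \<oplus>\<^bsub>qmat m n q\<^esub> y) =
        (a \<odot>\<^bsub>qmat m n q\<^esub> x) \<oplus>\<^bsub>qmat m n q\<^esub> (a \<odot>\<^bsub>qmat m n q\<^esub> y)"
      by (elim cases) (simp add: simps)
  next
    fix a b :: 'k and x
    assume "x \<in> carrier (qmat m n q)"
    then show "(a \<otimes>\<^bsub>class_ring\<^esub> b) \<odot>\<^bsub>qmat m n q\<^esub> x = a \<odot>\<^bsub>qmat m n q\<^esub> (b \<odot>\<^bsub>qmat m n q\<^esub> x)"
      by (rule cases) (use F.smult_assoc1 in \<open>simp add: simps\<close>)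
  next
    fix x
    assume "x \<in> carrier (qmat m n q)"
    then show "\<one>\<^bsub>class_ring\<^esub> \<odot>\<^bsub>qmat m n q\<^esub> x = x"
      by (rule cases) (use F.smult_one in \<open>simp add: simps\<close>)
  qed
qed

lemma qmat_smult_mult:
  fixes q :: "'k::field"
  assumes "U \<in> carrier (qmat m n q)" "V \<in> carrier (qmat m n q)"
  shows "(c \<odot>\<^bsub>qmat m n q\<^esub> U) \<otimes>\<^bsub>qmat m n q\<^esub> V = c \<odot>\<^bsub>qmat m n q\<^esub> (U \<otimes>\<^bsub>qmat m n q\<^esub> V)"
    and "U \<otimes>\<^bsub>qmat m n q\<^esub> (c \<odot>\<^bsub>qmat m n q\<^esub> V) = c \<odot>\<^bsub>qmat m n q\<^esub> (U \<otimes>\<^bsub>qmat m n q\<^esub> V)"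
proof -
  interpret F: module class_ring "free_algebra (indices m n) :: ('k, _) module"
    by (rule free_algebra_module)
  interpret R: ring "free_algebra (indices m n) :: ('k, _) module"
    by (rule free_algebra_ring)
  obtain x y where "x \<in> carrier (free_algebra (indices m n))" "y \<in> carrier (free_algebra (indices m n))"
    "U = qmat_ideal m n q +>\<^bsub>free_algebra (indices m n) :: ('k, _) module\<^esub> x"
    "V = qmat_ideal m n q +>\<^bsub>free_algebra (indices m n) :: ('k, _) module\<^esub> y"
    using assms by (elim qmat_carrier_cases)
  then show "(c \<odot>\<^bsub>qmat m n q\<^esub> U) \<otimes>\<^bsub>qmat m n q\<^esub> V = c \<odot>\<^bsub>qmat m n q\<^esub> (U \<otimes>\<^bsub>qmat m n q\<^esub> V)"
    and "U \<otimes>\<^bsub>qmat m n q\<^esub> (c \<odot>\<^bsub>qmat m n q\<^esub> V) = c \<odot>\<^bsub>qmat m n q\<^esub> (U \<otimes>\<^bsub>qmat m n q\<^esub> V)"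
    by (simp_all add: qmat_smult_coset qmat_coset_mult free_algebra_smult_assoc2)
qed

lemma qmat_gen_closed:
  assumes "i \<in> {1..m}" "j \<in> {1..n}"
  shows "qmat_gen m n q i j \<in> carrier (qmat m n q)"
  unfolding qmat_gen_def
  by (rule qmat_coset_closed, rule gen_closed) (use assms in \<open>auto simp: indices_def\<close>)

lemma list_prod_closed:
  assumes "monoid A" "set xs \<subseteq> carrier A"
  shows "list_prod A xs \<in> carrier A"
  using assms by (induction xs) (auto simp: list_prod_def monoid.m_closed)

lemma qminor_closed:
  fixes q :: "'k::field"
  assumes J: "J \<in> increasing_rows m n"
  shows "qminor m n q J \<in> carrier (qmat m n q)"
proof -
  interpret R: ring "qmat m n q" by (rule qmat_ring)
  interpret M: module class_ring "qmat m n q" by (rule qmat_module)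
  have "J ! \<sigma> i \<in> {1..n}" if "\<sigma> permutes {..<m}" "i < m" for \<sigma> i
  proof -
    have "\<sigma> i < length J"
      using permutes_in_image[OF that(1), of i] that(2) J by (simp add: increasing_rows_def)
    then show ?thesis using J nth_mem[of "\<sigma> i" J] unfolding increasing_rows_def by blast
  qed
  then have "list_prod (qmat m n q) (map (\<lambda>i. qmat_gen m n q (Suc i) (J ! \<sigma> i)) [0..<m])
      \<in> carrier (qmat m n q)" if "\<sigma> permutes {..<m}" for \<sigma>
    using that by (intro list_prod_closed R.monoid_axioms) (auto intro!: qmat_gen_closed)
  then show ?thesis
    unfolding qminor_def by (intro R.finsum_closed) (auto intro!: M.smult_closed)
qed

lemma qgrass_subalgebra:
  fixes q :: "'k::field"
  shows "is_subalgebra (qmat m n q) (carrier (qgrass m n q))"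
proof -
  let ?A = "qmat m n q" and ?B = "carrier (qgrass m n q)" and ?S = "qminor m n q ` increasing_rows m n"
  interpret R: ring ?A by (rule qmat_ring)
  interpret M: module "class_ring :: 'k ring" ?A by (rule qmat_module)
  have sub: "is_subalgebra ?A B \<longleftrightarrow> B \<subseteq> carrier ?A \<and> \<one>\<^bsub>?A\<^esub> \<in> B \<and>
      (\<forall>x\<in>B. \<forall>y\<in>B. x \<oplus>\<^bsub>?A\<^esub> y \<in> B \<and> x \<otimes>\<^bsub>?A\<^esub> y \<in> B) \<and>
      (\<forall>x\<in>B. \<ominus>\<^bsub>?A\<^esub> x \<in> B \<and> (\<forall>c. c \<odot>\<^bsub>?A\<^esub> x \<in> B))" for B
  proof
    assume B: "is_subalgebra ?A B"
    then interpret S: subring B ?A by (simp add: is_subalgebra_def)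
    have "c \<odot>\<^bsub>?A\<^esub> x \<in> B" if "x \<in> B" for c x
      using B M.submoduleE(4) that unfolding is_subalgebra_def by auto
    then show "B \<subseteq> carrier ?A \<and> \<one>\<^bsub>?A\<^esub> \<in> B \<and>
      (\<forall>x\<in>B. \<forall>y\<in>B. x \<oplus>\<^bsub>?A\<^esub> y \<in> B \<and> x \<otimes>\<^bsub>?A\<^esub> y \<in> B) \<and>
      (\<forall>x\<in>B. \<ominus>\<^bsub>?A\<^esub> x \<in> B \<and> (\<forall>c. c \<odot>\<^bsub>?A\<^esub> x \<in> B))"
      using subringE[OF S.subring_axioms] by (intro conjI ballI allI) auto
  next
    assume B: "B \<subseteq> carrier ?A \<and> \<one>\<^bsub>?A\<^esub> \<in> B \<and>
      (\<forall>x\<in>B. \<forall>y\<in>B. x \<oplus>\<^bsub>?A\<^esub> y \<in> B \<and> x \<otimes>\<^bsub>?A\<^esub> y \<in> B) \<and>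
      (\<forall>x\<in>B. \<ominus>\<^bsub>?A\<^esub> x \<in> B \<and> (\<forall>c. c \<odot>\<^bsub>?A\<^esub> x \<in> B))"
    then have "\<zero>\<^bsub>?A\<^esub> \<in> B"
      by (metis R.add.inv_closed R.one_closed R.r_neg)
    then show "is_subalgebra ?A B"
      unfolding is_subalgebra_def using B
      by (intro conjI R.subringI M.submoduleI) auto
  qed
  have carr: "?B = is_subalgebra ?A hull ?S"
    by (simp add: qgrass_def generated_subalgebra_def)
  have top: "is_subalgebra ?A (carrier ?A)"
    unfolding sub by (auto intro: M.smult_closed)
  have S: "?S \<subseteq> carrier ?A"
    using qminor_closed by blast
  have Int: "is_subalgebra ?A (\<Inter>\<T>)"
    if "\<T> \<noteq> {}" and \<T>: "\<And>B. B \<in> \<T> \<Longrightarrow> is_subalgebra ?A B" for \<T>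
  proof -
    have "\<exists>B. B \<in> \<T>" using that(1) by blast
    then obtain B where B: "B \<in> \<T>" ..
    have "B \<subseteq> carrier ?A"
      using \<T>[OF B] unfolding sub by simp
    then have "\<Inter>\<T> \<subseteq> carrier ?A"
      using Inter_lower[OF B] by (rule subset_trans[rotated])
    moreover have "\<one>\<^bsub>?A\<^esub> \<in> B" if "B \<in> \<T>" for B
      using \<T>[OF that] unfolding sub by simp
    moreover have "x \<oplus>\<^bsub>?A\<^esub> y \<in> B" "x \<otimes>\<^bsub>?A\<^esub> y \<in> B"
      if "B \<in> \<T>" "x \<in> \<Inter>\<T>" "y \<in> \<Inter>\<T>" for B x y
      using \<T>[OF that(1)] InterD[OF that(2,1)] InterD[OF that(3,1)] unfolding sub by simp_all
    moreover have "\<ominus>\<^bsub>?A\<^esub> x \<in> B" "c \<odot>\<^bsub>?A\<^esub> x \<in> B" if "B \<in> \<T>" "x \<in> \<Inter>\<T>" for B x c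
      using \<T>[OF that(1)] InterD[OF that(2,1)] unfolding sub by simp_all
    ultimately show ?thesis
      unfolding sub by (intro conjI ballI allI InterI)
  qed
  show ?thesis
    unfolding carr hull_def
  proof (rule Int)
    have "carrier ?A \<in> {B. is_subalgebra ?A B \<and> ?S \<subseteq> B}"
      using top S by simp
    then show "{B. is_subalgebra ?A B \<and> ?S \<subseteq> B} \<noteq> {}" by (metis empty_iff)
  qed simp
qed

theorem qgrass_vectorspace:
  fixes q :: "'k::field"
  shows "vectorspace class_ring (qgrass m n q)"
proof -
  interpret M: module "class_ring :: 'k ring" "qmat m n q" by (rule qmat_module)
  have "Module.submodule (carrier (qgrass m n q)) (class_ring :: 'k ring) (qmat m n q)"
    using qgrass_subalgebra unfolding is_subalgebra_def by blast
  then have "module (class_ring :: 'k ring) (qmat m n q\<lparr>carrier := carrier (qgrass m n q)\<rparr>)"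
    by (rule submodule.submodule_is_module) (rule M.module_axioms)
  then have "module (class_ring :: 'k ring) (qgrass m n q)"
    by (simp add: qgrass_def generated_subalgebra_def)
  then show ?thesis
    by (intro vectorspace.intro class_field)
qed

end

(*
  Spanning. Modulo the relations, the row and column expansions of a quantum minor agree, and a
  minor with more rows than available vanishes. Laplace expansion then yields the generalized
  quantum Pluecker relations. If the row A is not below the row B, say at position t, then
  shuffling the entries of A from t on with those of B up to t rewrites [A][B] as a combination of
  products [C][D] in which the entry sum of C is smaller than that of A, so straightening
  terminates.

  Independence. A row of variables t(1), ..., t(n) of a quantum torus, together with elements
  u(p) inverse to t(p) up to a rescaling in the p-th variable, extends a quantum matrix Y with r
  rows to one with r + 1 rows: the new entries are the sums of Y(i,p) u(p) t(j) over p >= j, and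
  the last row is t. Iteration maps the quantum matrices to operators on functions on an exponent
  lattice. For the weight giving the exponent at (i,j) the factor i * j, the generator X(i,j) has
  the leading exponent of a single variable x(i,j), the minor [J] that of its diagonal product, and
  the leading exponent of [T] records the contents of the columns of T, which determine T if it is
  preferred.
*)

theory Submission
  imports Defs "HOL-Library.Function_Algebras" "HOL-Combinatorics.Multiset_Permutations"
begin

section \<open>Quantum determinants\<close>

text \<open>Neither expansion suffices alone. A determinant expanded by rows can be reordered in its
  rows, one expanded by columns in its columns. Exchanging entries between the rows of a tableau
  concerns columns, so the factors of a Pluecker relation have to be column expansions; but the sum
  over all exchanges collapses only when the inner minors are read as row expansions, where too many
  rows force a repetition. A presentation gives no lower bound on the size of the quotient, so
  independence needs a representation. Independent variables that commute up to powers of q cannot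
  provide it directly if q^2 differs from 1: the relation between entries in diagonal position has a
  third monomial, which the summands with p > j account for. The factor i * j settles two
  comparisons at once. The positions (i, k), (i', l) outweigh (i, l), (i', k) by (i' - i)(l - k),
  which favours the diagonal of a minor; and Y(i,p) u(p) t(j) has weight (i - (r + 1)) p plus a
  constant, which favours p = j. Coefficients enter only as powers of q and - q, which are nonzero,
  so roots of unity need no special care.\<close>

definition below :: "nat set \<Rightarrow> nat \<Rightarrow> nat"
  where "below K j = card {l \<in> K. l < j}"

definition inversions :: "nat set \<Rightarrow> nat set \<Rightarrow> nat"
  where "inversions A B = (\<Sum>a\<in>A. below B a)"

text \<open>The rows form a list, which may be unordered and contain repetitions; the columns form a
  set, which can be split and diminished. \<open>below K j\<close> counts the inversions created by
  choosing column \<open>j\<close> first, so that full expansion yields the usual sum weighted by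
  powers of \<open>- q\<close>.\<close>

primrec qdet :: "(nat \<Rightarrow> nat \<Rightarrow> 'r::ring_1) \<Rightarrow> 'r \<Rightarrow> nat list \<Rightarrow> nat set \<Rightarrow> 'r" where
  "qdet X q [] K = (if K = {} then 1 else 0)"
| "qdet X q (i # r) K = (\<Sum>j\<in>K. (- q) ^ below K j * (X i j * qdet X q r (K - {j})))"

lemma below_Un:
  assumes "finite A" "finite B" "A \<inter> B = {}"
  shows "below (A \<union> B) j = below A j + below B j"
proof -
  have "{l \<in> A \<union> B. l < j} = {l \<in> A. l < j} \<union> {l \<in> B. l < j}" by auto
  then show ?thesis
    using assms by (simp add: below_def card_Un_disjoint disjoint_iff)
qed

lemma below_remove_le: "l \<le> j \<Longrightarrow> below (K - {j}) l = below K l"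
  unfolding below_def by (rule arg_cong[where f = card]) auto

lemma below_remove_less:
  assumes "finite K" "j \<in> K" "j < l"
  shows "below K l = Suc (below (K - {j}) l)"
proof -
  have "{x \<in> K. x < l} = insert j {x \<in> K - {j}. x < l}" using assms by auto
  then show ?thesis using assms by (simp add: below_def)
qed

text \<open>The balance of exponents behind Laplace expansion: on the right \<open>j\<close> is
  split off from the whole column set, on the left it is split off from the block
  \<open>insert j L\<close> after this block has been separated from \<open>M\<close>.\<close>

lemma inversions_insert:
  assumes "finite L" "finite M" "j \<notin> L" "j \<notin> M" "L \<inter> M = {}"
  shows "inversions (insert j L) M + below (insert j L) j = below (insert j (L \<union> M)) j + inversions L M"
proof -
  have "below (insert j (L \<union> M)) j = below L j + below M j"
    using below_remove_le[of j j "insert j (L \<union> M)"] assms by (simp add: below_Un)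
  moreover have "below (insert j L) j = below L j"
    using below_remove_le[of j j "insert j L"] assms by simp
  ultimately show ?thesis
    using assms by (simp add: inversions_def)
qed

lemma qdet_eq_0:
  assumes "finite K" "card K \<noteq> length r"
  shows "qdet X q r K = 0"
  using assms
proof (induction r arbitrary: K)
  case (Cons i r)
  have "qdet X q r (K - {j}) = 0" if "j \<in> K" for j
    using Cons.prems card_Suc_Diff1[of K j] that by (intro Cons.IH) (simp, metis length_Cons)
  then show ?case by simp
qed auto

lemma central_mult_left: "(\<And>x. c * x = x * c) \<Longrightarrow> a * (c * b) = c * (a * (b::'r::ring_1))"
  by (metis mult.assoc)

lemma central_power:
  fixes c :: "'r::ring_1"
  assumes "\<And>x. c * x = x * c"
  shows "(- c) ^ k * x = x * (- c) ^ k"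
proof (induction k)
  case (Suc k)
  have "(- c) ^ Suc k * x = - (c * (x * (- c) ^ k))"
    using Suc by (simp add: mult.assoc)
  then show ?case
    unfolding assms by (simp add: mult.assoc power_Suc2 del: power_Suc)
qed simp

lemma sum_ordered_pairs:
  fixes f :: "nat \<Rightarrow> nat \<Rightarrow> 'r::comm_monoid_add"
  assumes "finite K"
  shows "(\<Sum>j\<in>K. \<Sum>l\<in>K - {j}. f j l) = (\<Sum>(j, l) \<in> {(j, l). j \<in> K \<and> l \<in> K \<and> j < l}. f j l + f l j)"
proof -
  let ?P = "{(j, l). j \<in> K \<and> l \<in> K \<and> j < l}" and ?Q = "{(j, l). j \<in> K \<and> l \<in> K \<and> l < j}"
  have fin: "finite ?P" "finite ?Q"
    by (rule finite_subset[of _ "K \<times> K"]; use assms in auto)+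
  have "(\<Sum>j\<in>K. \<Sum>l\<in>K - {j}. f j l) = (\<Sum>(j, l) \<in> (SIGMA j:K. K - {j}). f j l)"
    using assms by (subst sum.Sigma) auto
  also have "(SIGMA j:K. K - {j}) = ?P \<union> ?Q" by auto
  also have "(\<Sum>(j, l) \<in> ?P \<union> ?Q. f j l) = (\<Sum>(j, l) \<in> ?P. f j l) + (\<Sum>(j, l) \<in> ?Q. f j l)"
    using fin by (intro sum.union_disjoint) auto
  also have "(\<Sum>(j, l) \<in> ?Q. f j l) = (\<Sum>(j, l) \<in> ?P. f l j)"
    by (rule sum.reindex_bij_witness[of _ prod.swap prod.swap]) auto
  finally show ?thesis
    by (simp add: sum.distrib case_prod_unfold)
qed

text \<open>Taking the larger of two columns first costs exactly one more inversion, so the two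
  orders combine into a two by two determinant on the rows \<open>i\<close> and \<open>k\<close>.
  Statements on adjacent rows thereby reduce to two by two blocks.\<close>

lemma qdet_Cons_Cons:
  fixes X :: "nat \<Rightarrow> nat \<Rightarrow> 'r::ring_1"
  assumes q: "\<And>x. q * x = x * q" and K: "finite K"
  shows "qdet X q (i # k # r) K = (\<Sum>(j, l) \<in> {(j, l). j \<in> K \<and> l \<in> K \<and> j < l}.
    (- q) ^ (below K j + below (K - {j}) l) *
      ((X i j * X k l - q * (X i l * X k j)) * qdet X q r (K - {j, l})))"
proof -
  have c: "X a b * ((- q) ^ k * y) = (- q) ^ k * (X a b * y)" for a b k y
    by (rule central_mult_left[OF central_power[OF q]])
  have D: "K - {j} - {l} = K - {j, l}" for j l by auto
  have "qdet X q (i # k # r) K = (\<Sum>j\<in>K. \<Sum>l\<in>K - {j}. (- q) ^ (below K j + below (K - {j}) l) *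
      (X i j * X k l * qdet X q r (K - {j, l})))"
    by (simp add: sum_distrib_left c power_add mult.assoc D)
  also have "\<dots> = (\<Sum>(j, l) \<in> {(j, l). j \<in> K \<and> l \<in> K \<and> j < l}.
    (- q) ^ (below K j + below (K - {j}) l) *
      ((X i j * X k l - q * (X i l * X k j)) * qdet X q r (K - {j, l})))"
    unfolding sum_ordered_pairs[OF K]
  proof (rule sum.cong[OF refl], clarify)
    fix j l assume jl: "j \<in> K" "l \<in> K" "j < l"
    have "below K l + below (K - {l}) j = Suc (below K j + below (K - {j}) l)"
      using below_remove_less[OF K jl(1,3)] below_remove_le[of j l K] jl by simp
    then show "(- q) ^ (below K j + below (K - {j}) l) * (X i j * X k l * qdet X q r (K - {j, l})) +
      (- q) ^ (below K l + below (K - {l}) j) * (X i l * X k j * qdet X q r (K - {l, j})) =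
      (- q) ^ (below K j + below (K - {j}) l) *
       ((X i j * X k l - q * (X i l * X k j)) * qdet X q r (K - {j, l}))"
      by (simp add: algebra_simps power_Suc2 insert_commute del: power_Suc)
  qed
  finally show ?thesis .
qed

text \<open>All products keep the order of the row list, so this Laplace expansion holds for
  arbitrary entries over a ring in which \<open>q\<close> is central.\<close>

lemma qdet_append:
  fixes X :: "nat \<Rightarrow> nat \<Rightarrow> 'r::ring_1"
  assumes q: "\<And>x. q * x = x * q" and K: "finite K"
  shows "qdet X q (r @ r') K =
    (\<Sum>L\<in>Pow K. (- q) ^ inversions L (K - L) * (qdet X q r L * qdet X q r' (K - L)))"
  using K
proof (induction r arbitrary: K)
  case Nil
  have "(\<Sum>L\<in>Pow K. (- q) ^ inversions L (K - L) * (qdet X q [] L * qdet X q r' (K - L))) =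
      (\<Sum>L\<in>{{}}. (- q) ^ inversions L (K - L) * (qdet X q [] L * qdet X q r' (K - L)))"
    using Nil by (intro sum.mono_neutral_right) auto
  then show ?case by (simp add: inversions_def)
next
  case (Cons i r)
  have c: "X a b * ((- q) ^ k * y) = (- q) ^ k * (X a b * y)" for a b k y
    by (rule central_mult_left[OF central_power[OF q]])
  have "qdet X q ((i # r) @ r') K = (\<Sum>j\<in>K. \<Sum>L\<in>Pow (K - {j}).
      (- q) ^ (below K j + inversions L (K - {j} - L)) * (X i j * qdet X q r L * qdet X q r' (K - {j} - L)))"
    using Cons by (simp add: sum_distrib_left c power_add mult.assoc)
  also have "\<dots> = (\<Sum>(j, L)\<in>(SIGMA j:K. Pow (K - {j})).
      (- q) ^ (below K j + inversions L (K - {j} - L)) * (X i j * qdet X q r L * qdet X q r' (K - {j} - L)))"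
    using Cons.prems by (subst sum.Sigma) auto
  also have "\<dots> = (\<Sum>(L, j)\<in>(SIGMA L:Pow K. L).
      (- q) ^ (inversions L (K - L) + below L j) * (X i j * qdet X q r (L - {j}) * qdet X q r' (K - L)))"
  \<comment> \<open>A column \<open>j\<close> for the first row and a set \<open>L\<close> for the
    rest of its block amount to the set \<open>insert j L\<close> with a marked element.\<close>
  proof (rule sum.reindex_bij_witness[of _ "\<lambda>(L, j). (j, L - {j})" "\<lambda>(j, L). (insert j L, j)"])
    fix a assume "a \<in> (SIGMA j:K. Pow (K - {j}))"
    then obtain j L where a: "a = (j, L)" "j \<in> K" "L \<subseteq> K" "j \<notin> L" by auto
    have "K - {j} - L = K - insert j L" "insert j (L \<union> (K - insert j L)) = K" "insert j L - {j} = L"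
      using a by auto
    moreover have "finite L" using a Cons.prems finite_subset by blast
    moreover have "L \<inter> (K - insert j L) = {}" by auto
    ultimately show "(case case a of (j, L) \<Rightarrow> (insert j L, j) of
         (L, j) \<Rightarrow> (- q) ^ (inversions L (K - L) + below L j) *
            (X i j * qdet X q r (L - {j}) * qdet X q r' (K - L))) =
         (case a of (j, L) \<Rightarrow> (- q) ^ (below K j + inversions L (K - {j} - L)) *
            (X i j * qdet X q r L * qdet X q r' (K - {j} - L)))"
      using inversions_insert[of L "K - insert j L" j] a Cons.prems
      by (simp)
  qed (use Cons.prems in auto)
  also have "\<dots> = (\<Sum>L\<in>Pow K. \<Sum>j\<in>L.
      (- q) ^ (inversions L (K - L) + below L j) * (X i j * qdet X q r (L - {j}) * qdet X q r' (K - L)))"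
    using Cons.prems by (subst sum.Sigma) (auto intro: finite_subset)
  also have "\<dots> = (\<Sum>L\<in>Pow K. (- q) ^ inversions L (K - L) * (qdet X q (i # r) L * qdet X q r' (K - L)))"
    by (simp add: sum_distrib_left sum_distrib_right power_add mult.assoc)
  finally show ?case .
qed

declare qdet.simps(2) [simp del]

section \<open>Reordering the rows of a determinant modulo the relations\<close>

locale quantum_matrix_mod =
  fixes A I :: "'r::ring_1 set" and q q' :: 'r and X :: "nat \<Rightarrow> nat \<Rightarrow> 'r" and m n :: nat
  assumes one_A: "1 \<in> A" and minus_A: "x \<in> A \<Longrightarrow> y \<in> A \<Longrightarrow> x - y \<in> A"
    and mult_A: "x \<in> A \<Longrightarrow> y \<in> A \<Longrightarrow> x * y \<in> A"
    and I_A: "I \<subseteq> A" and zero_I: "0 \<in> I" and minus_I: "x \<in> I \<Longrightarrow> y \<in> I \<Longrightarrow> x - y \<in> I"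
    and mult_I_left: "x \<in> A \<Longrightarrow> y \<in> I \<Longrightarrow> x * y \<in> I"
    and mult_I_right: "x \<in> I \<Longrightarrow> y \<in> A \<Longrightarrow> x * y \<in> I"
    and q_A: "q \<in> A" "q' \<in> A" and q_central: "q * x = x * q" and qq': "q * q' = 1"
    and X_A: "i \<in> {1..m} \<Longrightarrow> j \<in> {1..n} \<Longrightarrow> X i j \<in> A"
    and X_row: "i \<in> {1..m} \<Longrightarrow> 1 \<le> j \<Longrightarrow> j < l \<Longrightarrow> l \<le> n \<Longrightarrow> X i j * X i l - q * (X i l * X i j) \<in> I"
    and X_col: "1 \<le> i \<Longrightarrow> i < k \<Longrightarrow> k \<le> m \<Longrightarrow> j \<in> {1..n} \<Longrightarrow> X i j * X k j - q * (X k j * X i j) \<in> I"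
    and X_anti: "1 \<le> i \<Longrightarrow> i < k \<Longrightarrow> k \<le> m \<Longrightarrow> 1 \<le> j \<Longrightarrow> j < l \<Longrightarrow> l \<le> n \<Longrightarrow>
      X i l * X k j - X k j * X i l \<in> I"
    and X_diag: "1 \<le> i \<Longrightarrow> i < k \<Longrightarrow> k \<le> m \<Longrightarrow> 1 \<le> j \<Longrightarrow> j < l \<Longrightarrow> l \<le> n \<Longrightarrow>
      X i j * X k l - X k l * X i j - (q - q') * (X i l * X k j) \<in> I"
begin

text \<open>In the application \<open>A\<close> is the carrier of the free algebra and
  \<open>I\<close> the ideal of relations. Comparing elements modulo \<open>I\<close> keeps the
  arithmetic in a type that is a ring; the price is a membership in \<open>A\<close> whenever a
  congruence is multiplied.\<close>

definition cong (infix "\<approx>" 50) where "x \<approx> y \<longleftrightarrow> x - y \<in> I"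

lemma zero_A: "0 \<in> A" using zero_I I_A by auto
lemma uminus_I: "x \<in> I \<Longrightarrow> - x \<in> I" using minus_I[OF zero_I] by simp
lemma add_I: "x \<in> I \<Longrightarrow> y \<in> I \<Longrightarrow> x + y \<in> I" using minus_I[OF _ uminus_I] by simp
lemma uminus_A: "x \<in> A \<Longrightarrow> - x \<in> A" using minus_A[OF zero_A] by simp
lemma add_A: "x \<in> A \<Longrightarrow> y \<in> A \<Longrightarrow> x + y \<in> A" using minus_A[OF _ uminus_A] by simp
lemma sum_A: "(\<And>x. x \<in> S \<Longrightarrow> f x \<in> A) \<Longrightarrow> sum f S \<in> A"
  by (induction S rule: infinite_finite_induct) (auto simp: zero_A add_A)
lemma power_A: "x \<in> A \<Longrightarrow> x ^ k \<in> A"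
  by (induction k) (auto simp: one_A mult_A)

lemma cong_refl [simp]: "x \<approx> x" by (simp add: cong_def zero_I)
lemma cong_sym: "x \<approx> y \<Longrightarrow> y \<approx> x" unfolding cong_def using uminus_I by fastforce
lemma cong_trans [trans]: "x \<approx> y \<Longrightarrow> y \<approx> z \<Longrightarrow> x \<approx> z"
  unfolding cong_def using add_I by fastforce
lemma cong_add: "x \<approx> y \<Longrightarrow> z \<approx> w \<Longrightarrow> x + z \<approx> y + w"
  unfolding cong_def using add_I by (fastforce simp: algebra_simps)
lemma cong_sum: "(\<And>x. x \<in> S \<Longrightarrow> f x \<approx> g x) \<Longrightarrow> sum f S \<approx> sum g S"
  by (induction S rule: infinite_finite_induct) (auto intro: cong_add)
lemma cong_mult_left: "a \<in> A \<Longrightarrow> x \<approx> y \<Longrightarrow> a * x \<approx> a * y"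
  unfolding cong_def using mult_I_left[of a "x - y"] by (simp add: algebra_simps)
lemma cong_mult_right: "a \<in> A \<Longrightarrow> x \<approx> y \<Longrightarrow> x * a \<approx> y * a"
  unfolding cong_def using mult_I_right[of "x - y" a] by (simp add: algebra_simps)
lemma cong_mult: "x \<approx> y \<Longrightarrow> z \<approx> w \<Longrightarrow> y \<in> A \<Longrightarrow> z \<in> A \<Longrightarrow> x * z \<approx> y * w"
  by (rule cong_trans[OF cong_mult_right cong_mult_left])
lemma cong_0_iff: "x \<approx> 0 \<longleftrightarrow> x \<in> I" by (simp add: cong_def)

lemma cong_sum_0: "(\<And>x. x \<in> S \<Longrightarrow> f x \<approx> 0) \<Longrightarrow> sum f S \<approx> 0"
  using cong_sum[of S f "\<lambda>_. 0"] by simp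
lemma cong_mult_0: "a \<in> A \<Longrightarrow> x \<approx> 0 \<Longrightarrow> a * x \<approx> 0" "a \<in> A \<Longrightarrow> x \<approx> 0 \<Longrightarrow> x * a \<approx> 0"
  using cong_mult_left[of a x 0] cong_mult_right[of a x 0] by auto

lemma qpow_A: "(- q) ^ k \<in> A"
  by (simp add: power_A uminus_A q_A)

lemma qpow_left: "a * ((- q) ^ k * b) = (- q) ^ k * (a * b)"
  by (rule central_mult_left[OF central_power[OF q_central]])

lemma qdet_A: "set r \<subseteq> {1..m} \<Longrightarrow> K \<subseteq> {1..n} \<Longrightarrow> qdet X q r K \<in> A"
proof (induction r arbitrary: K)
  case (Cons i r)
  show ?case
    unfolding qdet.simps
    by (intro sum_A mult_A qpow_A X_A Cons.IH) (use Cons.prems in auto)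
qed (auto simp: one_A zero_A)

text \<open>The expansion along \<open>i\<close> meets all the sets \<open>K - {j}\<close>, so the
  exponent \<open>e\<close> must be the same for all of them. This is why the reordering lemmas
  choose \<open>e\<close> before the column set.\<close>

lemma qdet_Cons_cong:
  assumes "i \<in> {1..m}" "K \<subseteq> {1..n}" "\<And>K. K \<subseteq> {1..n} \<Longrightarrow> qdet X q r K \<approx> (- q) ^ e * qdet X q s K"
  shows "qdet X q (i # r) K \<approx> (- q) ^ e * qdet X q (i # s) K"
proof -
  have "(- q) ^ below K j * (X i j * qdet X q r (K - {j})) \<approx>
      (- q) ^ below K j * (X i j * ((- q) ^ e * qdet X q s (K - {j})))" if "j \<in> K" for j
    using assms(2) that by (intro cong_mult_left qpow_A X_A assms(1) assms(3)) auto
  moreover have "(- q) ^ below K j * (X i j * ((- q) ^ e * qdet X q s (K - {j}))) =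
    (- q) ^ e * ((- q) ^ below K j * (X i j * qdet X q s (K - {j})))" for j
    by (metis qpow_left)
  ultimately show ?thesis
    by (simp add: qdet.simps(2) sum_distrib_left cong_sum)
qed

lemma qdet_Cons_cong_0:
  assumes "i \<in> {1..m}" "K \<subseteq> {1..n}" "\<And>K. K \<subseteq> {1..n} \<Longrightarrow> qdet X q r K \<approx> 0"
  shows "qdet X q (i # r) K \<approx> 0"
  unfolding qdet.simps
  by (intro cong_sum_0 cong_mult_0(1) qpow_A X_A assms(1) assms(3)) (use assms(2) in auto)

text \<open>The two by two blocks of a repeated row vanish by the relation within that row.\<close>

lemma qdet_repeat:
  assumes "i \<in> {1..m}" "set r \<subseteq> {1..m}" "K \<subseteq> {1..n}"
  shows "qdet X q (i # i # r) K \<approx> 0"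
proof -
  have K: "finite K" using assms(3) finite_subset by blast
  have "X i j * X i l - q * (X i l * X i j) \<approx> 0" if "j \<in> K" "l \<in> K" "j < l" for j l
    using X_row[of i j l] assms that by (auto simp: cong_0_iff subset_eq)
  then show ?thesis
    unfolding qdet_Cons_Cons[OF q_central K]
    by (auto intro!: cong_sum_0 cong_mult_0(1)[OF qpow_A] cong_mult_0(2) qdet_A) (use assms in auto)
qed

text \<open>It suffices to exchange the rows of a two by two block. Its antidiagonal entries
  commute, and the correction \<open>q - q'\<close> from the diagonal entries, multiplied by
  \<open>q\<close>, contributes q^2 - 1 antidiagonal products; the - 1 cancels the one already
  present.\<close>

lemma qdet_swap:
  assumes "1 \<le> i" "i < k" "k \<le> m" "set r \<subseteq> {1..m}" "K \<subseteq> {1..n}"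
  shows "qdet X q (k # i # r) K \<approx> - q * qdet X q (i # k # r) K"
proof -
  have K: "finite K" using assms(5) finite_subset by blast
  have *: "X k j * X i l - q * (X k l * X i j) \<approx> - q * (X i j * X k l - q * (X i l * X k j))"
    if "j \<in> K" "l \<in> K" "j < l" for j l
  proof -
    have jl: "1 \<le> j" "l \<le> n" using that assms by auto
    have 1: "- (X i l * X k j - X k j * X i l) \<in> I"
      using X_anti[OF assms(1-3) jl(1) that(3) jl(2)] by (rule uminus_I)
    have 2: "q * (X i j * X k l - X k l * X i j - (q - q') * (X i l * X k j)) \<in> I"
      using X_diag[OF assms(1-3) jl(1) that(3) jl(2)] q_A by (intro mult_I_left)
    have "q * ((q - q') * (X i l * X k j)) = q * (q * (X i l * X k j)) - X i l * X k j"
      using qq' by (simp add: algebra_simps flip: mult.assoc)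
    then have "X k j * X i l - q * (X k l * X i j) - (- q * (X i j * X k l - q * (X i l * X k j))) =
       - (X i l * X k j - X k j * X i l) + q * (X i j * X k l - X k l * X i j - (q - q') * (X i l * X k j))"
      by (simp add: algebra_simps)
    with add_I[OF 1 2] show ?thesis
      unfolding cong_def by metis
  qed
  let ?P = "{(j, l). j \<in> K \<and> l \<in> K \<and> j < l}"
  have "qdet X q (k # i # r) K \<approx> (\<Sum>(j, l) \<in> ?P. (- q) ^ (below K j + below (K - {j}) l) *
      (- q * (X i j * X k l - q * (X i l * X k j)) * qdet X q r (K - {j, l})))"
    unfolding qdet_Cons_Cons[OF q_central K]
  proof (rule cong_sum, clarify)
    fix j l assume "j \<in> K" "l \<in> K" "j < l"
    then show "(- q) ^ (below K j + below (K - {j}) l) *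
       ((X k j * X i l - q * (X k l * X i j)) * qdet X q r (K - {j, l})) \<approx>
       (- q) ^ (below K j + below (K - {j}) l) *
       (- q * (X i j * X k l - q * (X i l * X k j)) * qdet X q r (K - {j, l}))"
      using assms(4,5) by (intro cong_mult_left cong_mult_right qpow_A qdet_A *) auto
  qed
  also have "\<dots> = - q * qdet X q (i # k # r) K"
    unfolding qdet_Cons_Cons[OF q_central K] sum_distrib_left
    by (intro sum.cong refl) (auto simp only: split_beta mult.assoc qpow_left[of "- q"])
  finally show ?thesis .
qed

text \<open>Insertion by adjacent swaps: each step of \<open>x\<close> past a smaller row costs a
  factor \<open>- q\<close>, and meeting an equal row gives 0.\<close>

lemma qdet_insort:
  assumes "x \<in> {1..m}" "set s \<subseteq> {1..m}" "sorted s" "distinct s"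
  shows "(x \<in> set s \<longrightarrow> (\<forall>K\<subseteq>{1..n}. qdet X q (x # s) K \<approx> 0)) \<and>
    (x \<notin> set s \<longrightarrow> (\<exists>e. \<forall>K\<subseteq>{1..n}. qdet X q (x # s) K \<approx> (- q) ^ e * qdet X q (insort x s) K))"
  using assms
proof (induction s)
  case Nil
  show ?case by (auto intro!: exI[of _ 0])
next
  case (Cons y s)
  consider "x < y" | "x = y" | "y < x" by linarith
  then show ?case
  proof cases
    case 1
    then have "x \<notin> set (y # s)" using Cons.prems by auto
    then show ?thesis using 1 by (auto intro!: exI[of _ 0])
  next
    case 2
    then show ?thesis using Cons.prems by (auto intro!: qdet_repeat)
  next
    case 3
    have sw: "qdet X q (x # y # s) K \<approx> - q * qdet X q (y # x # s) K" if "K \<subseteq> {1..n}" for K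
      using Cons.prems 3 that by (intro qdet_swap) auto
    have IH: "(x \<in> set s \<longrightarrow> (\<forall>K\<subseteq>{1..n}. qdet X q (x # s) K \<approx> 0)) \<and>
      (x \<notin> set s \<longrightarrow> (\<exists>e. \<forall>K\<subseteq>{1..n}. qdet X q (x # s) K \<approx> (- q) ^ e * qdet X q (insort x s) K))"
      using Cons by auto
    show ?thesis
    proof (cases "x \<in> set s")
      case True
      have "qdet X q (x # y # s) K \<approx> 0" if K: "K \<subseteq> {1..n}" for K
      proof -
        have "qdet X q (y # x # s) K \<approx> 0"
          using Cons.prems IH True K by (intro qdet_Cons_cong_0[of y K "x # s"]) auto
        then show ?thesis
          by (intro cong_trans[OF sw[OF K]] cong_mult_0(1) uminus_A q_A)
      qed
      then show ?thesis using True by simp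
    next
      case False
      then obtain e where e: "\<And>K. K \<subseteq> {1..n} \<Longrightarrow> qdet X q (x # s) K \<approx> (- q) ^ e * qdet X q (insort x s) K"
        using IH by blast
      have "qdet X q (x # y # s) K \<approx> (- q) ^ Suc e * qdet X q (insort x (y # s)) K" if K: "K \<subseteq> {1..n}" for K
      proof -
        have "qdet X q (y # x # s) K \<approx> (- q) ^ e * qdet X q (y # insort x s) K"
          using Cons.prems K e by (intro qdet_Cons_cong) auto
        from cong_trans[OF sw[OF K] cong_mult_left[OF uminus_A[OF q_A(1)] this]]
        show ?thesis using 3 by (simp add: mult.assoc)
      qed
      then show ?thesis using False 3 by (auto intro!: exI[of _ "Suc e"])
    qed
  qed
qed

lemma qdet_sort:
  assumes "set s \<subseteq> {1..m}"
  shows "(\<not> distinct s \<longrightarrow> (\<forall>K\<subseteq>{1..n}. qdet X q s K \<approx> 0)) \<and>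
    (distinct s \<longrightarrow> (\<exists>e. \<forall>K\<subseteq>{1..n}. qdet X q s K \<approx> (- q) ^ e * qdet X q (sort s) K))"
  using assms
proof (induction s)
  case Nil
  show ?case by (auto intro!: exI[of _ 0])
next
  case (Cons x s)
  have IH: "(\<not> distinct s \<longrightarrow> (\<forall>K\<subseteq>{1..n}. qdet X q s K \<approx> 0)) \<and>
    (distinct s \<longrightarrow> (\<exists>e. \<forall>K\<subseteq>{1..n}. qdet X q s K \<approx> (- q) ^ e * qdet X q (sort s) K))"
    using Cons by auto
  show ?case
  proof (cases "distinct s")
    case False
    then show ?thesis using IH Cons.prems qdet_Cons_cong_0 by auto
  next
    case True
    then obtain e where e: "\<And>K. K \<subseteq> {1..n} \<Longrightarrow> qdet X q s K \<approx> (- q) ^ e * qdet X q (sort s) K"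
      using IH by blast
    have xs: "qdet X q (x # s) K \<approx> (- q) ^ e * qdet X q (x # sort s) K" if "K \<subseteq> {1..n}" for K
      using Cons.prems that e by (intro qdet_Cons_cong) auto
    note ins = qdet_insort[of x "sort s"]
    show ?thesis
    proof (cases "x \<in> set s")
      case xin: True
      have "qdet X q (x # s) K \<approx> 0" if K: "K \<subseteq> {1..n}" for K
        using ins xin Cons.prems True K by (intro cong_trans[OF xs[OF K]] cong_mult_0(1) qpow_A) auto
      then show ?thesis using xin by simp
    next
      case False
      then obtain f where f: "\<And>K. K \<subseteq> {1..n} \<Longrightarrow>
          qdet X q (x # sort s) K \<approx> (- q) ^ f * qdet X q (insort x (sort s)) K"
        using ins Cons.prems True by auto
      have "qdet X q (x # s) K \<approx> (- q) ^ (e + f) * qdet X q (sort (x # s)) K" if K: "K \<subseteq> {1..n}" for K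
        using cong_trans[OF xs[OF K] cong_mult_left[OF qpow_A f[OF K]]]
        by (simp add: power_add mult.assoc)
      then show ?thesis using False True by (auto intro!: exI[of _ "e + f"])
    qed
  qed
qed

lemma qdet_pigeonhole:
  assumes "set r \<subseteq> {1..m}" "m < length r" "K \<subseteq> {1..n}"
  shows "qdet X q r K \<approx> 0"
proof -
  have "\<not> distinct r"
    using card_mono[OF _ assms(1)] distinct_card[of r] assms(2) by auto
  then show ?thesis using qdet_sort assms by blast
qed

text \<open>The row and column relations trade places. The antidiagonal relation changes its sign,
  and it also restores the order of the two factors on the right of the diagonal relation.\<close>

lemma transpose: "quantum_matrix_mod A I q q' (\<lambda>a b. X b a) n m"
proof
  fix i k j l assume *: "1 \<le> (i::nat)" "i < k" "k \<le> n" "1 \<le> (j::nat)" "j < l" "l \<le> m"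
  have 0: "X j k * X l i - X l i * X j k \<in> I" using X_anti * by blast
  then show "X l i * X j k - X j k * X l i \<in> I" using uminus_I by fastforce
  have "X j i * X l k - X l k * X j i - (q - q') * (X j k * X l i) + (q - q') * (X j k * X l i - X l i * X j k) \<in> I"
    by (intro add_I X_diag mult_I_left minus_A q_A 0 *)
  then show "X j i * X l k - X l k * X j i - (q - q') * (X l i * X j k) \<in> I"
    by (simp add: algebra_simps)
qed (use one_A minus_A mult_A I_A zero_I minus_I mult_I_left mult_I_right q_A q_central qq' X_A X_row X_col in auto)

end

section \<open>Row expansion against column expansion\<close>

lemma sorted_list_of_set_Min:
  assumes "finite K" "k \<in> K" "\<And>j. j \<in> K \<Longrightarrow> k \<le> j"
  shows "sorted_list_of_set K = k # sorted_list_of_set (K - {k})"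
proof -
  have "Min K = k" using assms by (intro Min_eqI) auto
  then show ?thesis using sorted_list_of_set_nonempty[of K] assms by auto
qed

lemma below_least:
  assumes "\<And>j. j \<in> K \<Longrightarrow> k \<le> j"
  shows "below K k = 0"
proof -
  have "{l \<in> K. l < k} = {}" using assms by fastforce
  then show ?thesis by (simp add: below_def)
qed

context quantum_matrix_mod
begin

lemmas qdet_transposed_A = quantum_matrix_mod.qdet_A[OF transpose]
lemmas qdet_transposed_sort = quantum_matrix_mod.qdet_sort[OF transpose]

text \<open>
  Expanding along the first row and then along the first column, or the other way round, yields the
  same sums, because the entries concerned lie on an antidiagonal and hence commute.
\<close>

lemma qdet_transpose_card:
  assumes "R \<subseteq> {1..m}" "K \<subseteq> {1..n}" "card R = card K"
  shows "qdet X q (sorted_list_of_set R) K \<approx> qdet (\<lambda>a b. X b a) q (sorted_list_of_set K) R"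
  using assms
proof (induction "card K" arbitrary: R K rule: less_induct)
  case less
  let ?D = "\<lambda>R K. qdet X q (sorted_list_of_set R) K"
  let ?E = "\<lambda>R K. qdet (\<lambda>a b. X b a) q (sorted_list_of_set K) R"
  have fin: "finite R" "finite K" using less.prems finite_subset by blast+
  show ?case
  proof (cases "K = {}")
    case True
    then show ?thesis using less.prems fin by simp
  next
    case False
    define k where "k = Min K"
    define i where "i = Min R"
    have k: "k \<in> K" "\<And>j. j \<in> K \<Longrightarrow> k \<le> j" using False fin by (auto simp: k_def)
    have "R \<noteq> {}" using False fin less.prems(3) by auto
    then have i: "i \<in> R" "\<And>j. j \<in> R \<Longrightarrow> i \<le> j" using fin by (auto simp: i_def)
    have ik: "i \<in> {1..m}" "k \<in> {1..n}" using i k less.prems by auto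
    have IH: "?D (R - S) (K - L) \<approx> ?E (R - S) (K - L)"
      if "S \<subseteq> R" "L \<subseteq> K" "card S = card L" "L \<noteq> {}" for S L
    proof (rule less.hyps)
      show "card (K - L) < card K" using that fin by (intro psubset_card_mono) auto
      show "card (R - S) = card (K - L)"
        using that fin less.prems(3) by (simp add: card_Diff_subset finite_subset)
    qed (use less.prems in auto)
    \<comment> \<open>The terms common to both expansions: \<open>T\<close> uses the corner entry at
      \<open>(i, k)\<close>, and \<open>G a j\<close> uses the entries at \<open>(i, j)\<close> and
      \<open>(a, k)\<close>. The extra 1 in the exponent comes from \<open>k < j\<close> in the row
      expansion and from \<open>i < a\<close> in the column expansion.\<close>
    define G where "G = (\<lambda>a j. (- q) ^ Suc (below (K - {k}) j + below (R - {i}) a) *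
      (X i j * (X a k * ?E (R - {i, a}) (K - {k, j}))))"
    define T where "T = X i k * ?E (R - {i}) (K - {k})"
    have EA: "?E S L \<in> A" if "S \<subseteq> R" "L \<subseteq> K" for S L
      using that less.prems fin finite_subset[of L K] by (intro qdet_transposed_A) auto
    have XA: "X a j \<in> A" if "a \<in> R" "j \<in> K" for a j
      using that less.prems by (intro X_A) auto
    have D1: "?D (R - {i}) (K - {j}) \<approx> (\<Sum>a\<in>R - {i}. (- q) ^ below (R - {i}) a *
        (X a k * ?E (R - {i, a}) (K - {k, j})))" if "j \<in> K - {k}" for j
    proof -
      have "sorted_list_of_set (K - {j}) = k # sorted_list_of_set (K - {j} - {k})"
        using that k fin by (intro sorted_list_of_set_Min) auto
      moreover have "K - {j} - {k} = K - {k, j}" "R - {i} - {a} = R - {i, a}" for a by auto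
      ultimately have "?E (R - {i}) (K - {j}) = (\<Sum>a\<in>R - {i}. (- q) ^ below (R - {i}) a *
        (X a k * ?E (R - {i, a}) (K - {k, j})))"
        by (simp add: qdet.simps(2))
      then show ?thesis using IH[of "{i}" "{j}"] that i by simp
    qed
    have E1: "?E (R - {a}) (K - {k}) \<approx> (\<Sum>j\<in>K - {k}. (- q) ^ below (K - {k}) j *
        (X i j * ?E (R - {i, a}) (K - {k, j})))" if "a \<in> R - {i}" for a
    proof -
      have "sorted_list_of_set (R - {a}) = i # sorted_list_of_set (R - {a} - {i})"
        using that i fin by (intro sorted_list_of_set_Min) auto
      moreover have "R - {a} - {i} = R - {i, a}" "K - {k} - {j} = K - {k, j}" for j by auto
      ultimately have "?D (R - {a}) (K - {k}) = (\<Sum>j\<in>K - {k}. (- q) ^ below (K - {k}) j *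
        (X i j * ?D (R - {i, a}) (K - {k, j})))"
        by (simp add: qdet.simps(2))
      also have "\<dots> \<approx> (\<Sum>j\<in>K - {k}. (- q) ^ below (K - {k}) j *
        (X i j * ?E (R - {i, a}) (K - {k, j})))"
        using that i k by (intro cong_sum cong_mult_left qpow_A XA IH) (auto simp: card_insert_if)
      finally have 1: "?D (R - {a}) (K - {k}) \<approx> (\<Sum>j\<in>K - {k}. (- q) ^ below (K - {k}) j *
        (X i j * ?E (R - {i, a}) (K - {k, j})))" .
      have 2: "?D (R - {a}) (K - {k}) \<approx> ?E (R - {a}) (K - {k})"
        using IH[of "{a}" "{k}"] that k by simp
      show ?thesis by (rule cong_trans[OF cong_sym[OF 2] 1])
    qed
    have D2: "?D R K = X i k * ?D (R - {i}) (K - {k}) +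
        (\<Sum>j\<in>K - {k}. (- q) ^ below K j * (X i j * ?D (R - {i}) (K - {j})))"
      using sorted_list_of_set_Min[OF fin(1) i] below_least[of K k] k(2)
      by (simp add: qdet.simps(2) sum.remove[OF fin(2) k(1)])
    have D3: "\<dots> \<approx> T + (\<Sum>j\<in>K - {k}. (- q) ^ below K j * (X i j * (\<Sum>a\<in>R - {i}.
        (- q) ^ below (R - {i}) a * (X a k * ?E (R - {i, a}) (K - {k, j})))))"
      unfolding T_def using i k
      by (intro cong_add cong_sum cong_mult_left qpow_A XA D1 IH) auto
    have D4: "(\<Sum>j\<in>K - {k}. (- q) ^ below K j * (X i j * (\<Sum>a\<in>R - {i}.
        (- q) ^ below (R - {i}) a * (X a k * ?E (R - {i, a}) (K - {k, j}))))) =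
        (\<Sum>j\<in>K - {k}. \<Sum>a\<in>R - {i}. G a j)"
    proof (rule sum.cong[OF refl])
      fix j assume j: "j \<in> K - {k}"
      then have "k < j" using k(2)[of j] by auto
      then have "below K j = Suc (below (K - {k}) j)"
        using below_remove_less[OF fin(2) k(1)] by simp
      then show "(- q) ^ below K j * (X i j * (\<Sum>a\<in>R - {i}.
        (- q) ^ below (R - {i}) a * (X a k * ?E (R - {i, a}) (K - {k, j})))) = (\<Sum>a\<in>R - {i}. G a j)"
        by (simp add: G_def sum_distrib_left qpow_left[of "X _ _"] power_add mult.assoc)
    qed
    have D5: "?D R K \<approx> T + (\<Sum>j\<in>K - {k}. \<Sum>a\<in>R - {i}. G a j)"
      using D3 unfolding D2 D4 .
    have E2: "?E R K = T + (\<Sum>a\<in>R - {i}. (- q) ^ below R a * (X a k * ?E (R - {a}) (K - {k})))"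
      using sorted_list_of_set_Min[OF fin(2) k] below_least[of R i] i(2)
      by (simp add: qdet.simps(2) sum.remove[OF fin(1) i(1)] T_def)
    have E3: "\<dots> \<approx> T + (\<Sum>a\<in>R - {i}. (- q) ^ below R a * (X a k * (\<Sum>j\<in>K - {k}.
        (- q) ^ below (K - {k}) j * (X i j * ?E (R - {i, a}) (K - {k, j})))))"
      using i k by (intro cong_add cong_sum cong_mult_left qpow_A XA E1 cong_refl) auto
    have E4: "(\<Sum>a\<in>R - {i}. (- q) ^ below R a * (X a k * (\<Sum>j\<in>K - {k}.
        (- q) ^ below (K - {k}) j * (X i j * ?E (R - {i, a}) (K - {k, j}))))) =
      (\<Sum>a\<in>R - {i}. \<Sum>j\<in>K - {k}. (- q) ^ Suc (below (K - {k}) j + below (R - {i}) a) *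
        ((X a k * X i j) * ?E (R - {i, a}) (K - {k, j})))"
    proof (rule sum.cong[OF refl])
      fix a assume a: "a \<in> R - {i}"
      then have "i < a" using i(2)[of a] by auto
      then have "below R a = Suc (below (R - {i}) a)"
        using below_remove_less[OF fin(1) i(1)] by simp
      moreover have "(- q) ^ Suc (x + y) = (- q) ^ Suc y * (- q) ^ x" for x y
        by (metis power_add add.commute add_Suc)
      ultimately show "(- q) ^ below R a * (X a k * (\<Sum>j\<in>K - {k}.
        (- q) ^ below (K - {k}) j * (X i j * ?E (R - {i, a}) (K - {k, j})))) =
        (\<Sum>j\<in>K - {k}. (- q) ^ Suc (below (K - {k}) j + below (R - {i}) a) *
          ((X a k * X i j) * ?E (R - {i, a}) (K - {k, j})))"
        by (simp add: sum_distrib_left qpow_left[of "X _ _"] mult.assoc del: power_Suc)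
    qed
    have E5: "T + \<dots> \<approx> T + (\<Sum>a\<in>R - {i}. \<Sum>j\<in>K - {k}. G a j)"
    proof (intro cong_add cong_sum cong_refl)
      fix a j assume a: "a \<in> R - {i}" and j: "j \<in> K - {k}"
      have "i < a" "k < j" using a j i(2)[of a] k(2)[of j] by auto
      then have "X i j * X a k \<approx> X a k * X i j"
        using X_anti[of i a k j] ik a j less.prems
        by (auto simp: cong_def subset_eq)
      then have "(- q) ^ Suc (below (K - {k}) j + below (R - {i}) a) *
          (X a k * X i j * ?E (R - {i, a}) (K - {k, j})) \<approx>
        (- q) ^ Suc (below (K - {k}) j + below (R - {i}) a) *
          (X i j * X a k * ?E (R - {i, a}) (K - {k, j}))"
        by (intro cong_mult_left cong_mult_right qpow_A EA cong_sym[of "X i j * X a k"]) auto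
      then show "(- q) ^ Suc (below (K - {k}) j + below (R - {i}) a) *
          (X a k * X i j * ?E (R - {i, a}) (K - {k, j})) \<approx> G a j"
        by (simp add: G_def mult.assoc)
    qed
    have "?E R K \<approx> T + (\<Sum>a\<in>R - {i}. \<Sum>j\<in>K - {k}. G a j)"
      using E3 E5 unfolding E2 E4 by (rule cong_trans)
    also have "\<dots> = T + (\<Sum>j\<in>K - {k}. \<Sum>a\<in>R - {i}. G a j)"
      by (subst sum.swap) (rule refl)
    finally show ?thesis by (rule cong_trans[OF D5 cong_sym])
  qed
qed

lemma qdet_transpose:
  assumes "R \<subseteq> {1..m}" "K \<subseteq> {1..n}"
  shows "qdet X q (sorted_list_of_set R) K \<approx> qdet (\<lambda>a b. X b a) q (sorted_list_of_set K) R"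
proof (cases "card R = card K")
  case True
  then show ?thesis using assms by (rule qdet_transpose_card[rotated 2])
next
  case False
  have "finite R" "finite K" using assms finite_subset by blast+
  then show ?thesis using False by (simp add: qdet_eq_0)
qed

section \<open>Quantum Pluecker relations\<close>

definition cdet :: "nat list \<Rightarrow> 'r"
  where "cdet w = qdet (\<lambda>a b. X b a) q w {1..m}"

lemma cdet_A: "set w \<subseteq> {1..n} \<Longrightarrow> cdet w \<in> A"
  unfolding cdet_def by (intro qdet_transposed_A) auto

lemma cdet_eq_0: "length w \<noteq> m \<Longrightarrow> cdet w = 0"
  unfolding cdet_def by (rule qdet_eq_0) auto

text \<open>Exchanging entries between two rows of a tableau leaves unordered columns, possibly with
  repetitions. A column list can express this, whereas the row expansion takes its columns as a
  set.\<close>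

lemma cdet_sort:
  assumes "set w \<subseteq> {1..n}"
  shows "\<not> distinct w \<Longrightarrow> cdet w \<approx> 0" "distinct w \<Longrightarrow> \<exists>e. cdet w \<approx> (- q) ^ e * cdet (sort w)"
  using qdet_transposed_sort[OF assms] unfolding cdet_def by blast+

text \<open>
  After Laplace expansion of all factors the inner sums become determinants with more than
  \<open>m\<close> rows, hence with a repeated row.
\<close>

lemma pluecker:
  assumes u: "set u \<subseteq> {1..n}" and v: "set v \<subseteq> {1..n}" and K: "K \<subseteq> {1..n}" "m < card K"
  shows "(\<Sum>L\<in>Pow K. (- q) ^ inversions L (K - L) *
    (cdet (u @ sorted_list_of_set L) * cdet (sorted_list_of_set (K - L) @ v))) \<approx> 0"
proof -
  let ?D = "\<lambda>R K. qdet X q (sorted_list_of_set R) K"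
  let ?E = "qdet (\<lambda>a b. X b a) q"
  let ?s = sorted_list_of_set
  let ?M = "{1..m}"
  have fin: "finite K" using K(1) finite_subset by blast
  \<comment> \<open>The part of the sum that depends on \<open>L\<close>, for fixed row sets
    \<open>R\<close> and \<open>S\<close>. Read as row determinants, its minors make up the Laplace
    expansion over \<open>K\<close> of the rows outside \<open>R\<close> followed by the rows
    \<open>S\<close>.\<close>
  define H where "H = (\<lambda>R S. \<Sum>L\<in>Pow K. (- q) ^ inversions L (K - L) *
    (?E (?s L) (?M - R) * ?E (?s (K - L)) S))"
  have H: "H R S \<approx> 0" if RS: "R \<subseteq> ?M" "S \<subseteq> ?M" for R S
  proof -
    have "H R S \<approx> (\<Sum>L\<in>Pow K. (- q) ^ inversions L (K - L) * (?D (?M - R) L * ?D S (K - L)))"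
      unfolding H_def
    proof (intro cong_sum cong_mult_left qpow_A cong_mult)
      fix L assume L: "L \<in> Pow K"
      then have finL: "finite L" "finite (?M - R)" "finite (K - L)" "finite S"
        using fin RS finite_subset[of S ?M] finite_subset[of L K] by auto
      show "?E (?s L) (?M - R) \<approx> ?D (?M - R) L" "?E (?s (K - L)) S \<approx> ?D S (K - L)"
        using K L RS by (intro cong_sym[OF qdet_transpose]; auto)+
      show "?D (?M - R) L \<in> A"
        using L K finL by (intro qdet_A) auto
      show "?E (?s (K - L)) S \<in> A"
        using L K finL RS by (intro qdet_transposed_A) auto
    qed
    also have "\<dots> = qdet X q (?s (?M - R) @ ?s S) K"
      using qdet_append[OF q_central fin, of X "?s (?M - R)" "?s S"] by simp
    also have "\<dots> \<approx> 0"
    \<comment> \<open>Either the numbers of rows and columns differ and the determinant is 0, or the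
      row list has length \<open>card K\<close>, which exceeds \<open>m\<close>, and some row is
      repeated.\<close>
    proof (cases "card K = length (?s (?M - R) @ ?s S)")
      case True
      then show ?thesis using K RS finite_subset[OF RS(2)]
        by (intro qdet_pigeonhole) auto
    qed (use fin in \<open>simp add: qdet_eq_0\<close>)
    finally show ?thesis .
  qed
  have "(\<Sum>L\<in>Pow K. (- q) ^ inversions L (K - L) * (cdet (u @ ?s L) * cdet (?s (K - L) @ v))) =
    (\<Sum>L\<in>Pow K. \<Sum>R\<in>Pow ?M. \<Sum>S\<in>Pow ?M. (- q) ^ (inversions R (?M - R) + inversions S (?M - S)) *
      (?E u R * ((- q) ^ inversions L (K - L) * (?E (?s L) (?M - R) * ?E (?s (K - L)) S)) * ?E v (?M - S)))"
  proof (rule sum.cong[OF refl])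
    fix L
    have *: "(- q) ^ inversions L (K - L) * ((- q) ^ a * (x * y) * ((- q) ^ b * (z * w))) =
        (- q) ^ (a + b) * (x * ((- q) ^ inversions L (K - L) * (y * z)) * w)" for a b x y z w
      by (simp add: power_add mult.assoc) (metis qpow_left mult.assoc)
    show "(- q) ^ inversions L (K - L) * (cdet (u @ ?s L) * cdet (?s (K - L) @ v)) =
      (\<Sum>R\<in>Pow ?M. \<Sum>S\<in>Pow ?M. (- q) ^ (inversions R (?M - R) + inversions S (?M - S)) *
      (?E u R * ((- q) ^ inversions L (K - L) * (?E (?s L) (?M - R) * ?E (?s (K - L)) S)) * ?E v (?M - S)))"
      unfolding cdet_def qdet_append[OF q_central finite_atLeastAtMost]
      by (simp only: sum_distrib_right) (simp only: sum_distrib_left *)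
  qed
  also have "\<dots> = (\<Sum>R\<in>Pow ?M. \<Sum>S\<in>Pow ?M. \<Sum>L\<in>Pow K. (- q) ^ (inversions R (?M - R) + inversions S (?M - S)) *
      (?E u R * ((- q) ^ inversions L (K - L) * (?E (?s L) (?M - R) * ?E (?s (K - L)) S)) * ?E v (?M - S)))"
    by (subst sum.swap) (intro sum.cong[OF refl] sum.swap)
  also have "\<dots> = (\<Sum>R\<in>Pow ?M. \<Sum>S\<in>Pow ?M. (- q) ^ (inversions R (?M - R) + inversions S (?M - S)) *
      (?E u R * H R S * ?E v (?M - S)))"
    by (simp add: H_def sum_distrib_left sum_distrib_right)
  also have "\<dots> \<approx> 0"
    using u v
    by (intro cong_sum_0 cong_mult_0(1)[OF qpow_A] cong_mult_0(2)[OF _ cong_mult_0(1)] H qdet_transposed_A) auto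
  finally show ?thesis .
qed

end

section \<open>Straightening of tableaux\<close>

lemma sum_exchange_less:
  fixes S T :: "nat set"
  assumes "finite S" "finite T" "card S = card T" "S \<noteq> T"
    and less: "\<And>x y. x \<in> S - T \<Longrightarrow> y \<in> T - S \<Longrightarrow> x < y"
  shows "\<Sum>S < \<Sum>T"
proof -
  have c: "card (S - T) = card (T - S)"
    using assms(1-3) card_Diff_subset_Int[of S T] card_Diff_subset_Int[of T S]
    by (simp add: Int_commute)
  have "S - T \<noteq> {}"
    using assms(1-4) by (metis Diff_eq_empty_iff card_subset_eq)
  then have pos: "0 < card (S - T)" using assms(1) by (simp add: card_gt_0_iff)
  then obtain y0 where y0: "y0 \<in> T - S" using c by (metis card_gt_0_iff ex_in_conv)
  \<comment> \<open>The least element of \<open>T - S\<close> separates the two differences, which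
    have equally many elements.\<close>
  define y where "y = Min (T - S)"
  have y: "y \<in> T - S" "\<And>z. z \<in> T - S \<Longrightarrow> y \<le> z"
    using y0 assms(2) Min_in[of "T - S"] by (auto simp: y_def)
  have "\<Sum>(S - T) < (\<Sum>x\<in>S - T. y)"
    using assms(1) \<open>S - T \<noteq> {}\<close> less[OF _ y(1)] by (intro sum_strict_mono) auto
  also have "\<dots> = (\<Sum>x\<in>T - S. y)" by (simp add: c)
  also have "\<dots> \<le> \<Sum>(T - S)" using y by (intro sum_mono) auto
  finally have "\<Sum>(S - T) < \<Sum>(T - S)" .
  moreover have "\<Sum>S = \<Sum>(S \<inter> T) + \<Sum>(S - T)" "\<Sum>T = \<Sum>(T \<inter> S) + \<Sum>(T - S)"
    using assms(1,2) by (intro sum.Int_Diff; simp)+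
  ultimately show ?thesis by (simp add: Int_commute)
qed

lemma increasing_rows_distinct: "J \<in> increasing_rows m n \<Longrightarrow> distinct J"
  by (simp add: increasing_rows_def strict_sorted_iff)

lemma sort_increasing_row:
  "distinct w \<Longrightarrow> length w = m \<Longrightarrow> set w \<subseteq> {1..n} \<Longrightarrow> sort w \<in> increasing_rows m n"
  by (simp add: increasing_rows_def strict_sorted_iff)

lemma not_successively:
  "\<not> successively P T \<Longrightarrow> \<exists>U A B V. T = U @ A # B # V \<and> \<not> P A B"
proof (induction T rule: induct_list012)
  case (3 x y zs)
  then show ?case
  proof (cases "P x y")
    case True
    then obtain U A B V where "y # zs = U @ A # B # V \<and> \<not> P A B" using 3 by auto
    then have "x # y # zs = (x # U) @ A # B # V \<and> \<not> P A B" by simp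
    then show ?thesis by blast
  qed (metis append_Nil)
qed auto

context quantum_matrix_mod
begin

text \<open>Abstracts from the span of the preferred tableaux modulo \<open>I\<close>. Of the
  scalars only \<open>q\<close> and \<open>q'\<close> are at hand in the locale, and they suffice to
  multiply and divide by powers of \<open>- q\<close>. Keeping \<open>W\<close> arbitrary lets the
  argument pass to the set of all \<open>x\<close> with \<open>tableau U * x * tableau V\<close> in
  \<open>W\<close>.\<close>

definition straightening_closed :: "'r set \<Rightarrow> bool"
  where "straightening_closed W \<longleftrightarrow> 0 \<in> W \<and> (\<forall>x\<in>W. \<forall>y\<in>W. x - y \<in> W) \<and>
    (\<forall>x\<in>W. q * x \<in> W \<and> q' * x \<in> W) \<and> (\<forall>x\<in>W. \<forall>y. y \<approx> x \<longrightarrow> y \<in> W)"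

lemma straightening_closedD:
  assumes "straightening_closed W"
  shows "0 \<in> W" "\<And>x y. x \<in> W \<Longrightarrow> y \<in> W \<Longrightarrow> x - y \<in> W"
    "\<And>x. x \<in> W \<Longrightarrow> q * x \<in> W" "\<And>x. x \<in> W \<Longrightarrow> q' * x \<in> W"
    "\<And>x y. x \<in> W \<Longrightarrow> y \<approx> x \<Longrightarrow> y \<in> W"
    "\<And>x e. x \<in> W \<Longrightarrow> (- q) ^ e * x \<in> W" "\<And>x e. (- q) ^ e * x \<in> W \<Longrightarrow> x \<in> W"
    "\<And>S f. (\<And>x. x \<in> S \<Longrightarrow> f x \<in> W) \<Longrightarrow> sum f S \<in> W"
proof -
  note W = assms[unfolded straightening_closed_def]
  show 0: "0 \<in> W" and minus: "\<And>x y. x \<in> W \<Longrightarrow> y \<in> W \<Longrightarrow> x - y \<in> W"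
    and q: "\<And>x. x \<in> W \<Longrightarrow> q * x \<in> W" and q': "\<And>x. x \<in> W \<Longrightarrow> q' * x \<in> W"
    and "\<And>x y. x \<in> W \<Longrightarrow> y \<approx> x \<Longrightarrow> y \<in> W"
    using W by blast+
  have um: "- x \<in> W" if "x \<in> W" for x using minus[OF 0 that] by simp
  have add: "x + y \<in> W" if "x \<in> W" "y \<in> W" for x y using minus[OF that(1) um[OF that(2)]] by simp
  show "(- q) ^ e * x \<in> W" if "x \<in> W" for x e
    by (induction e) (auto simp: mult.assoc that intro: um q)
  show "(- q) ^ e * x \<in> W \<Longrightarrow> x \<in> W" for x e
  proof (induction e)
    case (Suc e)
    have "q' * (q * z) = z" for z
      by (metis q_central qq' mult.assoc mult_1_left mult_1_right)
    then have "- (q' * ((- q) ^ Suc e * x)) = (- q) ^ e * x"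
      by (simp add: mult.assoc)
    then show ?case using Suc.IH um[OF q'[OF Suc.prems]] by simp
  qed simp
  show "sum f S \<in> W" if "\<And>x. x \<in> S \<Longrightarrow> f x \<in> W" for S :: "'b set" and f
    using that by (induction S rule: infinite_finite_induct) (auto simp: 0 add)
qed

text \<open>
  Exchanging the entries of the first row from a violating position on with the smaller entries
  of the second row up to that position can only lower the sum of the first row.
\<close>

lemma straighten_pair:
  assumes rows: "R1 \<in> increasing_rows m n" "R2 \<in> increasing_rows m n"
    and nle: "\<not> list_all2 (\<le>) R1 R2" and closed: "straightening_closed W"
    and smaller: "\<And>C D. C \<in> increasing_rows m n \<Longrightarrow> D \<in> increasing_rows m n \<Longrightarrow>
      sum_list C < sum_list R1 \<Longrightarrow> cdet C * cdet D \<in> W"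
  shows "cdet R1 * cdet R2 \<in> W"
proof -
  let ?s = sorted_list_of_set
  note W = straightening_closedD[OF closed]
  have len: "length R1 = m" "length R2 = m" and sub: "set R1 \<subseteq> {1..n}" "set R2 \<subseteq> {1..n}"
    and sorted: "sorted_wrt (<) R1" "sorted_wrt (<) R2"
    using rows by (auto simp: increasing_rows_def)
  obtain t where t: "t < m" "R2 ! t < R1 ! t"
    using nle len by (auto simp: list_all2_conv_all_nth not_le)
  define u where "u = take t R1"
  define v where "v = drop (Suc t) R2"
  define L0 where "L0 = set (drop t R1)"
  define M0 where "M0 = set (take (Suc t) R2)"
  \<comment> \<open>The \<open>m - t\<close> entries of \<open>R1\<close> from position
    \<open>t\<close> on and the \<open>t + 1\<close> entries of \<open>R2\<close> up to
    \<open>t\<close> are \<open>m + 1\<close> columns, just enough for a Pluecker relation. The term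
    for \<open>L0\<close> is the given product up to a power of \<open>- q\<close>.\<close>
  define K where "K = L0 \<union> M0"
  define f where "f = (\<lambda>L. (- q) ^ inversions L (K - L) * (cdet (u @ ?s L) * cdet (?s (K - L) @ v)))"
  have u: "set u \<subseteq> {1..n}" and v: "set v \<subseteq> {1..n}" and K: "K \<subseteq> {1..n}"
    using sub set_take_subset[of t R1] set_drop_subset[of t R1]
      set_take_subset[of "Suc t" R2] set_drop_subset[of "Suc t" R2]
    unfolding u_def v_def K_def L0_def M0_def by blast+
  have fin: "finite K" using K finite_subset by blast
  have ge: "R1 ! t \<le> x" if x: "x \<in> L0" for x
  proof -
    obtain i where "i < length (drop t R1)" "x = drop t R1 ! i"
      using x unfolding L0_def by (metis in_set_conv_nth)
    then have "t + i < m" "x = R1 ! (t + i)" using len by simp_all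
    then show ?thesis
      using sorted_wrt_nth_less[OF sorted(1), of t "t + i"] len by (cases i) auto
  qed
  have le: "x \<le> R2 ! t" if x: "x \<in> M0" for x
  proof -
    obtain i where "i < length (take (Suc t) R2)" "x = take (Suc t) R2 ! i"
      using x unfolding M0_def by (metis in_set_conv_nth)
    then have "i \<le> t" "x = R2 ! i" by simp_all
    then show ?thesis
      using sorted_wrt_nth_less[OF sorted(2), of i t] len t by (cases "i = t") auto
  qed
  have disj: "L0 \<inter> M0 = {}" using ge le t(2) by fastforce
  have dist: "distinct R1" "distinct R2" using rows increasing_rows_distinct by auto
  have card_L0: "card L0 = m - t" and card_M0: "card M0 = Suc t"
    using dist len t by (simp_all add: L0_def M0_def distinct_card)
  have card_K: "card K = Suc m"
    using disj card_L0 card_M0 t fin by (simp add: K_def card_Un_disjoint)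
  have sL0: "?s L0 = drop t R1" and sM0: "?s M0 = take (Suc t) R2"
    unfolding L0_def M0_def using sorted
    by (auto intro!: sorted_list_of_set.idem_if_sorted_distinct simp: strict_sorted_iff sorted_wrt_take sorted_wrt_drop)
  have L0K: "L0 \<in> Pow K" and KL0: "K - L0 = M0" using disj by (auto simp: K_def)
  have fL0: "f L0 = (- q) ^ inversions L0 M0 * (cdet R1 * cdet R2)"
    by (simp add: f_def KL0 sL0 sM0 u_def v_def)
  \<comment> \<open>A list of the wrong length gives 0 and a repeated entry something congruent to
    0; otherwise sorting both lists costs powers of \<open>- q\<close> and leads to a first row of
    smaller sum.\<close>
  have other: "f L \<in> W" if L: "L \<subseteq> K" "L \<noteq> L0" for L
  proof (cases "length (u @ ?s L) = m")
    case False
    then show ?thesis using W(1) by (simp add: f_def cdet_eq_0)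
  next
    case True
    have finL: "finite L" using L fin finite_subset by blast
    have cardL: "card L = m - t" using True len t by (simp add: u_def)
    have len2: "length (?s (K - L) @ v) = m"
      using L finL cardL card_K len t by (simp add: v_def card_Diff_subset)
    have sub1: "set (u @ ?s L) \<subseteq> {1..n}" using u L K finL by auto
    have sub2: "set (?s (K - L) @ v) \<subseteq> {1..n}" using v L K fin by auto
    show ?thesis
    proof (cases "distinct (u @ ?s L) \<and> distinct (?s (K - L) @ v)")
      case False
      then have "cdet (u @ ?s L) * cdet (?s (K - L) @ v) \<approx> 0"
        using cdet_sort(1)[OF sub1] cdet_sort(1)[OF sub2] cong_mult_0 cdet_A[OF sub1] cdet_A[OF sub2]
        by blast
      then have "f L \<approx> 0" unfolding f_def by (rule cong_mult_0(1)[OF qpow_A])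
      then show ?thesis by (rule W(5)[OF W(1)])
    next
      case dist': True
      obtain e where e: "cdet (u @ ?s L) \<approx> (- q) ^ e * cdet (sort (u @ ?s L))"
        using cdet_sort(2)[OF sub1] dist' by blast
      obtain d where d: "cdet (?s (K - L) @ v) \<approx> (- q) ^ d * cdet (sort (?s (K - L) @ v))"
        using cdet_sort(2)[OF sub2] dist' by blast
      have "\<Sum>L < \<Sum>L0"
      proof (rule sum_exchange_less)
        show "x < y" if "x \<in> L - L0" "y \<in> L0 - L" for x y
        proof -
          have "x \<in> M0" using that L by (auto simp: K_def)
          then show ?thesis using le[of x] ge[of y] that t(2) by auto
        qed
      qed (use finL L fin cardL card_L0 in \<open>auto simp: L0_def\<close>)
      moreover have "sum_list (?s L) = \<Sum>L"
        using finL distinct_sum_list_conv_Sum[of "?s L"] by simp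
      moreover have "sum_list (drop t R1) = \<Sum>L0"
        using dist distinct_sum_list_conv_Sum[of "drop t R1"] by (simp add: L0_def)
      moreover have "sum_list R1 = sum_list u + sum_list (drop t R1)"
        unfolding u_def by (metis append_take_drop_id sum_list_append)
      moreover have "sum_list (sort (u @ ?s L)) = sum_list (u @ ?s L)"
        by (metis mset_sort sum_mset_sum_list)
      ultimately have "sum_list (sort (u @ ?s L)) < sum_list R1" by simp
      then have "cdet (sort (u @ ?s L)) * cdet (sort (?s (K - L) @ v)) \<in> W"
        using dist' True len2 sub1 sub2 by (intro smaller sort_increasing_row) blast+
      then have "(- q) ^ e * ((- q) ^ d * (cdet (sort (u @ ?s L)) * cdet (sort (?s (K - L) @ v)))) \<in> W"
        by (intro W(6))
      also have "(- q) ^ e * ((- q) ^ d * (cdet (sort (u @ ?s L)) * cdet (sort (?s (K - L) @ v)))) =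
          ((- q) ^ e * cdet (sort (u @ ?s L))) * ((- q) ^ d * cdet (sort (?s (K - L) @ v)))"
        by (metis qpow_left mult.assoc)
      finally have "cdet (u @ ?s L) * cdet (?s (K - L) @ v) \<in> W"
        by (rule W(5)) (rule cong_mult[OF e d mult_A[OF qpow_A cdet_A] cdet_A[OF sub2]], use sub1 in simp)
      then show ?thesis unfolding f_def by (rule W(6))
    qed
  qed
  have "f L0 + (\<Sum>L\<in>Pow K - {L0}. f L) = (\<Sum>L\<in>Pow K. f L)"
    by (rule sum.remove[symmetric]) (use fin L0K in auto)
  also have "\<dots> \<approx> 0"
    unfolding f_def by (rule pluecker) (use u v K card_K in auto)
  finally have "f L0 + (\<Sum>L\<in>Pow K - {L0}. f L) \<in> W" by (rule W(5)[OF W(1)])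
  moreover have "(\<Sum>L\<in>Pow K - {L0}. f L) \<in> W" using other by (intro W(8)) auto
  ultimately have "f L0 \<in> W" using W(2) by fastforce
  then show ?thesis unfolding fL0 by (rule W(7))
qed

definition tableau :: "nat list list \<Rightarrow> 'r"
  where "tableau T = prod_list (map cdet T)"

lemma tableau_A: "set T \<subseteq> increasing_rows m n \<Longrightarrow> tableau T \<in> A"
proof (induction T)
  case (Cons J T)
  then have "set J \<subseteq> {1..n}" by (auto simp: increasing_rows_def)
  then show ?case using Cons by (simp add: tableau_def mult_A cdet_A)
qed (simp add: tableau_def one_A)

text \<open>An exchange lowers the sum of the first row involved but raises that of the second, so
  the measure is the list of all row sums, compared lexicographically; the number of rows is
  preserved.\<close>

lemma straighten:
  assumes closed: "straightening_closed W"
    and pref: "\<And>T. T \<in> preferred_tableaux m n \<Longrightarrow> tableau T \<in> W"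
    and T: "set T \<subseteq> increasing_rows m n"
  shows "tableau T \<in> W"
  using T
proof (induction T rule: wf_induct_rule[OF wf_inv_image[OF wf_lenlex[OF wf_less_than], of "map sum_list"]])
  case (1 T)
  show ?case
  proof (cases "successively (list_all2 (\<le>)) T")
    case True
    then show ?thesis using 1 by (intro pref) (auto simp: preferred_tableaux_def)
  next
    case False
    then obtain U R1 R2 V where T: "T = U @ R1 # R2 # V" and nle: "\<not> list_all2 (\<le>) R1 R2"
      using not_successively by blast
    have UV: "tableau U \<in> A" "tableau V \<in> A" using 1 T by (auto intro: tableau_A)
    define W' where "W' = {x. tableau U * x * tableau V \<in> W}"
    note W = straightening_closedD[OF closed]
    have "cdet R1 * cdet R2 \<in> W'"
    proof (rule straighten_pair)
      have q'c: "q' * z = z * q'" for z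
        by (metis q_central qq' mult.assoc mult_1_left mult_1_right)
      have c: "tableau U * (p * x) * tableau V = p * (tableau U * x * tableau V)"
        if "\<And>z. p * z = z * p" for p x
        by (metis that mult.assoc)
      have "q * x \<in> W'" "q' * x \<in> W'" if "x \<in> W'" for x
        using that W(3,4) by (simp_all add: W'_def c[OF q_central] c[OF q'c])
      moreover have "x - y \<in> W'" if "x \<in> W'" "y \<in> W'" for x y
        using W(2) that by (simp add: W'_def algebra_simps)
      moreover have "y \<in> W'" if "x \<in> W'" "y \<approx> x" for x y
      proof -
        have "tableau U * y * tableau V \<approx> tableau U * x * tableau V"
          using UV that by (intro cong_mult_left cong_mult_right)
        then show ?thesis using W(5) that by (simp add: W'_def)
      qed
      moreover have "0 \<in> W'" by (simp add: W'_def W(1))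
      ultimately show "straightening_closed W'"
        unfolding straightening_closed_def by blast
    next
      fix C D assume CD: "C \<in> increasing_rows m n" "D \<in> increasing_rows m n" "sum_list C < sum_list R1"
      have "(map sum_list (U @ C # D # V), map sum_list T) \<in> lenlex less_than"
        unfolding T lenlex_conv lex_conv using CD(3)
        by (auto intro!: exI[of _ "map sum_list U"])
      then have "tableau (U @ C # D # V) \<in> W"
        using 1 CD T by auto
      then show "cdet C * cdet D \<in> W'"
        by (simp add: W'_def tableau_def mult.assoc)
    qed (use 1 T nle in auto)
    then show ?thesis
      by (simp add: W'_def tableau_def T mult.assoc)
  qed
qed

end

section \<open>Quantum matrices over a quantum torus\<close>

definition quantum_matrix :: "'r::ring_1 \<Rightarrow> 'r \<Rightarrow> nat \<Rightarrow> nat \<Rightarrow> (nat \<Rightarrow> nat \<Rightarrow> 'r) \<Rightarrow> bool"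
  where "quantum_matrix q q' m n X \<longleftrightarrow>
    (\<forall>i j l. i \<in> {1..m} \<and> 1 \<le> j \<and> j < l \<and> l \<le> n \<longrightarrow> X i j * X i l = q * (X i l * X i j)) \<and>
    (\<forall>i k j. 1 \<le> i \<and> i < k \<and> k \<le> m \<and> j \<in> {1..n} \<longrightarrow> X i j * X k j = q * (X k j * X i j)) \<and>
    (\<forall>i k j l. 1 \<le> i \<and> i < k \<and> k \<le> m \<and> 1 \<le> j \<and> j < l \<and> l \<le> n \<longrightarrow>
      X i l * X k j = X k j * X i l \<and>
      X i j * X k l - X k l * X i j = (q - q') * (X i l * X k j))"

lemma quantum_matrixD:
  assumes "quantum_matrix q q' m n X"
  shows "i \<in> {1..m} \<Longrightarrow> 1 \<le> j \<Longrightarrow> j < l \<Longrightarrow> l \<le> n \<Longrightarrow> X i j * X i l = q * (X i l * X i j)"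
    and "1 \<le> i \<Longrightarrow> i < k \<Longrightarrow> k \<le> m \<Longrightarrow> j \<in> {1..n} \<Longrightarrow> X i j * X k j = q * (X k j * X i j)"
    and "1 \<le> i \<Longrightarrow> i < k \<Longrightarrow> k \<le> m \<Longrightarrow> 1 \<le> j \<Longrightarrow> j < l \<Longrightarrow> l \<le> n \<Longrightarrow> X i l * X k j = X k j * X i l"
    and "1 \<le> i \<Longrightarrow> i < k \<Longrightarrow> k \<le> m \<Longrightarrow> 1 \<le> j \<Longrightarrow> j < l \<Longrightarrow> l \<le> n \<Longrightarrow>
      X i j * X k l - X k l * X i j = (q - q') * (X i l * X k j)"
  using assms unfolding quantum_matrix_def by blast+

section \<open>Adjoining a row to a quantum matrix\<close>

locale quantum_row_extension =
  fixes q q' :: "'r::ring_1" and r n :: nat and Y :: "nat \<Rightarrow> nat \<Rightarrow> 'r" and t u :: "nat \<Rightarrow> 'r"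
  assumes central: "q * x = x * q" and inverse: "q * q' = 1"
    and matrix: "quantum_matrix q q' r n Y"
    and tt: "1 \<le> j \<Longrightarrow> j < l \<Longrightarrow> l \<le> n \<Longrightarrow> t j * t l = q * (t l * t j)"
    and uu: "1 \<le> j \<Longrightarrow> j < l \<Longrightarrow> l \<le> n \<Longrightarrow> u j * u l = q * (u l * u j)"
    and ut: "1 \<le> j \<Longrightarrow> j \<le> p \<Longrightarrow> p \<le> n \<Longrightarrow> u p * t j = q * (t j * u p)"
    and tu: "1 \<le> p \<Longrightarrow> p < j \<Longrightarrow> j \<le> n \<Longrightarrow> t j * u p = q * (u p * t j)"
    and Yt: "i \<in> {1..r} \<Longrightarrow> j \<in> {1..n} \<Longrightarrow> l \<in> {1..n} \<Longrightarrow> Y i j * t l = t l * Y i j"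
    and Yu: "i \<in> {1..r} \<Longrightarrow> j \<in> {1..n} \<Longrightarrow> l \<in> {1..n} \<Longrightarrow> Y i j * u l = u l * Y i j"
begin

lemma inverse_left: "q' * q = 1"
  using central inverse by metis

lemma central': "q' * x = x * q'"
proof -
  have "q' * x = q' * (x * (q * q'))" by (simp add: inverse)
  also have "\<dots> = q' * (q * x) * q'" unfolding central[of x] by (simp add: mult.assoc)
  also have "\<dots> = x * q'" by (simp add: inverse_left flip: mult.assoc)
  finally show ?thesis .
qed

lemma q_cancel: "q * (q' * x) = x" "q' * (q * x) = x"
  by (simp_all add: inverse inverse_left flip: mult.assoc)

lemma scalar_left: "x * (q * y) = q * (x * y)" "x * (q' * y) = q' * (x * y)"
  unfolding mult.assoc[symmetric] central[of x] central'[of x] by (rule refl)+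

text \<open>Lets a commutation rule act at the head of a longer right-nested product, so that
  rewriting sorts whole monomials.\<close>

lemma assoc_rule:
  fixes x y z w :: 'r
  assumes "x * y = z"
  shows "x * (y * w) = z * w"
  using mult.assoc[of x y w] unfolding assms by (rule sym)

text \<open>\<open>b * c\<close> equals \<open>q' * (c * b)\<close>, and the correction term of
  \<open>a * d\<close> completes it to \<open>q * (c * b)\<close>.\<close>

lemma col_identity:
  assumes "a * c = q * (c * a)" "b * d = q * (d * b)" "c * b = q * (b * c)"
    "a * d = q * (d * a) + (q - q') * (c * b)"
  shows "(a + b) * (c + d) = q * ((c + d) * (a + b))"
  by (simp add: assms distrib_left distrib_right left_diff_distrib q_cancel)

text \<open>From here on \<open>a + b\<close> and \<open>c + d\<close> stand for the sums
  \<open>Z\<close> of two rows from column \<open>j\<close> on, each cut at column \<open>l\<close>,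
  and \<open>x\<close>, \<open>y\<close> for \<open>t j\<close>, \<open>t l\<close>. The relations
  of the extended matrix become identities between words in these letters.\<close>

lemma row_identity:
  fixes a b x y :: 'r
  assumes "a * b = q * (q * (b * a))" "x * b = q' * (b * x)" "y * a = q * (a * y)"
    "y * b = q' * (b * y)" "x * y = q * (y * x)"
  shows "(a + b) * x * (b * y) = q * (b * y * ((a + b) * x))"
  by (simp add: assms assms[THEN assoc_rule] distrib_left distrib_right mult.assoc q_cancel
      scalar_left[of a] scalar_left[of b] scalar_left[of x] scalar_left[of y])

lemma last_row_identity:
  fixes a b x y :: 'r
  assumes "x * b = q' * (b * x)" "y * a = q * (a * y)"
    "y * b = q' * (b * y)" "x * y = q * (y * x)"
  shows "b * y * x = x * (b * y)"
    and "(a + b) * x * y - y * ((a + b) * x) = (q - q') * (b * y * x)"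
  by (simp_all add: assms assms[THEN assoc_rule] distrib_left distrib_right mult.assoc q_cancel
      left_diff_distrib scalar_left[of a] scalar_left[of b] scalar_left[of x] scalar_left[of y])

lemma cross_identity:
  fixes a b c d x y :: 'r
  assumes "b * d = q * (d * b)" "c * b = q * (b * c)" "a * d = q * (d * a) + (q - q') * (c * b)"
    "x * b = q' * (b * x)" "x * d = q' * (d * x)" "y * a = q * (a * y)" "y * c = q * (c * y)"
    "y * b = q' * (b * y)" "y * d = q' * (d * y)" "x * y = q * (y * x)"
  shows "b * y * ((c + d) * x) = (c + d) * x * (b * y)"
    and "(a + b) * x * (d * y) - d * y * ((a + b) * x) = (q - q') * (b * y * ((c + d) * x))"
  by (simp_all add: assms assms[THEN assoc_rule] distrib_left distrib_right mult.assoc q_cancel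
      left_diff_distrib scalar_left[of a] scalar_left[of b] scalar_left[of c] scalar_left[of d]
      scalar_left[of x] scalar_left[of y])

text \<open>The new upper rows are the product of \<open>Y\<close> with the lower triangular matrix
  of entries \<open>u p * t j\<close>, where p >= j. The factor \<open>t j\<close> is left out here,
  so that the range of \<open>p\<close> can be cut freely.\<close>

definition Z :: "nat \<Rightarrow> nat set \<Rightarrow> 'r"
  where "Z i P = (\<Sum>p\<in>P. Y i p * u p)"

lemma t_Z_ge:
  assumes "i \<in> {1..r}" "1 \<le> j" "j \<le> n" "P \<subseteq> {j..n}"
  shows "t j * Z i P = q' * (Z i P * t j)"
proof -
  have "t j * (Y i p * u p) = q' * (Y i p * u p * t j)" if "p \<in> P" for p
  proof -
    have "j \<le> p" "p \<le> n" using that assms by auto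
    then have "t j * u p = q' * (u p * t j)"
      using ut[of j p] assms by (simp add: q_cancel)
    moreover have "t j * (Y i p * u p) = Y i p * (t j * u p)"
      using Yt[of i p j] assms \<open>j \<le> p\<close> \<open>p \<le> n\<close> by (simp flip: mult.assoc)
    ultimately show ?thesis
      by (metis central' mult.assoc)
  qed
  then show ?thesis
    unfolding Z_def by (simp add: sum_distrib_left sum_distrib_right)
qed

lemma t_Z_less:
  assumes "i \<in> {1..r}" "1 \<le> j" "j \<le> n" "P \<subseteq> {1..<j}"
  shows "t j * Z i P = q * (Z i P * t j)"
proof -
  have "t j * (Y i p * u p) = q * (Y i p * u p * t j)" if "p \<in> P" for p
  proof -
    have p: "1 \<le> p" "p < j" using that assms by auto
    have "t j * (Y i p * u p) = Y i p * (t j * u p)"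
      using Yt[of i p j] assms p by (simp flip: mult.assoc)
    then show ?thesis
      using tu[of p j] p assms by (metis central mult.assoc)
  qed
  then show ?thesis
    unfolding Z_def by (simp add: sum_distrib_left sum_distrib_right)
qed

lemma Yu_Yu:
  assumes "i \<in> {1..r}" "k \<in> {1..r}" "a \<in> {1..n}" "b \<in> {1..n}"
  shows "(Y i a * u a) * (Y k b * u b) = (Y i a * Y k b) * (u a * u b)"
  using Yu[of k b a] assms by (metis mult.assoc)

text \<open>As \<open>P\<close> lies to the left of \<open>Q\<close>, both products can be written
  with \<open>u a * u b\<close> in the same order, at the price of one factor \<open>q\<close> in
  the second. Comparing them then only concerns products of entries of \<open>Y\<close>.\<close>

lemma Z_mult:
  assumes ik: "i \<in> {1..r}" "k \<in> {1..r}" and PQ: "P \<subseteq> {1..n}" "Q \<subseteq> {1..n}"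
    and less: "\<And>a b. a \<in> P \<Longrightarrow> b \<in> Q \<Longrightarrow> a < b"
  shows "Z i P * Z k Q = (\<Sum>a\<in>P. \<Sum>b\<in>Q. (Y i a * Y k b) * (u a * u b))"
    and "q * (Z k Q * Z i P) = (\<Sum>a\<in>P. \<Sum>b\<in>Q. (Y k b * Y i a) * (u a * u b))"
proof -
  show "Z i P * Z k Q = (\<Sum>a\<in>P. \<Sum>b\<in>Q. (Y i a * Y k b) * (u a * u b))"
    unfolding Z_def sum_product
    by (intro sum.cong refl Yu_Yu) (use ik PQ in auto)
  have "q * (Z k Q * Z i P) = (\<Sum>b\<in>Q. \<Sum>a\<in>P. q * ((Y k b * u b) * (Y i a * u a)))"
    unfolding Z_def sum_product by (simp add: sum_distrib_left)
  also have "\<dots> = (\<Sum>a\<in>P. \<Sum>b\<in>Q. q * ((Y k b * u b) * (Y i a * u a)))"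
    by (rule sum.swap)
  also have "\<dots> = (\<Sum>a\<in>P. \<Sum>b\<in>Q. (Y k b * Y i a) * (u a * u b))"
  proof (intro sum.cong refl)
    fix a b assume ab: "a \<in> P" "b \<in> Q"
    then have "(Y k b * u b) * (Y i a * u a) = (Y k b * Y i a) * (u b * u a)"
      using ik PQ by (intro Yu_Yu) auto
    moreover have "u a * u b = q * (u b * u a)"
      using ab PQ less by (intro uu) auto
    ultimately show "q * ((Y k b * u b) * (Y i a * u a)) = (Y k b * Y i a) * (u a * u b)"
      by (metis central mult.assoc)
  qed
  finally show "q * (Z k Q * Z i P) = (\<Sum>a\<in>P. \<Sum>b\<in>Q. (Y k b * Y i a) * (u a * u b))" .
qed

text \<open>One factor \<open>q\<close> comes from the row relation in \<open>Y\<close>, the other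
  from exchanging the elements \<open>u\<close>.\<close>

lemma Z_row:
  assumes "i \<in> {1..r}" "P \<subseteq> {1..n}" "Q \<subseteq> {1..n}" "\<And>a b. a \<in> P \<Longrightarrow> b \<in> Q \<Longrightarrow> a < b"
  shows "Z i P * Z i Q = q * (q * (Z i Q * Z i P))"
proof -
  have "(\<Sum>a\<in>P. \<Sum>b\<in>Q. (Y i a * Y i b) * (u a * u b)) =
      (\<Sum>a\<in>P. \<Sum>b\<in>Q. q * ((Y i b * Y i a) * (u a * u b)))"
  proof (intro sum.cong refl)
    fix a b assume "a \<in> P" "b \<in> Q"
    then have "Y i a * Y i b = q * (Y i b * Y i a)"
      using assms by (intro quantum_matrixD(1)[OF matrix]) auto
    then show "Y i a * Y i b * (u a * u b) = q * (Y i b * Y i a * (u a * u b))"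
      by (simp add: mult.assoc)
  qed
  then show ?thesis
    using Z_mult[OF assms(1,1) assms(2-4)] by (simp add: sum_distrib_left)
qed

lemma Z_anti:
  assumes "1 \<le> i" "i < k" "k \<le> r" "P \<subseteq> {1..n}" "Q \<subseteq> {1..n}" "\<And>a b. a \<in> P \<Longrightarrow> b \<in> Q \<Longrightarrow> a < b"
  shows "Z k P * Z i Q = q * (Z i Q * Z k P)"
proof -
  have ik: "k \<in> {1..r}" "i \<in> {1..r}" using assms by auto
  have "(\<Sum>a\<in>P. \<Sum>b\<in>Q. (Y k a * Y i b) * (u a * u b)) =
      (\<Sum>a\<in>P. \<Sum>b\<in>Q. (Y i b * Y k a) * (u a * u b))"
  proof (intro sum.cong refl)
    fix a b assume "a \<in> P" "b \<in> Q"
    then have "Y i b * Y k a = Y k a * Y i b"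
      using assms by (intro quantum_matrixD(3)[OF matrix]) auto
    then show "Y k a * Y i b * (u a * u b) = Y i b * Y k a * (u a * u b)" by simp
  qed
  then show ?thesis
    using Z_mult[OF ik assms(4-6)] by simp
qed

lemma Z_diag:
  assumes "1 \<le> i" "i < k" "k \<le> r" "P \<subseteq> {1..n}" "Q \<subseteq> {1..n}" "\<And>a b. a \<in> P \<Longrightarrow> b \<in> Q \<Longrightarrow> a < b"
  shows "Z i P * Z k Q = q * (Z k Q * Z i P) + (q - q') * (Z k P * Z i Q)"
proof -
  have ik: "k \<in> {1..r}" "i \<in> {1..r}" using assms by auto
  have "(\<Sum>a\<in>P. \<Sum>b\<in>Q. (Y i a * Y k b) * (u a * u b)) =
      (\<Sum>a\<in>P. \<Sum>b\<in>Q. (Y k b * Y i a) * (u a * u b) + (q - q') * ((Y k a * Y i b) * (u a * u b)))"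
  proof (intro sum.cong refl)
    fix a b assume "a \<in> P" "b \<in> Q"
    then have "Y i b * Y k a = Y k a * Y i b" "Y i a * Y k b - Y k b * Y i a = (q - q') * (Y i b * Y k a)"
      using assms by (intro quantum_matrixD(3,4)[OF matrix]; auto)+
    then have "Y i a * Y k b = Y k b * Y i a + (q - q') * (Y k a * Y i b)"
      by (simp add: algebra_simps)
    then show "Y i a * Y k b * (u a * u b) =
        Y k b * Y i a * (u a * u b) + (q - q') * (Y k a * Y i b * (u a * u b))"
      by (simp only: distrib_right mult.assoc)
  qed
  also have "\<dots> = (\<Sum>a\<in>P. \<Sum>b\<in>Q. (Y k b * Y i a) * (u a * u b)) +
      (q - q') * (\<Sum>a\<in>P. \<Sum>b\<in>Q. (Y k a * Y i b) * (u a * u b))"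
    by (simp add: sum.distrib sum_distrib_left)
  finally show ?thesis
    using Z_mult[OF ik(2,1) assms(4-6)] Z_mult[OF ik assms(4-6)] by simp
qed

lemma Z_split: "j \<le> l \<Longrightarrow> l \<le> Suc n \<Longrightarrow> Z i {j..n} = Z i {j..<l} + Z i {l..n}"
proof -
  assume "j \<le> l" "l \<le> Suc n"
  then have "{j..n} = {j..<l} \<union> {l..n}" "{j..<l} \<inter> {l..n} = {}" by auto
  then show ?thesis by (simp add: Z_def sum.union_disjoint)
qed

text \<open>Both sums range over the same columns, so \<open>Z_mult\<close> does not apply directly.
  Splitting off the least column leaves one pair of equal single columns, two pairs of separated
  sets, and a shorter instance of the claim.\<close>

lemma Z_col:
  assumes ik: "1 \<le> i" "i < k" "k \<le> r" and j: "1 \<le> j"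
  shows "Z i {j..n} * Z k {j..n} = q * (Z k {j..n} * Z i {j..n})"
  using j
proof (induction "Suc n - j" arbitrary: j)
  case 0
  then show ?case by (simp add: Z_def)
next
  case (Suc d)
  then have j: "1 \<le> j" "j \<le> n" by auto
  have ik': "i \<in> {1..r}" "k \<in> {1..r}" using ik by auto
  let ?A = "Z i {j..<Suc j}" and ?B = "Z i {Suc j..n}" and ?C = "Z k {j..<Suc j}" and ?D = "Z k {Suc j..n}"
  have BD: "?B * ?D = q * (?D * ?B)" using Suc by (intro Suc.hyps(1)) auto
  have "Y i j * Y k j = q * (Y k j * Y i j)"
    using ik j by (intro quantum_matrixD(2)[OF matrix]) auto
  then have AC: "?A * ?C = q * (?C * ?A)"
    using j ik' by (simp add: Z_def Yu_Yu) (simp add: mult.assoc)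
  have CB: "?C * ?B = q * (?B * ?C)"
    using ik j by (intro Z_anti) auto
  have AD: "?A * ?D = q * (?D * ?A) + (q - q') * (?C * ?B)"
    using ik j by (intro Z_diag) auto
  have "Z x {j..n} = Z x {j..<Suc j} + Z x {Suc j..n}" for x
    using j by (intro Z_split) auto
  then show ?case
    using col_identity[OF AC BD CB AD] by metis
qed

definition extend :: "nat \<Rightarrow> nat \<Rightarrow> 'r"
  where "extend i j = (if i = Suc r then t j else Z i {j..n} * t j)"

lemma quantum_matrix_extend: "quantum_matrix q q' (Suc r) n extend"
  unfolding quantum_matrix_def
proof (intro conjI allI impI)
  fix i j l assume *: "i \<in> {1..Suc r} \<and> 1 \<le> j \<and> j < l \<and> l \<le> n"
  show "extend i j * extend i l = q * (extend i l * extend i j)"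
  proof (cases "i = Suc r")
    case True
    then show ?thesis using * tt by (simp add: extend_def)
  next
    case False
    then have i: "i \<in> {1..r}" using * by auto
    let ?A = "Z i {j..<l}" and ?B = "Z i {l..n}" and ?s = "t j" and ?t = "t l"
    have sp: "Z i {j..n} = ?A + ?B" using * by (intro Z_split) auto
    have AB: "?A * ?B = q * (q * (?B * ?A))" using i * by (intro Z_row) auto
    have sB: "?s * ?B = q' * (?B * ?s)" using i * by (intro t_Z_ge) auto
    have tA: "?t * ?A = q * (?A * ?t)" using i * by (intro t_Z_less) auto
    have tB: "?t * ?B = q' * (?B * ?t)" using i * by (intro t_Z_ge) auto
    have st: "?s * ?t = q * (?t * ?s)" using * by (intro tt) auto
    show ?thesis
      using row_identity[OF AB sB tA tB st] False by (simp add: extend_def sp)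
  qed
next
  fix i k j assume *: "1 \<le> i \<and> i < k \<and> k \<le> Suc r \<and> j \<in> {1..n}"
  then have i: "i \<in> {1..r}" "i \<noteq> Suc r" by auto
  have tZ: "t j * Z x {j..n} = q' * (Z x {j..n} * t j)" if "x \<in> {1..r}" for x
    using that * by (intro t_Z_ge) auto
  show "extend i j * extend k j = q * (extend k j * extend i j)"
  proof (cases "k = Suc r")
    case True
    have "q * (t j * (Z i {j..n} * t j)) = q * (t j * Z i {j..n} * t j)" by (simp add: mult.assoc)
    also have "\<dots> = Z i {j..n} * t j * t j"
      unfolding tZ[OF i(1)] by (simp add: mult.assoc q_cancel)
    finally show ?thesis using True i by (simp add: extend_def)
  next
    case False
    then have k: "k \<in> {1..r}" using * by auto
    have c: "Z x {j..n} * t j * (Z y {j..n} * t j) = q' * (Z x {j..n} * Z y {j..n} * (t j * t j))"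
      if "y \<in> {1..r}" for x y
    proof -
      have "Z x {j..n} * t j * (Z y {j..n} * t j) = Z x {j..n} * (t j * Z y {j..n}) * t j"
        by (simp add: mult.assoc)
      then show ?thesis unfolding tZ[OF that] by (simp add: mult.assoc scalar_left(2)[of "Z _ _"])
    qed
    have "Z i {j..n} * Z k {j..n} = q * (Z k {j..n} * Z i {j..n})"
      using * k by (intro Z_col) auto
    from assoc_rule[OF this] show ?thesis
      using False i c[OF k] c[OF i(1)] by (simp add: extend_def q_cancel mult.assoc)
  qed
next
  fix i k j l assume *: "1 \<le> i \<and> i < k \<and> k \<le> Suc r \<and> 1 \<le> j \<and> j < l \<and> l \<le> n"
  then have i: "i \<in> {1..r}" "i \<noteq> Suc r" by auto
  let ?s = "t j" and ?t = "t l"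
  let ?A = "\<lambda>x. Z x {j..<l}" and ?B = "\<lambda>x. Z x {l..n}"
  have sp: "Z x {j..n} = ?A x + ?B x" for x using * by (intro Z_split) auto
  have st: "?s * ?t = q * (?t * ?s)" using * by (intro tt) auto
  have sA: "?s * ?A x = q' * (?A x * ?s)" and sB: "?s * ?B x = q' * (?B x * ?s)"
    and tA: "?t * ?A x = q * (?A x * ?t)" and tB: "?t * ?B x = q' * (?B x * ?t)"
    if "x \<in> {1..r}" for x
    using * that by (intro t_Z_ge t_Z_less; auto)+
  have "extend i l * extend k j = extend k j * extend i l \<and>
      extend i j * extend k l - extend k l * extend i j = (q - q') * (extend i l * extend k j)"
  proof (cases "k = Suc r")
    case True
    show ?thesis
      using True i last_row_identity[OF sB[OF i(1)] tA[OF i(1)] tB[OF i(1)] st]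
      by (simp add: extend_def sp)
  next
    case False
    then have k: "k \<in> {1..r}" using * by auto
    have CB: "?A k * ?B i = q * (?B i * ?A k)" using * k by (intro Z_anti) auto
    have AD: "?A i * ?B k = q * (?B k * ?A i) + (q - q') * (?A k * ?B i)"
      using * k by (intro Z_diag) auto
    have BD: "?B i * ?B k = q * (?B k * ?B i)" using * k by (intro Z_col) auto
    show ?thesis
      using False i cross_identity[OF BD CB AD sB[OF i(1)] sB[OF k] tA[OF i(1)] tA[OF k] tB[OF i(1)] tB[OF k] st]
      by (simp add: extend_def sp)
  qed
  then show "extend i l * extend k j = extend k j * extend i l"
    "extend i j * extend k l - extend k l * extend i j = (q - q') * (extend i l * extend k j)" by auto
qed

end

section \<open>Linear operators on functions\<close>

typedef (overloaded) ('b, 'k) linop = "{f :: ('b \<Rightarrow> 'k::field) \<Rightarrow> ('b \<Rightarrow> 'k).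
    (\<forall>v w. f (\<lambda>b. v b + w b) = (\<lambda>b. f v b + f w b)) \<and> (\<forall>c v. f (\<lambda>b. c * v b) = (\<lambda>b. c * f v b))}"
  morphisms app Linop
  by (rule exI[of _ "\<lambda>v. v"]) simp

setup_lifting type_definition_linop

instantiation linop :: (type, field) ring_1
begin

lift_definition zero_linop :: "('a, 'b) linop" is "\<lambda>v b. 0" by simp
lift_definition one_linop :: "('a, 'b) linop" is "\<lambda>v. v" by simp
lift_definition plus_linop :: "('a, 'b) linop \<Rightarrow> ('a, 'b) linop \<Rightarrow> ('a, 'b) linop"
  is "\<lambda>f g v b. f v b + g v b" by (simp add: fun_eq_iff algebra_simps)
lift_definition uminus_linop :: "('a, 'b) linop \<Rightarrow> ('a, 'b) linop"
  is "\<lambda>f v b. - f v b" by (simp add: fun_eq_iff)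
lift_definition minus_linop :: "('a, 'b) linop \<Rightarrow> ('a, 'b) linop \<Rightarrow> ('a, 'b) linop"
  is "\<lambda>f g v b. f v b - g v b" by (simp add: fun_eq_iff algebra_simps)
lift_definition times_linop :: "('a, 'b) linop \<Rightarrow> ('a, 'b) linop \<Rightarrow> ('a, 'b) linop"
  is "\<lambda>f g v. f (g v)" by simp

instance
proof
  fix f g h :: "('a, 'b) linop"
  show "f * g * h = f * (g * h)" "1 * f = f" "f * 1 = f"
    by (transfer, simp)+
  show "f + g + h = f + (g + h)" "f + g = g + f" "0 + f = f" "- f + f = 0" "f - g = f + - g"
    "(f + g) * h = f * h + g * h" "f * (g + h) = f * g + f * h"
    by (transfer, simp add: fun_eq_iff)+
  show "(0 :: ('a, 'b) linop) \<noteq> 1"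
  proof
    assume "(0 :: ('a, 'b) linop) = 1"
    then have "app (0 :: ('a, 'b) linop) (\<lambda>_. 1) undefined = app (1 :: ('a, 'b) linop) (\<lambda>_. 1) undefined"
      by simp
    then show False by (simp add: zero_linop.rep_eq one_linop.rep_eq)
  qed
qed

end

lift_definition scal :: "'k::field \<Rightarrow> ('b, 'k) linop" is "\<lambda>c v b. c * v b"
  by (simp add: fun_eq_iff algebra_simps)

lemma scal_central: "scal c * f = f * scal c"
  by transfer simp

lemma scal_add: "scal (c + d) = scal c + scal d"
  by transfer (simp add: fun_eq_iff distrib_right)

lemma scal_diff: "scal (c - d) = scal c - scal d"
  by transfer (simp add: fun_eq_iff left_diff_distrib)

lemma scal_mult: "scal (c * d) = scal c * scal d"
  by transfer (simp add: fun_eq_iff mult.assoc)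

lemma scal_1: "scal 1 = 1" and scal_0: "scal 0 = 0"
  by (transfer, simp add: fun_eq_iff)+

lemma scal_uminus: "scal (- c) = - scal c"
  by transfer (simp add: fun_eq_iff)

lemma scal_neg_power: "(- scal c) ^ e = scal ((- c) ^ e)"
  by (induction e) (simp_all add: scal_1 scal_mult scal_uminus)

text \<open>Translation by \<open>d\<close> followed by multiplication with \<open>\<chi>\<close>.
  With powers of \<open>q\<close> as multipliers such operators commute up to powers of
  \<open>q\<close>, and they realise a quantum torus whose associativity is that of
  composition.\<close>

lift_definition weyl :: "'b::ab_group_add \<Rightarrow> ('b \<Rightarrow> 'k) \<Rightarrow> ('b, 'k::field) linop"
  is "\<lambda>d \<chi> v b. \<chi> b * v (b - d)"
  by (simp add: fun_eq_iff algebra_simps)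

text \<open>The two orders multiply by \<open>q\<close> to the powers \<open>f b + g (b - d)\<close>
  and \<open>g b + f (b - e)\<close>. By additivity these differ by the constant
  \<open>f e - g d\<close>.\<close>

lemma weyl_commute:
  fixes q :: "'k::field" and d e :: "'b::ab_group_add"
  assumes q: "q \<noteq> 0" and f: "\<And>a b. f (a - b) = f a - f b" and g: "\<And>a b. g (a - b) = g a - g b"
    and c: "f e - g d = c"
  shows "weyl d (\<lambda>b. q powi f b) * weyl e (\<lambda>b. q powi g b) =
    scal (q powi c) * (weyl e (\<lambda>b. q powi g b) * weyl d (\<lambda>b. q powi f b))"
proof -
  have "q powi f b * q powi g (b - d) = q powi c * (q powi g b * q powi f (b - e))" for b
  proof -
    have "f b + g (b - d) = c + (g b + f (b - e))" using c by (simp add: f g)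
    then show ?thesis using q by (metis power_int_add)
  qed
  then have "(\<lambda>v b. q powi f b * (q powi g (b - d) * v (b - d - e))) =
      (\<lambda>v b. q powi c * (q powi g b * (q powi f (b - e) * v (b - e - d))))"
    by (simp add: fun_eq_iff diff_diff_eq add.commute flip: mult.assoc)
  then show ?thesis by transfer simp
qed

section \<open>Leading exponents of operators\<close>

definition leads :: "('b \<Rightarrow> int) \<Rightarrow> ('b \<Rightarrow> 'k::zero) \<Rightarrow> 'b \<Rightarrow> bool"
  where "leads w v b \<longleftrightarrow> v b \<noteq> 0 \<and> (\<forall>a. v a \<noteq> 0 \<longrightarrow> a = b \<or> w a < w b)"

text \<open>Describing an operator by its effect on leading exponents makes products trivial, since
  shifts add up under composition. Different exponents may have equal weight, hence
  \<open>leads\<close> demands that the maximal weight be attained only once.\<close>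

definition has_lead :: "('b::ab_group_add \<Rightarrow> int) \<Rightarrow> ('b, 'k::field) linop \<Rightarrow> 'b \<Rightarrow> bool"
  where "has_lead w A d \<longleftrightarrow> (\<forall>v b. leads w v b \<longrightarrow> leads w (app A v) (b + d))"

lemma has_lead_1: "has_lead w 1 0"
  by (simp add: has_lead_def one_linop.rep_eq)

lemma has_lead_scal: "c \<noteq> 0 \<Longrightarrow> has_lead w (scal c) 0"
  by (simp add: has_lead_def leads_def scal.rep_eq)

lemma has_lead_mult: "has_lead w A d \<Longrightarrow> has_lead w B e \<Longrightarrow> has_lead w (A * B) (d + e)"
  unfolding has_lead_def times_linop.rep_eq by (metis add.assoc add.commute)

lemma has_lead_scal_mult: "c \<noteq> 0 \<Longrightarrow> has_lead w A d \<Longrightarrow> has_lead w (scal c * A) d"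
  using has_lead_mult[OF has_lead_scal] by fastforce

lemma has_lead_weyl:
  assumes w: "\<And>a b. w (a + b) = w a + w b" and \<chi>: "\<And>b. \<chi> b \<noteq> 0"
  shows "has_lead w (weyl d \<chi>) d"
  unfolding has_lead_def
proof (intro allI impI)
  fix v :: "'a \<Rightarrow> 'b" and b assume v: "leads w v b"
  have "a = b + d \<or> w a < w (b + d)" if "v (a - d) \<noteq> 0" for a
  proof -
    have "a - d = b \<or> w (a - d) < w b" using v that by (auto simp: leads_def)
    moreover have "w a = w (a - d) + w d" using w[of "a - d" d] by simp
    ultimately show ?thesis by (auto simp: w)
  qed
  then show "leads w (app (weyl d \<chi>) v) (b + d)"
    using v \<chi> by (auto simp: leads_def weyl.rep_eq)
qed

lemma has_lead_add:
  fixes A B :: "('b::ab_group_add, 'k::field) linop"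
  assumes w: "\<And>a b. w (a + b) = w a + w b"
    and A: "has_lead w A d" and B: "has_lead w B e" and less: "w e < w d"
  shows "has_lead w (A + B) d"
  unfolding has_lead_def
proof (intro allI impI)
  fix v :: "'b \<Rightarrow> 'k" and b assume v: "leads w v b"
  have 1: "leads w (app A v) (b + d)" "leads w (app B v) (b + e)"
    using A B v by (auto simp: has_lead_def)
  have less': "w (b + e) < w (b + d)" using less by (simp add: w)
  have small: "w a < w (b + d)" if "app B v a \<noteq> 0" for a
    using 1(2) less' that by (auto simp: leads_def)
  then have "app B v (b + d) = 0" by fastforce
  moreover have "app A v a \<noteq> 0 \<or> app B v a \<noteq> 0" if "app A v a + app B v a \<noteq> 0" for a
    using that by auto
  ultimately show "leads w (app (A + B) v) (b + d)"
    using 1(1) small unfolding leads_def plus_linop.rep_eq by (metis add.right_neutral)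
qed

lemma has_lead_sum:
  assumes w: "\<And>a b. w (a + b) = w a + w b" and S: "finite S" "x \<in> S"
    and lead: "\<And>y. y \<in> S \<Longrightarrow> has_lead w (f y) (d y)" and less: "\<And>y. y \<in> S \<Longrightarrow> y \<noteq> x \<Longrightarrow> w (d y) < w (d x)"
  shows "has_lead w (sum f S) (d x)"
proof -
  have "has_lead w (f x + sum f T) (d x)" if "T \<subseteq> S - {x}" "finite T" for T
    using that(2,1)
  proof (induction T)
    case empty
    then show ?case using lead[OF S(2)] by simp
  next
    case (insert y T)
    have "has_lead w ((f x + sum f T) + f y) (d x)"
      using insert by (intro has_lead_add[OF w _ lead less] insert.IH) auto
    then show ?case using insert by (simp add: algebra_simps)
  qed
  from this[of "S - {x}"] show ?thesis using S by (simp add: sum.remove[OF S])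
qed

section \<open>The torus operators representing quantum matrices\<close>

type_synonym exponents = "nat \<times> nat \<Rightarrow> int"

definition unit_exp :: "nat \<Rightarrow> nat \<Rightarrow> exponents"
  where "unit_exp i j = (\<lambda>x. if x = (i, j) then 1 else 0)"

definition weight :: "nat \<Rightarrow> nat \<Rightarrow> exponents \<Rightarrow> int"
  where "weight m n b = (\<Sum>(i, j)\<in>{1..m} \<times> {1..n}. int i * int j * b (i, j))"

lemma weight_add: "weight m n (a + b) = weight m n a + weight m n b"
  by (simp add: weight_def distrib_left sum.distrib split_beta)

lemma weight_0: "weight m n 0 = 0"
  by (simp add: weight_def)

lemma weight_uminus: "weight m n (- a) = - weight m n a"
  using weight_add[of m n a "- a"] by (simp add: weight_0)

lemma weight_unit_exp: "i \<in> {1..m} \<Longrightarrow> j \<in> {1..n} \<Longrightarrow> weight m n (unit_exp i j) = int i * int j"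
proof -
  assume *: "i \<in> {1..m}" "j \<in> {1..n}"
  have "weight m n (unit_exp i j) = (\<Sum>x\<in>{1..m} \<times> {1..n}. if x = (i, j) then int i * int j else 0)"
    unfolding weight_def unit_exp_def by (rule sum.cong) (auto split: if_splits)
  also have "\<dots> = int i * int j"
    using * by (subst sum.delta) auto
  finally show ?thesis .
qed

definition torus_t :: "'k::field \<Rightarrow> nat \<Rightarrow> nat \<Rightarrow> (exponents, 'k) linop"
  where "torus_t q s j = weyl (unit_exp s j) (\<lambda>b. q powi (- (\<Sum>l<j. b (s, l))))"

text \<open>The inverse of \<open>torus_t q s p\<close> would sum over \<open>l < p\<close> only;
  the additional summand \<open>l = p\<close> is the rescaling in the p-th variable. It makes
  \<open>torus_u q s p * torus_t q s p\<close> equal to \<open>q\<close> times the reverse product,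
  as the row extension requires.\<close>

definition torus_u :: "'k::field \<Rightarrow> nat \<Rightarrow> nat \<Rightarrow> (exponents, 'k) linop"
  where "torus_u q s p = weyl (- unit_exp s p) (\<lambda>b. q powi (\<Sum>l\<le>p. b (s, l)))"

lemma sum_unit_exp:
  "(\<Sum>l<j. unit_exp s p (r, l)) = (if r = s \<and> p < j then 1 else 0)"
  "(\<Sum>l\<le>j. unit_exp s p (r, l)) = (if r = s \<and> p \<le> j then 1 else 0)"
  by (auto simp: unit_exp_def sum.delta')

lemma torus_commute:
  assumes q: "q \<noteq> (0::'k::field)"
  shows "torus_t q r j * torus_t q s l = scal (q powi ((if r = s \<and> j < l then 1 else 0) - (if r = s \<and> l < j then 1 else 0)))
      * (torus_t q s l * torus_t q r j)" (is ?tt)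
    and "torus_u q r j * torus_u q s l = scal (q powi ((if r = s \<and> j \<le> l then 1 else 0) - (if r = s \<and> l \<le> j then 1 else 0)))
      * (torus_u q s l * torus_u q r j)" (is ?uu)
    and "torus_u q r p * torus_t q s j = scal (q powi ((if r = s \<and> j \<le> p then 1 else 0) - (if r = s \<and> p < j then 1 else 0)))
      * (torus_t q s j * torus_u q r p)" (is ?ut)
proof -
  show ?tt
    unfolding torus_t_def
    by (rule weyl_commute[OF q]) (auto simp: sum_unit_exp sum_subtractf)
  show ?uu
    unfolding torus_u_def
    by (rule weyl_commute[OF q]) (auto simp: sum_unit_exp sum_subtractf sum_negf)
  show ?ut
    unfolding torus_u_def torus_t_def
    by (rule weyl_commute[OF q]) (auto simp: sum_unit_exp sum_subtractf sum_negf)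
qed

primrec qmat_op :: "'k::field \<Rightarrow> nat \<Rightarrow> nat \<Rightarrow> nat \<Rightarrow> nat \<Rightarrow> (exponents, 'k) linop" where
  "qmat_op q n 0 = (\<lambda>i j. 0)"
| "qmat_op q n (Suc r) = (\<lambda>i j. if i = Suc r then torus_t q (Suc r) j
    else (\<Sum>p\<in>{j..n}. qmat_op q n r i p * torus_u q (Suc r) p) * torus_t q (Suc r) j)"

lemma commutes_sum_mult:
  fixes x :: "'r::ring_1"
  assumes "\<And>p. p \<in> P \<Longrightarrow> f p * x = x * f p" "\<And>p. p \<in> P \<Longrightarrow> g p * x = x * g p" "t * x = x * t"
  shows "(\<Sum>p\<in>P. f p * g p) * t * x = x * ((\<Sum>p\<in>P. f p * g p) * t)"
proof -
  have "f p * g p * x = x * (f p * g p)" if "p \<in> P" for p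
    using assms(1,2)[OF that] by (metis mult.assoc)
  then have "(\<Sum>p\<in>P. f p * g p) * x = x * (\<Sum>p\<in>P. f p * g p)"
    by (simp add: sum_distrib_left sum_distrib_right)
  then have "(\<Sum>p\<in>P. f p * g p) * x * t = x * ((\<Sum>p\<in>P. f p * g p) * t)"
    by (simp only: mult.assoc)
  then show ?thesis by (simp only: assms(3) mult.assoc)
qed

text \<open>The operators of stage \<open>r\<close> only involve the torus variables with row index
  up to \<open>r\<close>, and variables with different row indices commute.\<close>

lemma qmat_op_commute:
  assumes q: "q \<noteq> 0"
  shows "r < s \<Longrightarrow> qmat_op q n r i j * torus_t q s l = torus_t q s l * qmat_op q n r i j"
    and "r < s \<Longrightarrow> qmat_op q n r i j * torus_u q s l = torus_u q s l * qmat_op q n r i j"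
proof (induction r arbitrary: i j)
  case (Suc r)
  case 1
  have "torus_t q (Suc r) j * torus_t q s l = torus_t q s l * torus_t q (Suc r) j"
    "torus_u q (Suc r) p * torus_t q s l = torus_t q s l * torus_u q (Suc r) p" for j p
    using torus_commute(1)[OF q, of "Suc r" j s l] torus_commute(3)[OF q, of "Suc r" p s l] 1
    by (simp_all add: scal_1)
  then show ?case using Suc 1 by (auto intro: commutes_sum_mult)
next
  case (Suc r)
  case 2
  have "torus_t q (Suc r) j * torus_u q s l = torus_u q s l * torus_t q (Suc r) j"
    "torus_u q (Suc r) p * torus_u q s l = torus_u q s l * torus_u q (Suc r) p" for j p
    using torus_commute(2)[OF q, of "Suc r" p s l] torus_commute(3)[OF q, of s l "Suc r" j] 2
    by (simp_all add: scal_1)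
  then show ?case using Suc 2 by (auto intro: commutes_sum_mult)
qed simp_all

lemma quantum_matrix_qmat_op:
  assumes q: "q \<noteq> (0::'k::field)"
  shows "quantum_matrix (scal q) (scal (inverse q)) r n (qmat_op q n r)"
proof (induction r)
  case 0
  then show ?case by (auto simp: quantum_matrix_def)
next
  case (Suc r)
  interpret quantum_row_extension "scal q" "scal (inverse q)" r n "qmat_op q n r"
    "torus_t q (Suc r)" "torus_u q (Suc r)"
  proof
    show "scal q * scal (inverse q) = (1 :: (exponents, 'k) linop)"
      using q by (simp add: scal_1 flip: scal_mult)
    show "torus_t q (Suc r) j * torus_t q (Suc r) l = scal q * (torus_t q (Suc r) l * torus_t q (Suc r) j)"
      if "j < l" for j l
      using torus_commute(1)[OF q, of "Suc r" j "Suc r" l] that by simp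
    show "torus_u q (Suc r) j * torus_u q (Suc r) l = scal q * (torus_u q (Suc r) l * torus_u q (Suc r) j)"
      if "j < l" for j l
      using torus_commute(2)[OF q, of "Suc r" j "Suc r" l] that by simp
    show "torus_u q (Suc r) p * torus_t q (Suc r) j = scal q * (torus_t q (Suc r) j * torus_u q (Suc r) p)"
      if "j \<le> p" for j p
      using torus_commute(3)[OF q, of "Suc r" p "Suc r" j] that by simp
    show "torus_t q (Suc r) j * torus_u q (Suc r) p = scal q * (torus_u q (Suc r) p * torus_t q (Suc r) j)"
      if "p < j" for p j
    proof -
      have "torus_u q (Suc r) p * torus_t q (Suc r) j = scal (inverse q) * (torus_t q (Suc r) j * torus_u q (Suc r) p)"
        using torus_commute(3)[OF q, of "Suc r" p "Suc r" j] that by simp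
      then have "scal q * (torus_u q (Suc r) p * torus_t q (Suc r) j) =
          scal (q * inverse q) * (torus_t q (Suc r) j * torus_u q (Suc r) p)"
        by (simp add: scal_mult mult.assoc)
      then show ?thesis using q by (simp add: scal_1)
    qed
  qed (use Suc qmat_op_commute[OF q] scal_central in auto)
  have "qmat_op q n (Suc r) = extend"
    by (auto simp: fun_eq_iff extend_def Z_def)
  then show ?case using quantum_matrix_extend by simp
qed

text \<open>Passing from \<open>r\<close> to \<open>Suc r\<close>, the summand \<open>p\<close> has
  weight \<open>(i - Suc r) * p\<close> with a negative factor, so the least index
  \<open>p = j\<close> dominates. The final factor \<open>torus_t\<close> then cancels the exponent
  of \<open>torus_u\<close> and leaves \<open>unit_exp i j\<close>.\<close>

lemma qmat_op_lead:
  assumes q: "q \<noteq> 0" and "1 \<le> i" "i \<le> r" "r \<le> m" "1 \<le> j" "j \<le> n"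
  shows "has_lead (weight m n) (qmat_op q n r i j) (unit_exp i j)"
  using assms(2-6)
proof (induction r arbitrary: j)
  case (Suc r)
  have t: "has_lead (weight m n) (torus_t q s j) (unit_exp s j)" for s
    unfolding torus_t_def using q by (intro has_lead_weyl weight_add) auto
  have u: "has_lead (weight m n) (torus_u q s p) (- unit_exp s p)" for s p
    unfolding torus_u_def using q by (intro has_lead_weyl weight_add) auto
  show ?case
  proof (cases "i = Suc r")
    case True
    then show ?thesis using t by simp
  next
    case False
    have "has_lead (weight m n) (\<Sum>p\<in>{j..n}. qmat_op q n r i p * torus_u q (Suc r) p)
        (unit_exp i j + - unit_exp (Suc r) j)"
    proof (rule has_lead_sum[where d = "\<lambda>p. unit_exp i p + - unit_exp (Suc r) p"])
      fix p assume p: "p \<in> {j..n}"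
      show "has_lead (weight m n) (qmat_op q n r i p * torus_u q (Suc r) p) (unit_exp i p + - unit_exp (Suc r) p)"
        using p Suc.prems False by (intro has_lead_mult u Suc.IH) auto
      assume "p \<noteq> j"
      then have "j < p" using p by simp
      have w: "weight m n (unit_exp i x + - unit_exp (Suc r) x) = (int i - int (Suc r)) * int x"
        if "x \<in> {j..n}" for x
        using that Suc.prems by (simp add: weight_add weight_uminus weight_unit_exp left_diff_distrib
              del: add_uminus_conv_diff)
      have "(int i - int (Suc r)) * int p < (int i - int (Suc r)) * int j"
        using \<open>j < p\<close> Suc.prems False by (intro mult_strict_left_mono_neg) auto
      then show "weight m n (unit_exp i p + - unit_exp (Suc r) p) < weight m n (unit_exp i j + - unit_exp (Suc r) j)"
        using w[of p] w[of j] p Suc.prems by simp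
    qed (use Suc.prems in \<open>auto simp: weight_add\<close>)
    from has_lead_mult[OF this t[of "Suc r"]] show ?thesis
      using False by (simp add: algebra_simps)
  qed
qed simp

section \<open>Leading exponents of minors and tableaux\<close>

definition diagonal_exp :: "nat \<Rightarrow> nat list \<Rightarrow> exponents"
  where "diagonal_exp i ks =
    (\<lambda>(a, b). if i \<le> a \<and> a < i + length ks \<and> ks ! (a - i) = b then 1 else 0)"

lemma diagonal_exp_Nil: "diagonal_exp i [] = 0"
  by (auto simp: diagonal_exp_def fun_eq_iff)

lemma diagonal_exp_Cons: "diagonal_exp i (k # ks) = unit_exp i k + diagonal_exp (Suc i) ks"
proof
  fix x :: "nat \<times> nat"
  obtain a b where x: "x = (a, b)" by (cases x)
  have "i < a \<Longrightarrow> a - i = Suc (a - Suc i)" by auto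
  then show "diagonal_exp i (k # ks) x = (unit_exp i k + diagonal_exp (Suc i) ks) x"
    by (cases a i rule: linorder_cases) (auto simp: diagonal_exp_def unit_exp_def x)
qed

text \<open>The column \<open>j\<close>, placed in the top row, moves down to its diagonal position
  by exchanges with the next row. Passing an entry \<open>k < j\<close> raises the weight by
  \<open>j - k\<close>, because row numbers increase by one.\<close>

lemma diagonal_weight_exchange:
  assumes "sorted_wrt (<) (k # ks)" "j \<in> set ks" "set (k # ks) \<subseteq> {1..n}" "1 \<le> i" "i + length ks \<le> m"
  shows "weight m n (unit_exp i j + diagonal_exp (Suc i) (k # remove1 j ks)) <
    weight m n (diagonal_exp i (k # ks))"
  using assms
proof (induction ks arbitrary: k i)
  case (Cons l ks)
  have kl: "k < l" using Cons.prems by simp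
  have lj: "l \<le> j" using Cons.prems by auto
  let ?w = "weight m n"
  have in1: "i \<in> {1..m}" "Suc i \<in> {1..m}" "j \<in> {1..n}" "k \<in> {1..n}" using Cons.prems by auto
  have "?w (unit_exp (Suc i) j + diagonal_exp (Suc (Suc i)) (remove1 j (l # ks))) \<le>
      ?w (diagonal_exp (Suc i) (l # ks))"
  proof (cases "j = l")
    case False
    then have "?w (unit_exp (Suc i) j + diagonal_exp (Suc (Suc i)) (l # remove1 j ks)) <
        ?w (diagonal_exp (Suc i) (l # ks))"
      using Cons.prems by (intro Cons.IH) auto
    then show ?thesis using False by simp
  qed (simp add: diagonal_exp_Cons)
  then have "?w (diagonal_exp (Suc (Suc i)) (remove1 j (l # ks))) \<le>
      ?w (diagonal_exp (Suc i) (l # ks)) - int (Suc i) * int j"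
    using in1 by (simp add: weight_add weight_unit_exp)
  moreover have "int (Suc i) * int k + int i * int j < int (Suc i) * int j + int i * int k"
    using kl lj by (simp add: algebra_simps)
  ultimately show ?case
    using in1 by (simp only: diagonal_exp_Cons weight_add weight_unit_exp)
qed simp

text \<open>By the exchange inequality the least column dominates the expansion along the top row,
  and induction on the remaining rows completes the diagonal. The coefficients are powers of
  \<open>- q\<close>, hence nonzero.\<close>

lemma qdet_lead:
  fixes q :: "'k::field"
  assumes q: "q \<noteq> 0"
    and X: "\<And>i j. i \<in> {1..m} \<Longrightarrow> j \<in> {1..n} \<Longrightarrow> has_lead (weight m n) (X i j) (unit_exp i j)"
    and ks: "sorted_wrt (<) ks" "set ks \<subseteq> {1..n}" and i: "1 \<le> i" "i + length ks \<le> Suc m"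
  shows "has_lead (weight m n) (qdet X (scal q) [i..<i + length ks] (set ks)) (diagonal_exp i ks)"
  using ks i
proof (induction "length ks" arbitrary: i ks)
  case 0
  then show ?case using has_lead_1[of "weight m n", folded diagonal_exp_Nil[of i]] by simp
next
  case (Suc N)
  then obtain k ks' where ks: "ks = k # ks'" by (cases ks) auto
  let ?d = "\<lambda>j. unit_exp i j + diagonal_exp (Suc i) (remove1 j ks)"
  have dist: "distinct ks" using Suc.prems strict_sorted_iff by blast
  have "[i..<i + length ks] = i # [Suc i..<i + length ks]"
    using Suc(2) by (intro upt_conv_Cons) auto
  then have eq: "qdet X (scal q) [i..<i + length ks] (set ks) = (\<Sum>j\<in>set ks. (- scal q) ^ below (set ks) j *
      (X i j * qdet X (scal q) [Suc i..<i + length ks] (set ks - {j})))"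
    by (simp add: qdet.simps(2))
  have "has_lead (weight m n) (\<Sum>j\<in>set ks. (- scal q) ^ below (set ks) j *
      (X i j * qdet X (scal q) [Suc i..<i + length ks] (set ks - {j}))) (?d k)"
  proof (rule has_lead_sum[where d = ?d])
    fix j assume j: "j \<in> set ks"
    have len: "length (remove1 j ks) = N" using j Suc(2) by (simp add: length_remove1)
    have "has_lead (weight m n) (qdet X (scal q) [Suc i..<Suc i + length (remove1 j ks)] (set (remove1 j ks)))
        (diagonal_exp (Suc i) (remove1 j ks))"
    proof (rule Suc.hyps(1))
      show "sorted_wrt (<) (remove1 j ks)"
        using Suc.prems dist by (simp add: strict_sorted_iff sorted_remove1)
      show "set (remove1 j ks) \<subseteq> {1..n}" using Suc.prems set_remove1_subset by fastforce
    qed (use Suc(2) Suc.prems len in auto)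
    moreover have "Suc i + length (remove1 j ks) = i + length ks" using len Suc(2) by simp
    ultimately have "has_lead (weight m n) (qdet X (scal q) [Suc i..<i + length ks] (set ks - {j}))
        (diagonal_exp (Suc i) (remove1 j ks))"
      using dist by (simp only: set_remove1_eq)
    then show "has_lead (weight m n) ((- scal q) ^ below (set ks) j *
      (X i j * qdet X (scal q) [Suc i..<i + length ks] (set ks - {j}))) (?d j)"
      unfolding scal_neg_power using q j Suc.prems Suc(2)
      by (intro has_lead_scal_mult has_lead_mult X) auto
    assume "j \<noteq> k"
    then show "weight m n (?d j) < weight m n (?d k)"
      using diagonal_weight_exchange[of k ks' j n i m] j Suc.prems ks by (simp add: diagonal_exp_Cons)
  qed (auto simp: weight_add ks)
  then show ?case unfolding eq by (simp add: ks diagonal_exp_Cons)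
qed

definition tableau_exp :: "nat list list \<Rightarrow> exponents"
  where "tableau_exp T = sum_list (map (diagonal_exp 1) T)"

lemma tableau_lead:
  fixes q :: "'k::field"
  assumes q: "q \<noteq> 0"
    and X: "\<And>i j. i \<in> {1..m} \<Longrightarrow> j \<in> {1..n} \<Longrightarrow> has_lead (weight m n) (X i j) (unit_exp i j)"
    and T: "set T \<subseteq> increasing_rows m n"
  shows "has_lead (weight m n) (prod_list (map (\<lambda>J. qdet X (scal q) [1..<Suc m] (set J)) T)) (tableau_exp T)"
  using T
proof (induction T)
  case (Cons J T)
  have J: "sorted_wrt (<) J" "set J \<subseteq> {1..n}" "length J = m"
    using Cons.prems by (auto simp: increasing_rows_def)
  have "has_lead (weight m n) (qdet X (scal q) [1..<Suc m] (set J)) (diagonal_exp 1 J)"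
    using qdet_lead[OF q X J(1,2), of 1] J(3) by simp
  then show ?case
    unfolding tableau_exp_def list.map prod_list.Cons sum_list.Cons
    using Cons by (intro has_lead_mult) (simp_all add: tableau_exp_def)
next
  case Nil
  show ?case by (simp only: tableau_exp_def list.map prod_list.Nil sum_list.Nil has_lead_1)
qed

lemma tableau_exp_apply:
  assumes "set T \<subseteq> increasing_rows m n" "1 \<le> i" "i \<le> m"
  shows "tableau_exp T (i, j) = int (count (mset (map (\<lambda>J. J ! (i - 1)) T)) j)"
  using assms by (induction T) (auto simp: tableau_exp_def diagonal_exp_def increasing_rows_def)

lemma preferred_columns_sorted:
  assumes "T \<in> preferred_tableaux m n" "i < m"
  shows "sorted (map (\<lambda>J. J ! i) T)"
proof -
  have "successively (list_all2 (\<le>)) T" "\<forall>J\<in>set T. length J = m"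
    using assms by (auto simp: preferred_tableaux_def increasing_rows_def)
  then have "successively (\<le>) (map (\<lambda>J. J ! i) T)"
  proof (induction T rule: induct_list012)
    case (3 x y zs)
    then show ?case using assms(2) by (auto simp: list_all2_conv_all_nth)
  qed auto
  then show ?thesis
    by (simp add: successively_conv_sorted_wrt)
qed

text \<open>The exponent at \<open>(i, j)\<close> counts the entries \<open>j\<close> in column
  \<open>i\<close>. Columns of a preferred tableau are weakly increasing and so are recovered from
  their multisets of entries; the first column also shows the number of rows.\<close>

lemma tableau_exp_inj:
  assumes "1 \<le> m"
  shows "inj_on tableau_exp (preferred_tableaux m n)"
proof (rule inj_onI)
  fix S T assume S: "S \<in> preferred_tableaux m n" and T: "T \<in> preferred_tableaux m n"
    and eq: "tableau_exp S = tableau_exp T"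
  have sub: "set S \<subseteq> increasing_rows m n" "set T \<subseteq> increasing_rows m n"
    using S T by (auto simp: preferred_tableaux_def)
  have col: "map (\<lambda>J. J ! i) S = map (\<lambda>J. J ! i) T" if "i < m" for i
  proof -
    have "count (mset (map (\<lambda>J. J ! i) S)) j = count (mset (map (\<lambda>J. J ! i) T)) j" for j
      using tableau_exp_apply[OF sub(1), of "Suc i" j] tableau_exp_apply[OF sub(2), of "Suc i" j] eq that by simp
    then have "mset (map (\<lambda>J. J ! i) S) = mset (map (\<lambda>J. J ! i) T)"
      by (rule multiset_eqI)
    then show ?thesis
      using preferred_columns_sorted[OF S that] preferred_columns_sorted[OF T that]
      by (metis properties_for_sort)
  qed
  have len: "length S = length T" using col[of 0] assms by (metis length_map less_eq_Suc_le One_nat_def)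
  show "S = T"
  proof (rule nth_equalityI[OF len])
    fix a assume a: "a < length S"
    have lens: "length (S ! a) = m" "length (T ! a) = m"
      using sub subsetD[OF sub(1) nth_mem[of a S]] subsetD[OF sub(2) nth_mem[of a T]] a len
      by (auto simp: increasing_rows_def)
    show "S ! a = T ! a"
    proof (rule nth_equalityI)
      fix i assume "i < length (S ! a)"
      then have "map (\<lambda>J. J ! i) S ! a = map (\<lambda>J. J ! i) T ! a" using col lens by simp
      then show "S ! a ! i = T ! a ! i" using a len by simp
    qed (simp add: lens)
  qed
qed

section \<open>Linear independence by leading exponents\<close>

lemma app_sum: "app (sum f S) v b = (\<Sum>x\<in>S. app (f x) v b)"
  by (induction S rule: infinite_finite_induct) (simp_all add: zero_linop.rep_eq plus_linop.rep_eq)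

text \<open>
  The values at the unit vector of weight \<open>0\<close> have distinct leading exponents, so the coefficient
  at an exponent of maximal weight cannot cancel.
\<close>

lemma leads_independent:
  fixes c :: "'i \<Rightarrow> 'k::field" and f :: "'i \<Rightarrow> ('b::ab_group_add, 'k) linop"
  assumes S: "finite S" and lead: "\<And>x. x \<in> S \<Longrightarrow> has_lead w (f x) (d x)" and inj: "inj_on d S"
    and zero: "(\<Sum>x\<in>S. scal (c x) * f x) = 0"
  shows "\<forall>x\<in>S. c x = 0"
proof (rule ccontr)
  assume "\<not> (\<forall>x\<in>S. c x = 0)"
  define S' where "S' = {x \<in> S. c x \<noteq> 0}"
  have S': "finite S'" "S' \<noteq> {}" using S \<open>\<not> _\<close> by (auto simp: S'_def)
  then have "\<exists>x\<in>S'. \<forall>y\<in>S'. w (d y) \<le> w (d x)"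
    using Max_in[of "(w \<circ> d) ` S'"] Max_ge[of "(w \<circ> d) ` S'"] by fastforce
  then obtain x where x: "x \<in> S'" and max: "\<And>y. y \<in> S' \<Longrightarrow> w (d y) \<le> w (d x)" by blast
  define e where "e = (\<lambda>b::'b. if b = 0 then 1 else 0 :: 'k)"
  have "leads w e 0" by (simp add: leads_def e_def)
  then have l: "leads w (app (f y) e) (d y)" if "y \<in> S" for y
    using lead[OF that] unfolding has_lead_def by (metis add_0)
  have "0 = (\<Sum>y\<in>S. c y * app (f y) e (d x))"
    using arg_cong[OF zero, of "\<lambda>g. app g e (d x)"]
    by (simp add: app_sum times_linop.rep_eq scal.rep_eq zero_linop.rep_eq)
  also have "\<dots> = (\<Sum>y\<in>{x}. c y * app (f y) e (d x))"
  proof (rule sum.mono_neutral_right[OF S])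
    show "\<forall>y\<in>S - {x}. c y * app (f y) e (d x) = 0"
    proof
      fix y assume y: "y \<in> S - {x}"
      show "c y * app (f y) e (d x) = 0"
      proof (cases "c y = 0")
        case False
        then have "w (d y) \<le> w (d x)" using y by (intro max) (simp add: S'_def)
        moreover have "d x \<noteq> d y" using y x inj by (auto simp: S'_def inj_on_def)
        ultimately show ?thesis using l[of y] y by (force simp: leads_def)
      qed simp
    qed
  qed (use x in \<open>simp add: S'_def\<close>)
  finally show False
    using x l[of x] by (simp add: S'_def leads_def)
qed

section \<open>Evaluation of the free algebra\<close>

primrec word_inversions :: "nat list \<Rightarrow> nat" where
  "word_inversions [] = 0"
| "word_inversions (x # w) = below (set w) x + word_inversions w"

lemma qdet_eq_sum_words:
  fixes X :: "nat \<Rightarrow> nat \<Rightarrow> 'r::ring_1"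
  assumes q: "\<And>x. q * x = x * q" and "finite K" "card K = length r"
  shows "qdet X q r K =
    (\<Sum>w\<in>permutations_of_set K. (- q) ^ word_inversions w * prod_list (map2 X r w))"
  using assms(2,3)
proof (induction r arbitrary: K)
  case (Cons i r)
  have K: "K \<noteq> {}" using Cons.prems by auto
  have c: "X a b * ((- q) ^ k * y) = (- q) ^ k * (X a b * y)" for a b k y
    by (rule central_mult_left[OF central_power[OF q]])
  have "(\<Sum>w\<in>permutations_of_set K. (- q) ^ word_inversions w * prod_list (map2 X (i # r) w)) =
    (\<Sum>j\<in>K. \<Sum>w\<in>(#) j ` permutations_of_set (K - {j}).
      (- q) ^ word_inversions w * prod_list (map2 X (i # r) w))"
    unfolding permutations_of_set_nonempty[OF K] using Cons.prems
    by (subst sum.UNION_disjoint) auto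
  also have "\<dots> = (\<Sum>j\<in>K. (- q) ^ below K j * (X i j * qdet X q r (K - {j})))"
  proof (rule sum.cong[OF refl])
    fix j assume j: "j \<in> K"
    have IH: "qdet X q r (K - {j}) = (\<Sum>w\<in>permutations_of_set (K - {j}).
        (- q) ^ word_inversions w * prod_list (map2 X r w))"
      using Cons.prems j by (intro Cons.IH) (auto simp: card_Diff_singleton)
    have "(\<Sum>w\<in>(#) j ` permutations_of_set (K - {j}). (- q) ^ word_inversions w * prod_list (map2 X (i # r) w)) =
        (\<Sum>w\<in>permutations_of_set (K - {j}). (- q) ^ word_inversions (j # w) * prod_list (map2 X (i # r) (j # w)))"
      by (subst sum.reindex) auto
    also have "\<dots> = (\<Sum>w\<in>permutations_of_set (K - {j}).
        (- q) ^ below K j * (X i j * ((- q) ^ word_inversions w * prod_list (map2 X r w))))"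
    proof (rule sum.cong[OF refl])
      fix w assume "w \<in> permutations_of_set (K - {j})"
      then have "below (set w) j = below K j"
        using below_remove_le[of j j K] by (simp add: permutations_of_setD)
      then show "(- q) ^ word_inversions (j # w) * prod_list (map2 X (i # r) (j # w)) =
          (- q) ^ below K j * (X i j * ((- q) ^ word_inversions w * prod_list (map2 X r w)))"
        by (simp add: power_add c mult.assoc)
    qed
    finally show "(\<Sum>w\<in>(#) j ` permutations_of_set (K - {j}). (- q) ^ word_inversions w * prod_list (map2 X (i # r) w)) =
        (- q) ^ below K j * (X i j * qdet X q r (K - {j}))"
      unfolding IH by (simp add: sum_distrib_left)
  qed
  finally show ?case by (simp add: qdet.simps(2))
qed simp

lemma word_inversions_eq_card:
  "distinct w \<Longrightarrow> word_inversions w = card {(i, j). i < j \<and> j < length w \<and> w ! j < w ! i}"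
proof (induction w)
  case (Cons x w)
  let ?P = "{(i, j). i < j \<and> j < length w \<and> w ! j < w ! i}" and ?J = "{j. j < length w \<and> w ! j < x}"
  have eq: "{(i, j). i < j \<and> j < length (x # w) \<and> (x # w) ! j < (x # w) ! i} =
      (\<lambda>j. (0, Suc j)) ` ?J \<union> map_prod Suc Suc ` ?P" (is "?A = ?B \<union> ?C")
  proof (rule Set.set_eqI)
    fix p :: "nat \<times> nat"
    obtain i j where "p = (i, j)" by (cases p)
    then show "p \<in> ?A \<longleftrightarrow> p \<in> ?B \<union> ?C"
      by (cases i; cases j) (auto simp: image_iff)
  qed
  have fin: "finite ?J" "finite ?P"
    by simp (rule finite_subset[of _ "{..<length w} \<times> {..<length w}"], auto)
  have "below (set w) x = card ((!) w ` ?J)"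
    unfolding below_def by (rule arg_cong[where f = card]) (auto simp: in_set_conv_nth)
  also have "\<dots> = card ?J"
    using Cons.prems by (intro card_image) (auto simp: inj_on_def nth_eq_iff_index_eq)
  finally have "below (set w) x = card ?B"
    by (subst card_image) (auto simp: inj_on_def)
  moreover have "card ?C = card ?P"
    by (rule card_image) (auto simp: inj_on_def)
  moreover have "card (?B \<union> ?C) = card ?B + card ?C"
    using fin by (intro card_Un_disjoint finite_imageI) auto
  ultimately show ?case
    unfolding eq using Cons by simp
qed simp

lemma permutations_of_set_permute_list:
  assumes "distinct J"
  shows "bij_betw (\<lambda>\<sigma>. permute_list \<sigma> J) {\<sigma>. \<sigma> permutes {..<length J}} (permutations_of_set (set J))"
proof -
  let ?P = "{\<sigma>. \<sigma> permutes {..<length J}}"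
  have inj: "inj_on (\<lambda>\<sigma>. permute_list \<sigma> J) ?P"
  proof (rule inj_onI)
    fix \<sigma> \<tau> assume *: "\<sigma> \<in> ?P" "\<tau> \<in> ?P" and eq: "permute_list \<sigma> J = permute_list \<tau> J"
    show "\<sigma> = \<tau>"
    proof
      fix i
      show "\<sigma> i = \<tau> i"
      proof (cases "i < length J")
        case True
        then have "\<sigma> i < length J" "\<tau> i < length J"
          using * permutes_in_image[of _ "{..<length J}" i] by auto
        moreover have "J ! \<sigma> i = J ! \<tau> i"
          using True eq * by (metis mem_Collect_eq permute_list_nth)
        ultimately show ?thesis using assms by (simp add: nth_eq_iff_index_eq)
      next
        case False
        then show ?thesis using * by (metis lessThan_iff mem_Collect_eq permutes_not_in)
      qed
    qed
  qed
  \<comment> \<open>Surjectivity follows by counting, since both sides have as many elements as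
    there are permutations of the positions of \<open>J\<close>.\<close>
  have "card ((\<lambda>\<sigma>. permute_list \<sigma> J) ` ?P) = card (permutations_of_set (set J))"
    using assms by (simp add: card_image[OF inj] card_permutations distinct_card)
  moreover have "(\<lambda>\<sigma>. permute_list \<sigma> J) ` ?P \<subseteq> permutations_of_set (set J)"
    using assms by (auto simp: permutations_of_set_def)
  ultimately show ?thesis
    unfolding bij_betw_def using inj by (simp add: card_subset_eq)
qed

text \<open>Connects the recursive determinant with the defining sum of a minor: as \<open>J\<close>
  is increasing, the word \<open>permute_list \<sigma> J\<close> has the same inversions as
  \<open>\<sigma>\<close>.\<close>

lemma qdet_eq_sum_permutations:
  fixes X :: "nat \<Rightarrow> nat \<Rightarrow> 'r::ring_1"
  assumes q: "\<And>x. q * x = x * q" and J: "J \<in> increasing_rows m n"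
  shows "qdet X q [1..<Suc m] (set J) = (\<Sum>\<sigma> | \<sigma> permutes {..<m}.
    (- q) ^ perm_length m \<sigma> * prod_list (map (\<lambda>i. X (Suc i) (J ! \<sigma> i)) [0..<m]))"
proof -
  have J': "length J = m" "sorted_wrt (<) J" "distinct J"
    using J by (auto simp: increasing_rows_def strict_sorted_iff)
  have "qdet X q [1..<Suc m] (set J) =
    (\<Sum>w\<in>permutations_of_set (set J). (- q) ^ word_inversions w * prod_list (map2 X [1..<Suc m] w))"
    using J' by (intro qdet_eq_sum_words[OF q]) (auto simp: distinct_card)
  also have "\<dots> = (\<Sum>\<sigma> | \<sigma> permutes {..<length J}. (- q) ^ word_inversions (permute_list \<sigma> J) *
      prod_list (map2 X [1..<Suc m] (permute_list \<sigma> J)))"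
    by (rule sum.reindex_bij_betw[OF permutations_of_set_permute_list[OF J'(3)], symmetric])
  also have "\<dots> = (\<Sum>\<sigma> | \<sigma> permutes {..<m}.
    (- q) ^ perm_length m \<sigma> * prod_list (map (\<lambda>i. X (Suc i) (J ! \<sigma> i)) [0..<m]))"
    unfolding J'(1)
  proof (rule sum.cong[OF refl], clarify)
    fix \<sigma> assume \<sigma>: "\<sigma> permutes {..<m}"
    have lt: "\<sigma> i < m" if "i < m" for i using permutes_in_image[OF \<sigma>, of i] that by simp
    have "J ! \<sigma> j < J ! \<sigma> i \<longleftrightarrow> \<sigma> j < \<sigma> i" if "i < m" "j < m" for i j
      using sorted_wrt_nth_less[OF J'(2)] lt that J'(1)
      by (metis linorder_neqE_nat order_less_asym order_less_irrefl)
    then have "{(i, j). i < j \<and> j < m \<and> J ! \<sigma> j < J ! \<sigma> i} = {(i, j). i < j \<and> j < m \<and> \<sigma> j < \<sigma> i}"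
      by auto
    moreover have "{(i, j). i < j \<and> j < length (permute_list \<sigma> J) \<and> permute_list \<sigma> J ! j < permute_list \<sigma> J ! i} =
        {(i, j). i < j \<and> j < m \<and> J ! \<sigma> j < J ! \<sigma> i}"
      using \<sigma> J'(1) by (auto simp: permute_list_nth)
    ultimately have inv: "word_inversions (permute_list \<sigma> J) = perm_length m \<sigma>"
      using \<sigma> J' by (subst word_inversions_eq_card) (simp_all add: perm_length_def)
    have "map2 X [1..<Suc m] (permute_list \<sigma> J) = map (\<lambda>i. X (Suc i) (J ! \<sigma> i)) [0..<m]"
      by (rule nth_equalityI) (use \<sigma> J'(1) in \<open>auto simp: permute_list_nth simp del: upt_Suc\<close>)
    then show "(- q) ^ word_inversions (permute_list \<sigma> J) * prod_list (map2 X [1..<Suc m] (permute_list \<sigma> J)) =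
      (- q) ^ perm_length m \<sigma> * prod_list (map (\<lambda>i. X (Suc i) (J ! \<sigma> i)) [0..<m])"
      by (simp only: inv)
  qed
  finally show ?thesis .
qed

section \<open>Evaluation at operators\<close>

abbreviation sc :: "'k::field \<Rightarrow> 'a free_monoid \<Rightarrow>\<^sub>0 'k"
  where "sc c \<equiv> Poly_Mapping.single 0 c"

lemma sc_mult: "sc (c * d) = sc c * sc d" and sc_add: "sc (c + d) = sc c + sc d"
  and sc_diff: "sc (c - d) = sc c - sc d" and sc_1: "sc 1 = 1" and sc_uminus: "sc (- c) = - sc c"
  by (simp_all add: mult_single single_add single_diff single_uminus)

lemma sc_neg_power: "(- sc c) ^ e = sc ((- c) ^ e)"
  by (induction e) (simp_all add: sc_mult sc_uminus)

lemma poly_mapping_induct_add: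
  fixes f :: "'a \<Rightarrow>\<^sub>0 'b::ab_group_add"
  assumes "P 0" "\<And>k v. P (Poly_Mapping.single k v)" "\<And>f g. P f \<Longrightarrow> P g \<Longrightarrow> P (f + g)"
  shows "P f"
proof (induction f rule: update_induct)
  case (update f k v)
  have "Poly_Mapping.update k v f = f + Poly_Mapping.single k v"
    using update(1) by (intro poly_mapping_eqI) (auto simp: lookup_add lookup_update lookup_single in_keys_iff)
  then show ?case using update assms by simp
qed (rule assms)

definition eval_free :: "('a \<Rightarrow> ('b, 'k) linop) \<Rightarrow> ('a free_monoid \<Rightarrow>\<^sub>0 'k::field) \<Rightarrow> ('b, 'k) linop"
  where "eval_free Y f = (\<Sum>w\<in>Poly_Mapping.keys f. scal (Poly_Mapping.lookup f w) * prod_list (map Y (letters w)))"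

text \<open>Keys may disappear when polynomials are added, so additivity is checked over a common
  finite set of words.\<close>

lemma eval_free_superset:
  "finite S \<Longrightarrow> Poly_Mapping.keys f \<subseteq> S \<Longrightarrow>
    eval_free Y f = (\<Sum>w\<in>S. scal (Poly_Mapping.lookup f w) * prod_list (map Y (letters w)))"
  unfolding eval_free_def by (rule sum.mono_neutral_left) (auto simp: in_keys_iff scal_0)

lemma eval_free_add: "eval_free Y (f + g) = eval_free Y f + eval_free Y g"
proof -
  let ?S = "Poly_Mapping.keys f \<union> Poly_Mapping.keys g"
  have "eval_free Y h = (\<Sum>w\<in>?S. scal (Poly_Mapping.lookup h w) * prod_list (map Y (letters w)))"
    if "h \<in> {f, g, f + g}" for h
    using that keys_add[of f g] by (intro eval_free_superset) auto
  then show ?thesis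
    by (simp add: lookup_add scal_add distrib_right sum.distrib)
qed

lemma eval_free_0: "eval_free Y 0 = 0"
  by (simp add: eval_free_def)

lemma eval_free_single: "eval_free Y (Poly_Mapping.single w c) = scal c * prod_list (map Y (letters w))"
  by (subst eval_free_superset[of "{w}"]) auto

lemma eval_free_mult: "eval_free Y (f * g) = eval_free Y f * eval_free Y g"
proof (induction f rule: poly_mapping_induct_add)
  case (2 w c)
  show ?case
  proof (induction g rule: poly_mapping_induct_add)
    case (2 v d)
    show ?case
      by (simp add: mult_single eval_free_single plus_free_monoid_def scal_mult mult.assoc
          central_mult_left[OF scal_central, of "prod_list _"])
  qed (simp_all add: eval_free_0 eval_free_add distrib_left)
qed (simp_all add: eval_free_0 eval_free_add distrib_right)

lemma eval_free_diff: "eval_free Y (f - g) = eval_free Y f - eval_free Y g"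
  using eval_free_add[of Y "f - g" g] by simp

lemma eval_free_sc: "eval_free Y (sc c) = scal c"
  by (simp add: eval_free_single zero_free_monoid_def)

lemma eval_free_gen: "eval_free Y (gen x) = Y x"
  by (simp add: gen_def eval_free_single scal_1)

lemma eval_free_1: "eval_free Y 1 = 1"
  using eval_free_sc[of Y 1] by (simp add: scal_1)

lemma eval_free_sum: "eval_free Y (sum f S) = (\<Sum>x\<in>S. eval_free Y (f x))"
  by (induction S rule: infinite_finite_induct) (simp_all add: eval_free_0 eval_free_add)

lemma eval_free_qdet:
  "eval_free Y (qdet (\<lambda>i j. gen (i, j)) (sc q) r K) = qdet (\<lambda>i j. Y (i, j)) (scal q) r K"
proof (induction r arbitrary: K)
  case Nil
  show ?case by (simp add: eval_free_0 eval_free_1)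
next
  case (Cons i r)
  have "eval_free Y ((- sc q) ^ e) = (- scal q) ^ e" for e
    by (simp only: sc_neg_power scal_neg_power eval_free_sc)
  then show ?case
    by (simp add: qdet.simps(2) eval_free_sum eval_free_mult eval_free_gen Cons)
qed

text \<open>A representative of [T] in the free algebra. Evaluation is defined on such
  representatives, and a relation between products of minors becomes membership in the ideal of
  relations.\<close>

definition free_tableau :: "nat \<Rightarrow> 'k::field \<Rightarrow> nat list list \<Rightarrow> ((nat \<times> nat) free_monoid \<Rightarrow>\<^sub>0 'k)"
  where "free_tableau m q T = prod_list (map (\<lambda>J. qdet (\<lambda>i j. gen (i, j)) (sc q) [1..<Suc m] (set J)) T)"

lemma eval_free_tableau:
  "eval_free Y (free_tableau m q T) =
    prod_list (map (\<lambda>J. qdet (\<lambda>i j. Y (i, j)) (scal q) [1..<Suc m] (set J)) T)"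
  by (induction T) (simp_all add: free_tableau_def eval_free_1 eval_free_mult eval_free_qdet del: upt_Suc)

text \<open>The kernel of the evaluation is an ideal containing the relators, hence contains the
  least such ideal.\<close>

lemma eval_free_ideal:
  fixes q :: "'k::field"
  assumes Y: "quantum_matrix (scal q) (scal (inverse q)) m n (\<lambda>i j. Y (i, j))" and f: "f \<in> qmat_ideal m n q"
  shows "eval_free Y f = 0"
proof -
  let ?F = "free_algebra (indices m n) :: ('k, _) module"
  interpret R: ring ?F by (rule free_algebra_ring)
  let ?I = "{f \<in> carrier ?F. eval_free Y f = 0}"
  have "ideal ?I ?F"
  proof (rule idealI[OF R.ring_axioms])
    show "subgroup ?I (add_monoid ?F)"
    proof (rule R.add.subgroupI)
      fix a assume a: "a \<in> ?I"
      have "\<ominus>\<^bsub>?F\<^esub> a = - a"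
        using a by (intro R.minus_equality) (auto simp: free_algebra_simps)
      then show "\<ominus>\<^bsub>?F\<^esub> a \<in> ?I"
        using a eval_free_diff[of Y 0 a] by (auto simp: eval_free_0 intro: free_algebra_uminus_closed)
    next
      fix a b assume "a \<in> ?I" "b \<in> ?I"
      then show "a \<oplus>\<^bsub>?F\<^esub> b \<in> ?I"
        using free_algebra_add_closed[of a _ b] by (simp add: eval_free_add free_algebra_simps(5))
    next
      show "?I \<noteq> {}" using eval_free_0 R.zero_closed by (auto simp: free_algebra_simps(4))
    qed auto
  next
    fix a x assume "a \<in> ?I" "x \<in> carrier ?F"
    then show "x \<otimes>\<^bsub>?F\<^esub> a \<in> ?I" "a \<otimes>\<^bsub>?F\<^esub> x \<in> ?I"
      using free_algebra_mult_closed[of a _ x] free_algebra_mult_closed[of x _ a]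
      by (simp_all add: eval_free_mult free_algebra_simps(2))
  qed
  moreover have "qmat_relators m n q \<subseteq> ?I"
  proof
    fix g assume g: "g \<in> qmat_relators m n q"
    note D = quantum_matrixD[OF Y]
    have "eval_free Y g = 0"
      using g unfolding qmat_relators_def Let_def
      by - (elim UnE CollectE exE conjE; simp only: eval_free_diff eval_free_mult eval_free_gen
          eval_free_sc scal_diff; auto simp: D(1,2,4) intro: D(3))
    then show "g \<in> ?I" using g qmat_relators_closed by auto
  qed
  ultimately have "qmat_ideal m n q \<subseteq> ?I"
    unfolding qmat_ideal_def by (rule R.genideal_minimal)
  then show ?thesis using f by auto
qed

text \<open>The index set is kept separate from the tableaux because it varies: a pair of tableaux
  when products are to be distinguished, a set of products when their linear independence is
  shown.\<close>

lemma free_tableaux_independent: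
  fixes q :: "'k::field"
  assumes q: "q \<noteq> 0" and m: "1 \<le> m" and A: "finite A" and T: "T ` A \<subseteq> preferred_tableaux m n" "inj_on T A"
    and zero: "(\<Sum>x\<in>A. sc (c x) * free_tableau m q (T x)) \<in> qmat_ideal m n q"
  shows "\<forall>x\<in>A. c x = 0"
proof (rule leads_independent[OF A])
  let ?Y = "\<lambda>(i, j). qmat_op q n m i j"
  have Y: "quantum_matrix (scal q) (scal (inverse q)) m n (\<lambda>i j. ?Y (i, j))"
    using quantum_matrix_qmat_op[OF q] by simp
  show "(\<Sum>x\<in>A. scal (c x) * eval_free ?Y (free_tableau m q (T x))) = 0"
    using eval_free_ideal[OF Y zero] by (simp add: eval_free_sum eval_free_mult eval_free_sc)
  show "has_lead (weight m n) (eval_free ?Y (free_tableau m q (T x))) ((tableau_exp \<circ> T) x)" if "x \<in> A" for x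
  proof -
    have "T x \<in> preferred_tableaux m n" using T that by auto
    then have "set (T x) \<subseteq> increasing_rows m n" by (simp add: preferred_tableaux_def)
    then show ?thesis
      unfolding eval_free_tableau comp_def
      using qmat_op_lead[OF q, of _ m m _ n] by (intro tableau_lead[OF q]) auto
  qed
  show "inj_on (tableau_exp \<circ> T) A"
    using T tableau_exp_inj[OF m, of n] by (intro comp_inj_on) (auto intro: inj_on_subset)
qed

section \<open>The quantum grassmannian\<close>

locale quantum_grassmannian =
  fixes m n :: nat and q :: "'k::field"
  assumes q: "q \<noteq> 0" and m: "1 \<le> m"
begin

abbreviation F :: "('k, (nat \<times> nat) free_monoid \<Rightarrow>\<^sub>0 'k) module"
  where "F \<equiv> free_algebra (indices m n)"

abbreviation proj :: "((nat \<times> nat) free_monoid \<Rightarrow>\<^sub>0 'k) \<Rightarrow> ((nat \<times> nat) free_monoid \<Rightarrow>\<^sub>0 'k) set"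
  where "proj f \<equiv> qmat_ideal m n q +>\<^bsub>F\<^esub> f"

sublocale R: ring F by (rule free_algebra_ring)
sublocale Q: ring "qmat m n q" by (rule qmat_ring)
sublocale QM: module "class_ring :: 'k ring" "qmat m n q" by (rule qmat_module)
sublocale Id: ideal "qmat_ideal m n q" F by (rule qmat_ideal_ideal)

lemma sc_closed: "sc c \<in> carrier F"
  by (simp add: free_algebra_simps zero_free_monoid_def)

lemma one_closed: "1 \<in> carrier F"
  using R.one_closed by (simp add: free_algebra_simps(3))

lemma R_minus: "x \<in> carrier F \<Longrightarrow> \<ominus>\<^bsub>F\<^esub> x = - x"
  by (intro R.minus_equality) (auto simp: free_algebra_simps)

sublocale quantum_matrix_mod "carrier F" "qmat_ideal m n q" "sc q" "sc (inverse q)" "\<lambda>i j. gen (i, j)" m n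
proof
  let ?I = "qmat_ideal m n q"
  have rel: "r \<in> ?I" if "r \<in> qmat_relators m n q" for r
    using that R.genideal_self[OF qmat_relators_closed[of m n q]] unfolding qmat_ideal_def by blast
  show "1 \<in> carrier F" by (rule one_closed)
  show "x - y \<in> carrier F" if "x \<in> carrier F" "y \<in> carrier F" for x y
    using that by (rule free_algebra_minus_closed)
  show "x * y \<in> carrier F" if "x \<in> carrier F" "y \<in> carrier F" for x y
    using that by (rule free_algebra_mult_closed)
  show sub: "?I \<subseteq> carrier F" using Id.a_subset .
  show "0 \<in> ?I" using Id.zero_closed by (simp add: free_algebra_simps(4))
  show "x - y \<in> ?I" if "x \<in> ?I" "y \<in> ?I" for x y
  proof -
    have "\<ominus>\<^bsub>F\<^esub> y = - y" using that sub by (intro R_minus) auto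
    moreover have "x \<oplus>\<^bsub>F\<^esub> (\<ominus>\<^bsub>F\<^esub> y) \<in> ?I" using that by (intro Id.a_closed Id.a_inv_closed)
    ultimately show ?thesis by (simp add: free_algebra_simps(5))
  qed
  show "x * y \<in> ?I" if "x \<in> carrier F" "y \<in> ?I" for x y
    using Id.I_l_closed[OF that(2,1)] by (simp add: free_algebra_simps(2))
  show "x * y \<in> ?I" if "x \<in> ?I" "y \<in> carrier F" for x y
    using Id.I_r_closed[OF that] by (simp add: free_algebra_simps(2))
  show "sc q \<in> carrier F" "sc (inverse q) \<in> carrier F" by (rule sc_closed)+
  show "sc q * x = x * sc q" for x :: "(nat \<times> nat) free_monoid \<Rightarrow>\<^sub>0 'k"
    by (rule single_mult_commute)
  show "sc q * sc (inverse q) = (1 :: (nat \<times> nat) free_monoid \<Rightarrow>\<^sub>0 'k)"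
    using q by (simp add: sc_1 flip: sc_mult)
  show "gen (i, j) \<in> carrier F" if "i \<in> {1..m}" "j \<in> {1..n}" for i j
    using that by (intro gen_closed) (auto simp: indices_def)
  show "gen (i, j) * gen (i, l) - sc q * (gen (i, l) * gen (i, j)) \<in> ?I"
    if "i \<in> {1..m}" "1 \<le> j" "j < l" "l \<le> n" for i j l
    using that by (intro rel) (unfold qmat_relators_def Let_def, blast)
  show "gen (i, j) * gen (k, j) - sc q * (gen (k, j) * gen (i, j)) \<in> ?I"
    if "1 \<le> i" "i < k" "k \<le> m" "j \<in> {1..n}" for i j k
    using that by (intro rel) (unfold qmat_relators_def Let_def, blast)
  show "gen (i, l) * gen (k, j) - gen (k, j) * gen (i, l) \<in> ?I"
    if "1 \<le> i" "i < k" "k \<le> m" "1 \<le> j" "j < l" "l \<le> n" for i j k l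
    using that by (intro rel) (unfold qmat_relators_def Let_def, blast)
  show "gen (i, j) * gen (k, l) - gen (k, l) * gen (i, j) - (sc q - sc (inverse q)) * (gen (i, l) * gen (k, j)) \<in> ?I"
    if "1 \<le> i" "i < k" "k \<le> m" "1 \<le> j" "j < l" "l \<le> n" for i j k l
    unfolding sc_diff[symmetric]
    using that by (intro rel) (unfold qmat_relators_def Let_def, blast)
qed

notation cong (infix "\<approx>" 50)

lemma proj_closed: "f \<in> carrier F \<Longrightarrow> proj f \<in> carrier (qmat m n q)"
  by (rule qmat_coset_closed)

lemma proj_eq_iff:
  assumes "f \<in> carrier F" "g \<in> carrier F"
  shows "proj f = proj g \<longleftrightarrow> f \<approx> g"
proof
  assume "proj f = proj g"
  then have "f \<in> proj g" using Id.a_rcos_self[OF assms(1)] by simp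
  then obtain h where "h \<in> qmat_ideal m n q" "f = h + g"
    by (auto simp: a_r_coset_def' free_algebra_simps(5))
  then show "f \<approx> g" by (simp add: cong_def)
next
  assume "f \<approx> g"
  then have "(f - g) \<oplus>\<^bsub>F\<^esub> g \<in> proj g" by (auto simp: cong_def a_r_coset_def')
  then have "f \<in> proj g" by (simp add: free_algebra_simps(5))
  then show "proj f = proj g" using Id.a_repr_independence'[OF _ assms(2)] by simp
qed

lemma proj_add: "f \<in> carrier F \<Longrightarrow> g \<in> carrier F \<Longrightarrow> proj (f + g) = proj f \<oplus>\<^bsub>qmat m n q\<^esub> proj g"
  by (simp add: qmat_coset_add free_algebra_simps(5))

lemma proj_mult: "f \<in> carrier F \<Longrightarrow> g \<in> carrier F \<Longrightarrow> proj (f * g) = proj f \<otimes>\<^bsub>qmat m n q\<^esub> proj g"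
  by (simp add: qmat_coset_mult free_algebra_simps(2))

lemma proj_smult: "f \<in> carrier F \<Longrightarrow> proj (sc c * f) = c \<odot>\<^bsub>qmat m n q\<^esub> proj f"
  by (simp add: qmat_smult_coset free_algebra_simps(6))

lemma proj_0: "proj 0 = \<zero>\<^bsub>qmat m n q\<^esub>"
proof -
  have "proj \<zero>\<^bsub>F\<^esub> = qmat_ideal m n q" by (rule Id.a_rcos_const[OF Id.zero_closed])
  then show ?thesis
    by (simp add: qmat_def quot_algebra_simps FactRing_simps free_algebra_simps(4))
qed

lemma proj_1: "proj 1 = \<one>\<^bsub>qmat m n q\<^esub>"
  by (simp add: qmat_def quot_algebra_simps FactRing_simps free_algebra_simps(3))

lemma proj_prod_list:
  assumes "set xs \<subseteq> carrier F"
  shows "prod_list xs \<in> carrier F" "proj (prod_list xs) = list_prod (qmat m n q) (map proj xs)"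
proof -
  have closed: "prod_list xs \<in> carrier F" if "set xs \<subseteq> carrier F" for xs
    using that by (induction xs) (auto intro: mult_A one_A)
  show "prod_list xs \<in> carrier F" using assms by (rule closed)
  show "proj (prod_list xs) = list_prod (qmat m n q) (map proj xs)"
    using assms
  proof (induction xs)
    case Nil
    show ?case by (simp add: list_prod_def proj_1)
  next
    case (Cons x xs)
    then show ?case using closed[of xs] by (simp add: list_prod_def proj_mult)
  qed
qed

text \<open>\<open>V\<close> is the whole quotient algebra for the sum defining a minor, and the
  grassmannian for linear combinations of products; the two share addition and zero.\<close>

lemma finsum_proj:
  assumes V: "abelian_monoid V" "add V = add (qmat m n q)" "zero V = zero (qmat m n q)"
    and g: "\<And>x. x \<in> S \<Longrightarrow> g x \<in> carrier F" "\<And>x. x \<in> S \<Longrightarrow> proj (g x) \<in> carrier V"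
    and f: "\<And>x. x \<in> S \<Longrightarrow> f x = proj (g x)" and S: "finite S"
  shows "finsum V f S = proj (sum g S)"
  using S g f
proof (induction S)
  case empty
  interpret V: abelian_monoid V by (rule V(1))
  show ?case by (simp add: proj_0 V(3))
next
  case (insert x S)
  interpret V: abelian_monoid V by (rule V(1))
  have "f \<in> S \<rightarrow> carrier V" "f x \<in> carrier V" using insert by auto
  then have "finsum V f (insert x S) = f x \<oplus>\<^bsub>V\<^esub> finsum V f S"
    using insert by (intro V.finsum_insert) auto
  also have "\<dots> = proj (g x) \<oplus>\<^bsub>qmat m n q\<^esub> proj (sum g S)"
    using insert by (simp add: V(2))
  also have "\<dots> = proj (g x + sum g S)"
    using insert by (intro proj_add[symmetric] sum_A) auto
  finally show ?case using insert by simp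
qed

section \<open>Minors and tableau products as cosets\<close>

abbreviation rdet :: "nat list \<Rightarrow> (nat \<times> nat) free_monoid \<Rightarrow>\<^sub>0 'k"
  where "rdet J \<equiv> qdet (\<lambda>i j. gen (i, j)) (sc q) [1..<Suc m] (set J)"

lemma rdet_closed: "J \<in> increasing_rows m n \<Longrightarrow> rdet J \<in> carrier F"
  by (intro qdet_A) (auto simp: increasing_rows_def)

lemma qminor_eq_proj:
  assumes J: "J \<in> increasing_rows m n"
  shows "qminor m n q J = proj (rdet J)"
proof -
  let ?g = "\<lambda>\<sigma>. sc ((- q) ^ perm_length m \<sigma>) *
    prod_list (map (\<lambda>i. gen (Suc i, J ! \<sigma> i) :: (nat \<times> nat) free_monoid \<Rightarrow>\<^sub>0 'k) [0..<m])"
  have J': "length J = m" "set J \<subseteq> {1..n}" using J by (auto simp: increasing_rows_def)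
  have gens: "set (map (\<lambda>i. gen (Suc i, J ! \<sigma> i) :: (nat \<times> nat) free_monoid \<Rightarrow>\<^sub>0 'k) [0..<m]) \<subseteq> carrier F"
    if "\<sigma> permutes {..<m}" for \<sigma>
  proof -
    have "gen (Suc i, J ! \<sigma> i) \<in> carrier F" if "i < m" for i
    proof (rule X_A)
      have "\<sigma> i < length J"
        using permutes_in_image[OF \<open>\<sigma> permutes {..<m}\<close>, of i] that J' by simp
      then show "J ! \<sigma> i \<in> {1..n}" using J'(2) nth_mem by blast
    qed (use that in simp)
    then show ?thesis by auto
  qed
  have "qminor m n q J = proj (\<Sum>\<sigma> | \<sigma> permutes {..<m}. ?g \<sigma>)"
    unfolding qminor_def
  proof (rule finsum_proj)
    show "abelian_monoid (qmat m n q)" by (rule Q.abelian_monoid_axioms)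
    show "finite {\<sigma>. \<sigma> permutes {..<m}}" by (rule finite_permutations) simp
    fix \<sigma> assume "\<sigma> \<in> {\<sigma>. \<sigma> permutes {..<m}}"
    then have g: "set (map (\<lambda>i. gen (Suc i, J ! \<sigma> i) :: (nat \<times> nat) free_monoid \<Rightarrow>\<^sub>0 'k) [0..<m]) \<subseteq> carrier F"
      using gens by blast
    show "?g \<sigma> \<in> carrier F" by (intro mult_A sc_closed proj_prod_list(1)[OF g])
    then show "proj (?g \<sigma>) \<in> carrier (qmat m n q)" by (rule proj_closed)
    have "proj (?g \<sigma>) = (- q) ^ perm_length m \<sigma> \<odot>\<^bsub>qmat m n q\<^esub>
      list_prod (qmat m n q) (map proj (map (\<lambda>i. gen (Suc i, J ! \<sigma> i)) [0..<m]))"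
      by (simp only: proj_smult[OF proj_prod_list(1)[OF g]] proj_prod_list(2)[OF g])
    then show "(- q) ^ perm_length m \<sigma> \<odot>\<^bsub>qmat m n q\<^esub>
      list_prod (qmat m n q) (map (\<lambda>i. qmat_gen m n q (Suc i) (J ! \<sigma> i)) [0..<m]) = proj (?g \<sigma>)"
      by (simp add: qmat_gen_def comp_def)
  qed simp_all
  also have "(\<Sum>\<sigma> | \<sigma> permutes {..<m}. ?g \<sigma>) = rdet J"
    unfolding qdet_eq_sum_permutations[OF q_central J] sc_neg_power ..
  finally show ?thesis .
qed

abbreviation tab :: "nat list list \<Rightarrow> (nat \<times> nat) free_monoid \<Rightarrow>\<^sub>0 'k"
  where "tab \<equiv> free_tableau m q"

lemma tab_closed: "set T \<subseteq> increasing_rows m n \<Longrightarrow> tab T \<in> carrier F"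
  unfolding free_tableau_def by (intro proj_prod_list(1), unfold set_map) (use rdet_closed in blast)

lemma tableau_prod_eq_proj:
  assumes "set T \<subseteq> increasing_rows m n"
  shows "tableau_prod m n q T = proj (tab T)"
proof -
  have "map (qminor m n q) T = map proj (map rdet T)"
    using assms qminor_eq_proj by (auto simp del: upt_Suc)
  moreover have "set (map rdet T) \<subseteq> carrier F"
    using assms rdet_closed by (auto simp del: upt_Suc)
  ultimately show ?thesis
    by (simp only: tableau_prod_def free_tableau_def proj_prod_list(2))
qed

text \<open>The bridge between the two expansions: \<open>tab\<close> multiplies row determinants,
  as in the definition of the minors, and \<open>tableau\<close> multiplies column determinants, as
  in straightening.\<close>

lemma tab_cong_tableau: "set T \<subseteq> increasing_rows m n \<Longrightarrow> tab T \<approx> tableau T"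
proof (induction T)
  case Nil
  show ?case by (simp add: free_tableau_def tableau_def)
next
  case (Cons J T)
  then have J: "J \<in> increasing_rows m n" by simp
  then have J': "set J \<subseteq> {1..n}" "sorted_list_of_set (set J) = J"
    by (auto simp: increasing_rows_def strict_sorted_iff sorted_list_of_set.idem_if_sorted_distinct)
  have rows: "sorted_list_of_set {1..m} = [1..<Suc m]"
    by (metis atLeastLessThanSuc_atLeastAtMost sorted_list_of_set_range)
  have "rdet J \<approx> cdet J"
    using qdet_transpose[of "{1..m}" "set J"] J' rows unfolding cdet_def by simp
  then have "rdet J * tab T \<approx> cdet J * tableau T"
    using Cons J' by (intro cong_mult tab_closed cdet_A) auto
  then show ?case by (simp add: free_tableau_def tableau_def del: upt_Suc)
qed

section \<open>The span of the preferred tableaux\<close>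

definition comb :: "(nat list list \<Rightarrow> 'k) \<Rightarrow> nat list list set \<Rightarrow> (nat \<times> nat) free_monoid \<Rightarrow>\<^sub>0 'k"
  where "comb c S = (\<Sum>T\<in>S. sc (c T) * tab T)"

lemma preferred_rows: "T \<in> preferred_tableaux m n \<Longrightarrow> set T \<subseteq> increasing_rows m n"
  by (simp add: preferred_tableaux_def)

lemma comb_closed: "S \<subseteq> preferred_tableaux m n \<Longrightarrow> comb c S \<in> carrier F"
  unfolding comb_def by (intro sum_A mult_A sc_closed tab_closed preferred_rows) auto

text \<open>Formed from representatives in the free algebra instead of cosets, so that straightening
  applies to it as it stands.\<close>

definition standard_span :: "((nat \<times> nat) free_monoid \<Rightarrow>\<^sub>0 'k) set"
  where "standard_span = {x. \<exists>c S. finite S \<and> S \<subseteq> preferred_tableaux m n \<and> x \<approx> comb c S}"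

lemma standard_spanI: "finite S \<Longrightarrow> S \<subseteq> preferred_tableaux m n \<Longrightarrow> x \<approx> comb c S \<Longrightarrow> x \<in> standard_span"
  unfolding standard_span_def by blast

lemma standard_spanE:
  assumes "x \<in> standard_span"
  obtains c S where "finite S" "S \<subseteq> preferred_tableaux m n" "x \<approx> comb c S"
  using assms unfolding standard_span_def by blast

lemma standard_span_smult:
  assumes "x \<in> standard_span"
  shows "sc a * x \<in> standard_span"
proof -
  obtain c S where S: "finite S" "S \<subseteq> preferred_tableaux m n" "x \<approx> comb c S"
    using assms by (rule standard_spanE)
  have "sc a * x \<approx> sc a * comb c S" by (intro cong_mult_left sc_closed S)
  also have "sc a * comb c S = comb (\<lambda>T. a * c T) S"
    by (simp add: comb_def sum_distrib_left sc_mult mult.assoc)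
  finally show ?thesis by (rule standard_spanI[OF S(1,2)])
qed

lemma standard_span_add:
  assumes "x \<in> standard_span" "y \<in> standard_span"
  shows "x + y \<in> standard_span"
proof -
  obtain c S where S: "finite S" "S \<subseteq> preferred_tableaux m n" "x \<approx> comb c S"
    using assms(1) by (rule standard_spanE)
  obtain d U where U: "finite U" "U \<subseteq> preferred_tableaux m n" "y \<approx> comb d U"
    using assms(2) by (rule standard_spanE)
  \<comment> \<open>Coefficients are continued by 0 to the union of the two supports.\<close>
  let ?e = "\<lambda>e V T. if T \<in> V then e T else 0"
  have ext: "comb e V = comb (?e e V) (S \<union> U)" if "V \<subseteq> S \<union> U" for e V
    unfolding comb_def using S(1) U(1) that by (intro sum.mono_neutral_cong_left) auto
  have "x + y \<approx> comb c S + comb d U" by (intro cong_add S U)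
  also have "comb c S + comb d U = comb (\<lambda>T. ?e c S T + ?e d U T) (S \<union> U)"
    using ext[of S c] ext[of U d] by (simp add: comb_def sc_add distrib_right sum.distrib)
  finally show ?thesis using S U by (intro standard_spanI) auto
qed

lemma standard_span_cong: "x \<in> standard_span \<Longrightarrow> y \<approx> x \<Longrightarrow> y \<in> standard_span"
  by (elim standard_spanE) (rule standard_spanI, auto intro: cong_trans)

lemma standard_span_0: "0 \<in> standard_span"
  by (rule standard_spanI[of "{}"]) (simp_all add: comb_def)

lemma standard_span_sum: "(\<And>x. x \<in> S \<Longrightarrow> f x \<in> standard_span) \<Longrightarrow> sum f S \<in> standard_span"
  by (induction S rule: infinite_finite_induct) (auto simp: standard_span_0 standard_span_add)

lemma standard_span_tab:
  assumes "set T \<subseteq> increasing_rows m n"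
  shows "tab T \<in> standard_span"
proof -
  have "straightening_closed standard_span"
    unfolding straightening_closed_def
  proof (intro conjI ballI allI impI)
    fix x y assume "x \<in> standard_span" "y \<in> standard_span"
    then have "x + sc (- 1) * y \<in> standard_span" by (intro standard_span_add standard_span_smult)
    then show "x - y \<in> standard_span" by (simp add: sc_uminus sc_1)
  qed (auto intro: standard_span_0 standard_span_smult standard_span_cong)
  moreover have "tableau U \<in> standard_span" if "U \<in> preferred_tableaux m n" for U
  proof (rule standard_spanI[of "{U}"])
    show "tableau U \<approx> comb (\<lambda>_. 1) {U}"
      using cong_sym[OF tab_cong_tableau[OF preferred_rows[OF that]]] by (simp add: comb_def sc_1)
  qed (use that in auto)
  ultimately have "tableau T \<in> standard_span" using assms by (rule straighten)
  then show ?thesis using tab_cong_tableau[OF assms] by (rule standard_span_cong)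
qed

text \<open>The product of two tableaux is the tableau of the concatenated rows. It need not be
  preferred, but straightening brings it back into the span.\<close>

lemma standard_span_mult:
  assumes "x \<in> standard_span" "y \<in> standard_span" "y \<in> carrier F"
  shows "x * y \<in> standard_span"
proof -
  obtain c S where S: "finite S" "S \<subseteq> preferred_tableaux m n" "x \<approx> comb c S"
    using assms(1) by (rule standard_spanE)
  obtain d U where U: "finite U" "U \<subseteq> preferred_tableaux m n" "y \<approx> comb d U"
    using assms(2) by (rule standard_spanE)
  have "comb c S * comb d U = (\<Sum>T\<in>S. \<Sum>T'\<in>U. sc (c T) * (sc (d T') * tab (T @ T')))"
    unfolding comb_def sum_product
  proof (intro sum.cong refl)
    fix T T'
    have "tab T * (sc (d T') * tab T') = sc (d T') * (tab T * tab T')"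
      by (rule central_mult_left[OF single_mult_commute])
    then show "sc (c T) * tab T * (sc (d T') * tab T') = sc (c T) * (sc (d T') * tab (T @ T'))"
      by (simp add: mult.assoc free_tableau_def)
  qed
  also have "\<dots> \<in> standard_span"
    using S(2) U(2) preferred_rows
    by (intro standard_span_sum standard_span_smult standard_span_tab) fastforce
  finally show ?thesis
    by (rule standard_span_cong) (intro cong_mult S U comb_closed assms)
qed

lemma is_subalgebra_proj_standard_span:
  "is_subalgebra (qmat m n q) (proj ` (standard_span \<inter> carrier F))"
proof -
  let ?B = "proj ` (standard_span \<inter> carrier F)"
  have sub: "?B \<subseteq> carrier (qmat m n q)" using proj_closed by blast
  have one: "\<one>\<^bsub>qmat m n q\<^esub> \<in> ?B"
    using standard_span_tab[of "[]"] one_closed by (auto simp: free_tableau_def simp flip: proj_1)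
  have add: "x \<oplus>\<^bsub>qmat m n q\<^esub> y \<in> ?B" if "x \<in> ?B" "y \<in> ?B" for x y
    using that by (auto simp flip: proj_add intro!: imageI standard_span_add add_A)
  have mult: "x \<otimes>\<^bsub>qmat m n q\<^esub> y \<in> ?B" if "x \<in> ?B" "y \<in> ?B" for x y
    using that by (auto simp flip: proj_mult intro!: imageI standard_span_mult mult_A)
  have smult: "c \<odot>\<^bsub>qmat m n q\<^esub> x \<in> ?B" if "x \<in> ?B" for x c
    using that by (auto simp flip: proj_smult intro!: imageI standard_span_smult mult_A sc_closed)
  have neg: "\<ominus>\<^bsub>qmat m n q\<^esub> x \<in> ?B" if "x \<in> ?B" for x
  proof -
    have x: "x \<in> carrier (qmat m n q)" using that sub by blast
    have "\<ominus>\<^bsub>qmat m n q\<^esub> x = (- 1) \<odot>\<^bsub>qmat m n q\<^esub> x"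
    proof (rule Q.minus_equality)
      have "(- 1 + 1) \<odot>\<^bsub>qmat m n q\<^esub> x = (- 1) \<odot>\<^bsub>qmat m n q\<^esub> x \<oplus>\<^bsub>qmat m n q\<^esub> 1 \<odot>\<^bsub>qmat m n q\<^esub> x"
        using QM.smult_l_distr[of "- 1" 1 x] x by simp
      then show "(- 1) \<odot>\<^bsub>qmat m n q\<^esub> x \<oplus>\<^bsub>qmat m n q\<^esub> x = \<zero>\<^bsub>qmat m n q\<^esub>"
        using QM.smult_l_null[of x] QM.smult_one[of x] x by simp
    qed (use x QM.smult_closed[of "- 1" x] in auto)
    then show ?thesis using smult[OF that] by simp
  qed
  have "\<zero>\<^bsub>qmat m n q\<^esub> \<in> ?B"
    using standard_span_0 zero_A by (auto simp flip: proj_0)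
  then show ?thesis
    unfolding is_subalgebra_def
    using sub one add mult smult neg
    by (intro conjI Q.subringI QM.submoduleI) auto
qed

text \<open>The image of the span is a subalgebra, and it contains every minor as a tableau with a
  single row. The grassmannian, being generated by the minors, is therefore contained in it.\<close>

lemma carrier_qgrass_subset:
  assumes "x \<in> carrier (qgrass m n q)"
  obtains c S where "finite S" "S \<subseteq> preferred_tableaux m n" "x = proj (comb c S)"
proof -
  have "qminor m n q ` increasing_rows m n \<subseteq> proj ` (standard_span \<inter> carrier F)"
  proof
    fix x assume "x \<in> qminor m n q ` increasing_rows m n"
    then obtain J where J: "J \<in> increasing_rows m n" "x = proj (rdet J)"
      using qminor_eq_proj by auto
    moreover have "rdet J \<in> standard_span"
      using standard_span_tab[of "[J]"] J by (simp add: free_tableau_def del: upt_Suc)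
    ultimately show "x \<in> proj ` (standard_span \<inter> carrier F)"
      using rdet_closed by blast
  qed
  then have "is_subalgebra (qmat m n q) hull (qminor m n q ` increasing_rows m n)
      \<subseteq> proj ` (standard_span \<inter> carrier F)"
    using is_subalgebra_proj_standard_span by (rule hull_minimal)
  then have "x \<in> proj ` (standard_span \<inter> carrier F)"
    using assms by (auto simp: qgrass_def generated_subalgebra_def)
  then obtain f where f: "f \<in> standard_span" "f \<in> carrier F" "x = proj f" by blast
  obtain c S where S: "finite S" "S \<subseteq> preferred_tableaux m n" "f \<approx> comb c S"
    using f(1) by (rule standard_spanE)
  then have "x = proj (comb c S)"
    using f proj_eq_iff[OF f(2) comb_closed[OF S(2)]] by simp
  then show ?thesis using that S by blast
qed

lemma tableau_prod_qgrass:
  assumes "set T \<subseteq> increasing_rows m n"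
  shows "tableau_prod m n q T \<in> carrier (qgrass m n q)"
proof -
  let ?B = "carrier (qgrass m n q)"
  interpret S: subring ?B "qmat m n q"
    using qgrass_subalgebra[of m n q] by (simp add: is_subalgebra_def)
  have "qminor m n q ` increasing_rows m n \<subseteq> ?B"
    by (simp add: qgrass_def generated_subalgebra_def hull_subset)
  with assms show ?thesis
    by (induction T) (auto simp: tableau_prod_def list_prod_def)
qed

text \<open>A basis given as a set of products would not reveal two tableaux with the same product.
  Such a coincidence would be a relation with coefficients 1 and - 1.\<close>

lemma inj_on_tableau_prod: "inj_on (tableau_prod m n q) (preferred_tableaux m n)"
proof (rule inj_onI, rule ccontr)
  fix S T assume S: "S \<in> preferred_tableaux m n" and T: "T \<in> preferred_tableaux m n"
    and eq: "tableau_prod m n q S = tableau_prod m n q T" and "S \<noteq> T"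
  have "tab S \<approx> tab T"
    using eq S T proj_eq_iff[OF tab_closed tab_closed] by (simp add: tableau_prod_eq_proj preferred_rows)
  then have "(\<Sum>U\<in>{S, T}. sc (if U = S then 1 else - 1) * tab U) \<in> qmat_ideal m n q"
    using \<open>S \<noteq> T\<close> by (simp add: cong_def sc_1 sc_uminus)
  then have "\<forall>U\<in>{S, T}. (if U = S then 1 else - 1) = (0 :: 'k)"
    using S T by (intro free_tableaux_independent[where T = "\<lambda>U. U", OF q m]) auto
  then show False by simp
qed

theorem basis_tableau_prod:
  "vectorspace.basis (class_ring :: 'k ring) (qgrass m n q) (tableau_prod m n q ` preferred_tableaux m n)"
proof -
  let ?V = "qgrass m n q" and ?P = "preferred_tableaux m n"
  let ?tp = "tableau_prod m n q"
  interpret V: vectorspace "class_ring :: 'k ring" ?V by (rule qgrass_vectorspace)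
  have V_simps: "add ?V = add (qmat m n q)" "zero ?V = zero (qmat m n q)"
    "module.smult ?V = module.smult (qmat m n q)"
    by (simp_all add: qgrass_def generated_subalgebra_def)
  have sub: "?tp ` ?P \<subseteq> carrier ?V" using tableau_prod_qgrass preferred_rows by blast
  \<comment> \<open>The basis vectors are cosets; each is traced back to its tableau, which turns
    linear combinations of products into cosets of combinations of \<open>tab\<close>.\<close>
  define rep where "rep = inv_into ?P ?tp"
  have rep: "rep v \<in> ?P" "?tp (rep v) = v" if "v \<in> ?tp ` ?P" for v
    unfolding rep_def using that by (rule inv_into_into, rule f_inv_into_f)
  have lincomb: "V.lincomb a A = proj (\<Sum>v\<in>A. sc (a v) * tab (rep v))"
    if A: "finite A" "A \<subseteq> ?tp ` ?P" for a A
    unfolding V.lincomb_def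
  proof (rule finsum_proj[OF _ V_simps(1,2)])
    show "abelian_monoid ?V" by (rule V.abelian_monoid_axioms)
    fix v assume v: "v \<in> A"
    then have v': "rep v \<in> ?P" "?tp (rep v) = v" "v \<in> carrier ?V" using rep A sub by auto
    then have t: "tab (rep v) \<in> carrier F" by (intro tab_closed preferred_rows)
    show "sc (a v) * tab (rep v) \<in> carrier F" by (intro mult_A sc_closed t)
    show eq: "a v \<odot>\<^bsub>?V\<^esub> v = proj (sc (a v) * tab (rep v))"
      using v' by (simp add: proj_smult[OF t] V_simps(3) flip: tableau_prod_eq_proj[OF preferred_rows])
    show "proj (sc (a v) * tab (rep v)) \<in> carrier ?V"
      unfolding eq[symmetric] using v'(3) by (intro V.smult_closed) auto
  qed (rule A(1))
  have "V.lin_indpt (?tp ` ?P)"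
  proof
    assume "V.lin_dep (?tp ` ?P)"
    then obtain A a v where A: "finite A" "A \<subseteq> ?tp ` ?P" "V.lincomb a A = \<zero>\<^bsub>?V\<^esub>" "v \<in> A" "a v \<noteq> 0"
      unfolding V.lin_dep_def by auto
    have "(\<Sum>v\<in>A. sc (a v) * tab (rep v)) \<in> carrier F"
      using A rep by (intro sum_A mult_A sc_closed tab_closed preferred_rows) auto
    moreover have "proj (\<Sum>v\<in>A. sc (a v) * tab (rep v)) = proj 0"
      using A(3) lincomb[OF A(1,2)] by (simp add: V_simps proj_0)
    ultimately have "(\<Sum>v\<in>A. sc (a v) * tab (rep v)) \<in> qmat_ideal m n q"
      using proj_eq_iff[OF _ zero_A] by (simp add: cong_0_iff)
    then have "\<forall>v\<in>A. a v = 0"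
    proof (rule free_tableaux_independent[OF q m A(1), rotated 2])
      show "rep ` A \<subseteq> ?P" using rep(1) A(2) by blast
      show "inj_on rep A" using rep(2) A(2) by (metis inj_onI subsetD)
    qed
    then show False using A by blast
  qed
  moreover have "V.span (?tp ` ?P) = carrier ?V"
  proof
    show "V.span (?tp ` ?P) \<subseteq> carrier ?V" using sub by (rule V.span_is_subset2)
    show "carrier ?V \<subseteq> V.span (?tp ` ?P)"
    proof
      fix x assume "x \<in> carrier ?V"
      then obtain c S where S: "finite S" "S \<subseteq> ?P" "x = proj (comb c S)"
        by (rule carrier_qgrass_subset)
      \<comment> \<open>Summing over products instead of tableaux must not merge any terms.\<close>
      have inj: "inj_on ?tp S" using inj_on_tableau_prod S(2) by (rule inj_on_subset)
      have "rep (?tp T) = T" if "T \<in> S" for T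
        using that S(2) inj_on_tableau_prod by (auto simp: rep_def inv_into_f_f)
      then have "comb c S = (\<Sum>v\<in>?tp ` S. sc (c (rep v)) * tab (rep v))"
        unfolding comb_def by (simp add: sum.reindex[OF inj])
      then have "x = V.lincomb (\<lambda>v. c (rep v)) (?tp ` S)"
        using S by (subst lincomb) auto
      then show "x \<in> V.span (?tp ` ?P)"
        unfolding V.span_def
        by (intro CollectI exI[of _ "?tp ` S"] exI[of _ "\<lambda>v. c (rep v)"]) (use S in auto)
    qed
  qed
  ultimately show ?thesis unfolding V.basis_def using sub by blast
qed

end

theorem corollary2p8:
  fixes q :: "'k::field" and m n :: nat
  assumes "q \<noteq> 0" and "1 \<le> m" and "m \<le> n"
  shows "inj_on (tableau_prod m n q) (preferred_tableaux m n) \<and>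
    vectorspace.basis (class_ring :: 'k ring) (qgrass m n q)
      (tableau_prod m n q ` preferred_tableaux m n)"
proof -
  interpret quantum_grassmannian m n q using assms by unfold_locales
  show ?thesis using inj_on_tableau_prod basis_tableau_prod by blast
qed

end
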